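(* Let $\Omega\subseteq\mathbb{R}^n$ be open and let $P$ be a first-order partial differential operator with coefficients in $\mathcal{G}(\Omega)$, represented by $P_\varepsilon(x,\xi)=\sum_{j=1}^n a_j^\varepsilon(x)\xi_j+a_0^\varepsilon(x)$, whose coefficients have slow scale $\varepsilon$-growth on compact sets in each derivative, i.e. for every compact $K\subset\Omega$, every $\alpha\in\mathbb{N}_0^n$ and every $k=0,\dots,n$ the net $\big(\sup_{x\in K}|\partial^\alpha a_k^\varepsilon(x)|\big)_\varepsilon$ is slow scale. Let $P_{\varepsilon,1}(x,\xi)=\sum_{j=1}^n a_j^\varepsilon(x)\xi_j$. Let $(x_0,\xi_0)\in\Omega\times(\mathbb{R}^n\setminus\{0\})$ and let $U\times\Gamma$ be an open conic neighborhood of $(x_0,\xi_0)$ ($U\ni x_0$ open in $\Omega$, $\Gamma\ni\xi_0$ an open cone in $\mathbb{R}^n\setminus\{0\}$) such that for each compact $K\subset U$ there are slow scale nets $s_\varepsilon,r_\varepsilon>0$ and $\varepsilon_0>0$ with $$|P_{\varepsilon,1}(x,\xi)|\ge\frac{1}{s_\varepsilon}(1+|\xi|)$$ for all $(x,\xi)\in K\times\Gamma$, $|\xi|\ge r_\varepsilon$, and $0<\varepsilon<\varepsilon_0$. Then for any $u\in\mathcal{G}(\Omega)$, $(x_0,\xi_0)\notin\mathrm{WF}_g(Pu)$ implies $(x_0,\xi_0)\notin\mathrm{WF}_g(u)$.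
   Context: Colombeau algebra: $\mathcal{E}_M(\Omega)$ is the set of families $(u_\varepsilon)_{\varepsilon\in(0,1]}$ of functions $u_\varepsilon\in C^\infty(\Omega)$ such that for all compact $K\subset\Omega$ and all $\alpha\in\mathbb{N}_0^n$ there is $p\ge0$ with $\sup_{x\in K}|\partial^\alpha u_\varepsilon(x)|=O(\varepsilon^{-p})$ as $\varepsilon\to0$. $\mathcal{N}(\Omega)$ is the set of families such that for all compact $K\subset\Omega$, all $\alpha$ and all $q\ge0$, $\sup_{x\in K}|\partial^\alpha u_\varepsilon(x)|=O(\varepsilon^q)$. $\mathcal{G}(\Omega)=\mathcal{E}_M(\Omega)/\mathcal{N}(\Omega)$; classes are written $[(u_\varepsilon)_\varepsilon]$. Operators: with $D=(-i\partial_1,\dots,-i\partial_n)$, an operator with symbol family $P_\varepsilon(x,\xi)=\sum_{|\alpha|\le m}a^\varepsilon_\alpha(x)\xi^\alpha$, $a_\alpha=[(a_\alpha^\varepsilon)_\varepsilon]\in\mathcal{G}(\Omega)$, acts by $Pu=[(P_\varepsilon(x,D)u_\varepsilon)_\varepsilon]$, $P_\varepsilon(x,D)=\sum_{|\alpha|\le m}a_\alpha^\varepsilon(x)D^\alpha$. Slow scale: a net $(r_\varepsilon)_{\varepsilon\in(0,1]}$ of complex numbers with $|r_\varepsilon|=O(\varepsilon^{-p})$ for some $p$ is a slow scale net if for all $t\ge0$ there is $\varepsilon_t>0$ with $|r_\varepsilon|^t\le\varepsilon^{-1}$ for all $\varepsilon\in(0,\varepsilon_t)$. Generalized wave front set: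 $u=[(u_\varepsilon)_\varepsilon]\in\mathcal{G}(\Omega)$ is microlocally regular at $(x_0,\xi_0)\in\Omega\times(\mathbb{R}^n\setminus\{0\})$ if there are an open neighborhood $U$ of $x_0$ and a conic neighborhood $\Gamma$ of $\xi_0$ such that for all $\varphi\in\mathcal{D}(U)=C_c^\infty(U)$: there is $N\in\mathbb{R}$ such that for all $l\in\mathbb{N}_0$ there are $C>0$, $\varepsilon_0>0$ with $|\widehat{\varphi u_\varepsilon}(\xi)|\le C\varepsilon^{-N}(1+|\xi|)^{-l}$ for all $\xi\in\Gamma$, $\varepsilon\in(0,\varepsilon_0)$, where $\widehat{v}(\xi)=\int v(x)e^{-i\xi x}dx$. $\mathrm{WF}_g(u)$ is the complement in $\Omega\times(\mathbb{R}^n\setminus\{0\})$ of the set of points where $u$ is microlocally regular. *)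

theory Defs
  imports "HOL-Analysis.Analysis" "HOL-Library.Landau_Symbols"
begin

definition pderiv_at :: "'n::finite \<Rightarrow> (real^'n \<Rightarrow> complex) \<Rightarrow> real^'n \<Rightarrow> complex" where
  "pderiv_at i f = (\<lambda>x. frechet_derivative f (at x) (axis i 1))"

text \<open>Functions on an open set are represented by total functions whose values off the set are
  irrelevant. A function is of class \<open>C\<^sup>\<infinity>\<close> iff all its iterated partial derivatives
  (of every order, in every sequence of directions) are differentiable; each of them is then
  continuous, and \<open>pderiv_at\<close> is the genuine partial derivative at every stage.\<close>

definition smooth_on :: "(real^'n::finite) set \<Rightarrow> (real^'n \<Rightarrow> complex) \<Rightarrow> bool" where
  "smooth_on \<Omega> f \<longleftrightarrow> (\<forall>is. foldr pderiv_at is f differentiable_on \<Omega>)"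

text \<open>An enumeration of the coordinates, fixing the order of differentiation in
  \<open>\<partial>\<^sup>\<alpha>\<close>; on smooth functions the order has no effect.\<close>

definition coordinates :: "'n::finite list" where
  "coordinates = (SOME is. distinct is \<and> set is = UNIV)"

definition mderiv :: "('n::finite \<Rightarrow> nat) \<Rightarrow> (real^'n \<Rightarrow> complex) \<Rightarrow> real^'n \<Rightarrow> complex" where
  "mderiv \<alpha> f = foldr (\<lambda>i. pderiv_at i ^^ \<alpha> i) coordinates f"

text \<open>The supremum over the empty set is \<open>0\<close>, since \<open>Sup {}\<close> is unspecified on the reals.\<close>

definition sup_on :: "'a set \<Rightarrow> ('a \<Rightarrow> complex) \<Rightarrow> real" where
  "sup_on K f = (if K = {} then 0 else (SUP x\<in>K. cmod (f x)))"

definition test_functions :: "(real^'n::finite) set \<Rightarrow> (real^'n \<Rightarrow> complex) set" where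
  "test_functions U = {\<phi>. smooth_on UNIV \<phi> \<and> compact (closure {x. \<phi> x \<noteq> 0}) \<and>
     closure {x. \<phi> x \<noteq> 0} \<subseteq> U}"

text \<open>Families are indexed by \<open>\<epsilon> \<in> (0,1]\<close>; values at other real numbers are irrelevant.\<close>

type_synonym 'n family = "real \<Rightarrow> real^'n \<Rightarrow> complex"

definition moderate :: "(real^'n::finite) set \<Rightarrow> 'n family set" where
  "moderate \<Omega> = {u. (\<forall>\<epsilon>\<in>{0<..1}. smooth_on \<Omega> (u \<epsilon>)) \<and>
     (\<forall>K \<alpha>. compact K \<and> K \<subseteq> \<Omega> \<longrightarrow>
        (\<exists>p\<ge>0. (\<lambda>\<epsilon>. sup_on K (mderiv \<alpha> (u \<epsilon>))) \<in> O[at_right 0](\<lambda>\<epsilon>. \<epsilon> powr (- p))))}"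

definition negligible_families :: "(real^'n::finite) set \<Rightarrow> 'n family set" where
  "negligible_families \<Omega> = {u. (\<forall>\<epsilon>\<in>{0<..1}. smooth_on \<Omega> (u \<epsilon>)) \<and>
     (\<forall>K \<alpha>. compact K \<and> K \<subseteq> \<Omega> \<longrightarrow>
        (\<forall>q\<ge>0. (\<lambda>\<epsilon>. sup_on K (mderiv \<alpha> (u \<epsilon>))) \<in> O[at_right 0](\<lambda>\<epsilon>. \<epsilon> powr q)))}"

definition colombeau_rel :: "(real^'n::finite) set \<Rightarrow> ('n family \<times> 'n family) set" where
  "colombeau_rel \<Omega> = {(u, v). u \<in> moderate \<Omega> \<and> v \<in> moderate \<Omega> \<and>
     (\<lambda>\<epsilon> x. u \<epsilon> x - v \<epsilon> x) \<in> negligible_families \<Omega>}"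

definition colombeau :: "(real^'n::finite) set \<Rightarrow> 'n family set set" where
  "colombeau \<Omega> = moderate \<Omega> // colombeau_rel \<Omega>"

definition slow_scale :: "(real \<Rightarrow> 'a::real_normed_field) \<Rightarrow> bool" where
  "slow_scale r \<longleftrightarrow>
     (\<exists>p. (\<lambda>\<epsilon>. norm (r \<epsilon>)) \<in> O[at_right 0](\<lambda>\<epsilon>. \<epsilon> powr (- p))) \<and>
     (\<forall>t\<ge>0. \<exists>\<epsilon>\<^sub>t>0. \<forall>\<epsilon>\<in>{0<..<\<epsilon>\<^sub>t}. norm (r \<epsilon>) powr t \<le> 1 / \<epsilon>)"

definition principal_symbol ::
    "('n::finite \<Rightarrow> 'n family) \<Rightarrow> real \<Rightarrow> real^'n \<Rightarrow> real^'n \<Rightarrow> complex" where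
  "principal_symbol a \<epsilon> x \<xi> = (\<Sum>j\<in>UNIV. a j \<epsilon> x * complex_of_real (\<xi> $ j))"

text \<open>The family \<open>P\<^sub>\<epsilon>(x,D) u\<^sub>\<epsilon>\<close>, where \<open>D\<^sub>j = -\<i> \<partial>\<^sub>j\<close>.\<close>

definition first_order_family ::
    "'n::finite family \<Rightarrow> ('n \<Rightarrow> 'n family) \<Rightarrow> 'n family \<Rightarrow> 'n family" where
  "first_order_family a\<^sub>0 a u =
     (\<lambda>\<epsilon> x. (\<Sum>j\<in>UNIV. a j \<epsilon> x * (- \<i> * pderiv_at j (u \<epsilon>) x)) + a\<^sub>0 \<epsilon> x * u \<epsilon> x)"

text \<open>The operator on generalized functions, with coefficients \<open>A\<^sub>0\<close> and \<open>A j\<close> in the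
  Colombeau algebra. The class of the result does not depend on the representatives, so the
  union is over equal classes.\<close>

definition first_order_op ::
    "(real^'n::finite) set \<Rightarrow> 'n family set \<Rightarrow> ('n \<Rightarrow> 'n family set) \<Rightarrow> 'n family set \<Rightarrow> 'n family set"
  where
  "first_order_op \<Omega> A\<^sub>0 A u =
     (\<Union>a\<^sub>0\<in>A\<^sub>0. \<Union>a\<in>{a. \<forall>j. a j \<in> A j}. \<Union>v\<in>u. colombeau_rel \<Omega> `` {first_order_family a\<^sub>0 a v})"

text \<open>\<open>conic\<close> from the library is closed under multiplication by \<open>0\<close> as well, hence not
  usable for cones in the complement of the origin.\<close>

definition open_cone :: "(real^'n::finite) set \<Rightarrow> bool" where
  "open_cone \<Gamma> \<longleftrightarrow> open \<Gamma> \<and> 0 \<notin> \<Gamma> \<and> (\<forall>\<xi>\<in>\<Gamma>. \<forall>t>0. t *\<^sub>R \<xi> \<in> \<Gamma>)"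

definition fourier :: "(real^'n::finite \<Rightarrow> complex) \<Rightarrow> real^'n \<Rightarrow> complex" where
  "fourier v \<xi> = (LINT x|lborel. v x * exp (- \<i> * complex_of_real (\<xi> \<bullet> x)))"

definition microlocally_regular_family ::
    "(real^'n::finite) set \<Rightarrow> 'n family \<Rightarrow> real^'n \<Rightarrow> real^'n \<Rightarrow> bool" where
  "microlocally_regular_family \<Omega> u x\<^sub>0 \<xi>\<^sub>0 \<longleftrightarrow>
     (\<exists>U \<Gamma>. open U \<and> U \<subseteq> \<Omega> \<and> x\<^sub>0 \<in> U \<and> open_cone \<Gamma> \<and> \<xi>\<^sub>0 \<in> \<Gamma> \<and>
       (\<forall>\<phi>\<in>test_functions U. \<exists>N::real. \<forall>l::nat. \<exists>C>0. \<exists>\<epsilon>\<^sub>0>0.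
          \<forall>\<xi>\<in>\<Gamma>. \<forall>\<epsilon>\<in>{0<..<\<epsilon>\<^sub>0}.
            cmod (fourier (\<lambda>x. \<phi> x * u \<epsilon> x) \<xi>) \<le> C * \<epsilon> powr (- N) * (1 + norm \<xi>) powr (- real l)))"

text \<open>Regularity of a family does not change when a negligible family is added, so it is a
  property of the class \<open>u\<close>.\<close>

definition microlocally_regular ::
    "(real^'n::finite) set \<Rightarrow> 'n family set \<Rightarrow> real^'n \<Rightarrow> real^'n \<Rightarrow> bool" where
  "microlocally_regular \<Omega> u x\<^sub>0 \<xi>\<^sub>0 \<longleftrightarrow> (\<exists>v\<in>u. microlocally_regular_family \<Omega> v x\<^sub>0 \<xi>\<^sub>0)"

definition WF_g :: "(real^'n::finite) set \<Rightarrow> 'n family set \<Rightarrow> ((real^'n) \<times> (real^'n)) set" where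
  "WF_g \<Omega> u = \<Omega> \<times> (- {0}) - {(x, \<xi>). microlocally_regular \<Omega> u x \<xi>}"

end

theory Submission imports Defs begin

text \<open>
  The idea is elliptic regularity by integration by parts on the frequency side. Let \<open>b\<close> be
  \<open>|\<xi>|\<close> divided by the principal symbol \<open>P\<^sub>1(x,\<xi>)\<close>. For a test function \<open>\<psi>\<close> supported
  near \<open>x\<^sub>0\<close>, moving the derivatives in \<open>P u\<close> onto \<open>\<psi> b exp(-i\<xi>x)\<close> gives
    \<open>|\<xi>| F(\<psi> u)(\<xi>) = F(\<psi> b P u)(\<xi>) + F((T \<psi>) u)(\<xi>)\<close>,
  where \<open>F\<close> is the Fourier transform and \<open>T \<psi>\<close> is a first-order expression in \<open>\<psi>\<close>, \<open>b\<close> and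
  the coefficients (\<open>fourier_parametrix_identity\<close>). The last term has the same shape as the one on
  the left, so each use of the identity gains a power of \<open>|\<xi>|\<close>, as long as \<open>F(\<psi> b P u)\<close> decays
  rapidly (\<open>slow_amplitude_decay\<close>).

  What has to be controlled is the dependence on \<open>\<epsilon>\<close>: the number \<open>N\<close> of powers of
  \<open>1/\<epsilon>\<close> that are lost must not grow with the order of decay. The amplitudes \<open>\<psi>\<close>, \<open>\<psi> b\<close>, \<open>T \<psi>\<close>
  depend on \<open>\<epsilon>\<close> and \<open>\<xi>\<close>, but all their derivatives are of slow scale, uniformly in \<open>\<xi>\<close>.
  Slow scale nets are closed under sums, products and, with the assumed lower bound, division, and
  each of them is at most \<open>1/\<epsilon>\<close> for small \<open>\<epsilon>\<close>. Hence any number of integrations by parts costs only one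
  factor \<open>1/\<epsilon>\<close>.

  Microlocal regularity of \<open>P u\<close> speaks of fixed test functions, with \<open>N\<close> depending on the
  test function, whereas the amplitude \<open>\<psi> b\<close> varies with \<open>\<epsilon>\<close> and \<open>\<xi>\<close>. The gap is closed by
  the Baire category theorem in the complete metrizable space of smooth functions supported in a compact
  set (\<open>smooth_supp_uniform_boundedness\<close>): one \<open>N\<close> serves all test functions, and the estimate of
  order \<open>l\<close> depends only on a bound for finitely many derivatives, hence holds for amplitudes of
  slow scale (\<open>regular_imp_slow_amplitude_decay\<close>).

  Finally, the coefficients are classes: a regular representative of \<open>P u\<close> differs from the one formed with
  the slow scale representatives by a negligible family, whose Fourier transform after
  localization decays rapidly with \<open>N = 0\<close> (\<open>regular_first_order_op_representative\<close>).
\<close>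

section \<open>Calculus of iterated partial derivatives\<close>

lemma pderiv_at_eqI:
  "(f has_derivative D) (at x) \<Longrightarrow> pderiv_at i f x = D (axis i 1)"
  unfolding pderiv_at_def by (simp add: frechet_derivative_at[symmetric])

lemma pderiv_at_cong:
  assumes "open V" "x \<in> V" "\<And>y. y \<in> V \<Longrightarrow> f y = g y"
  shows "pderiv_at i f x = pderiv_at i g x"
proof -
  have "(f has_derivative D) (at x) \<longleftrightarrow> (g has_derivative D) (at x)" for D
    using assms has_derivative_transform_within_open[of f D x UNIV V g]
      has_derivative_transform_within_open[of g D x UNIV V f] by auto
  then show ?thesis unfolding pderiv_at_def frechet_derivative_def by simp
qed

lemma iterated_pderiv_cong:
  assumes "open V" "\<And>y. y \<in> V \<Longrightarrow> f y = g y" "x \<in> V"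
  shows "foldr pderiv_at is f x = foldr pderiv_at is g x"
  using assms(3)
proof (induction "is" arbitrary: x)
  case (Cons i "is")
  then show ?case
    using pderiv_at_cong[OF assms(1) Cons.prems, of "foldr pderiv_at is f" "foldr pderiv_at is g"]
    by simp
qed (use assms in auto)

lemma smooth_onD:
  assumes "smooth_on V f" "open V" "x \<in> V"
  shows "f differentiable at x"
proof -
  have "foldr pderiv_at [] f differentiable_on V" using assms(1) unfolding smooth_on_def by (rule spec)
  then show ?thesis using assms(2,3) by (simp add: differentiable_on_eq_differentiable_at)
qed

lemma smooth_on_pderiv:
  assumes "smooth_on V f"
  shows "smooth_on V (pderiv_at i f)"
  unfolding smooth_on_def
proof
  fix "is"
  have "foldr pderiv_at (is @ [i]) f differentiable_on V"
    using assms unfolding smooth_on_def by (rule spec)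
  then show "foldr pderiv_at is (pderiv_at i f) differentiable_on V" by simp
qed

lemma smooth_on_foldr: "smooth_on V f \<Longrightarrow> smooth_on V (foldr pderiv_at is f)"
  by (induction "is") (auto intro: smooth_on_pderiv)

lemma smooth_on_imp_continuous_on:
  assumes "smooth_on V f"
  shows "continuous_on V f"
proof -
  have "foldr pderiv_at [] f differentiable_on V" using assms unfolding smooth_on_def by (rule spec)
  then show ?thesis by (simp add: differentiable_imp_continuous_on)
qed

lemma smooth_on_subset: "smooth_on V f \<Longrightarrow> W \<subseteq> V \<Longrightarrow> smooth_on W f"
  unfolding smooth_on_def using differentiable_on_subset by blast

lemma differentiable_transform_open:
  assumes "open V" "x \<in> V" "\<And>y. y \<in> V \<Longrightarrow> f y = g y" "f differentiable at x"
  shows "g differentiable at x"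
  using assms has_derivative_transform_within_open[of f _ x UNIV V g]
  unfolding differentiable_def by blast

text \<open>Smoothness is the greatest property that implies differentiability and is inherited by
  partial derivatives up to equality on the open set. This form lets one verify smoothness of
  a whole algebra of functions at once, without an induction on the order.\<close>

lemma smooth_on_coinduct:
  assumes "open V" "P f"
    and step: "\<And>f. P f \<Longrightarrow> (\<forall>x\<in>V. f differentiable at x) \<and>
      (\<forall>i. \<exists>g. P g \<and> (\<forall>x\<in>V. pderiv_at i f x = g x))"
  shows "smooth_on V f"
proof -
  have "\<forall>f. P f \<longrightarrow> (\<forall>x\<in>V. foldr pderiv_at is f differentiable at x)" for "is"
  proof (induction "is" rule: rev_induct)
    case (snoc i "is")
    show ?case
    proof (intro allI impI ballI)
      fix f x assume "P f" "x \<in> V"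
      then obtain g where g: "P g" "\<forall>x\<in>V. pderiv_at i f x = g x" using step by blast
      then have "foldr pderiv_at is g differentiable at x" using snoc \<open>x \<in> V\<close> by blast
      moreover have "\<And>y. y \<in> V \<Longrightarrow>
          foldr pderiv_at is g y = foldr pderiv_at is (pderiv_at i f) y"
        by (rule iterated_pderiv_cong[OF assms(1)]) (use g in auto)
      ultimately show "foldr pderiv_at (is @ [i]) f differentiable at x"
        using differentiable_transform_open[OF assms(1) \<open>x \<in> V\<close>,
            of "foldr pderiv_at is g" "foldr pderiv_at is (pderiv_at i f)"] by simp
    qed
  qed (use step in auto)
  then show ?thesis
    unfolding smooth_on_def using assms(2) by (blast intro: differentiable_at_imp_differentiable_on)
qed

lemma smooth_on_cong:
  assumes "open V" "\<And>x. x \<in> V \<Longrightarrow> f x = g x" "smooth_on V f"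
  shows "smooth_on V g"
proof (rule smooth_on_coinduct[OF assms(1), where P = "\<lambda>g. \<exists>f. smooth_on V f \<and> (\<forall>x\<in>V. f x = g x)"])
  show "\<exists>f. smooth_on V f \<and> (\<forall>x\<in>V. f x = g x)" using assms by blast
  fix g assume "\<exists>f. smooth_on V f \<and> (\<forall>x\<in>V. f x = g x)"
  then obtain f where f: "smooth_on V f" "\<forall>x\<in>V. f x = g x" by blast
  have "g differentiable at x" if "x \<in> V" for x
    using differentiable_transform_open[OF assms(1) that, of f g] smooth_onD[OF f(1) assms(1) that] f(2)
    by blast
  moreover have "\<exists>h. (\<exists>f. smooth_on V f \<and> (\<forall>x\<in>V. f x = h x)) \<and> (\<forall>x\<in>V. pderiv_at i g x = h x)" for i
  proof (intro exI conjI ballI)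
    show "smooth_on V (pderiv_at i f)" using f(1) by (rule smooth_on_pderiv)
    show "pderiv_at i g x = pderiv_at i f x" if "x \<in> V" for x
      by (rule pderiv_at_cong[OF assms(1) that]) (use f in simp)
  qed (rule refl)
  ultimately show "(\<forall>x\<in>V. g differentiable at x) \<and>
      (\<forall>i. \<exists>h. (\<exists>f. smooth_on V f \<and> (\<forall>x\<in>V. f x = h x)) \<and> (\<forall>x\<in>V. pderiv_at i g x = h x))"
    by simp
qed

lemma smooth_on_Un:
  assumes "open V" "open W" "smooth_on V f" "smooth_on W f"
  shows "smooth_on (V \<union> W) f"
  unfolding smooth_on_def
proof
  fix "is"
  have "foldr pderiv_at is f differentiable at x" if "x \<in> V \<union> W" for x
    using that smooth_onD[OF smooth_on_foldr[OF assms(3)] assms(1)]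
      smooth_onD[OF smooth_on_foldr[OF assms(4)] assms(2)] by blast
  then show "foldr pderiv_at is f differentiable_on (V \<union> W)"
    by (auto intro: differentiable_at_imp_differentiable_on)
qed

lemma pderiv_at_const: "pderiv_at i (\<lambda>_. c) = (\<lambda>_. 0)"
  by (rule ext) (simp add: pderiv_at_eqI[OF has_derivative_const])

lemma smooth_on_const:
  fixes V :: "(real^'n::finite) set"
  assumes "open V"
  shows "smooth_on V (\<lambda>_. c)"
proof (rule smooth_on_coinduct[OF assms, where P = "\<lambda>f. \<exists>c. f = (\<lambda>_. c)"])
  fix f :: "real^'n \<Rightarrow> complex" assume "\<exists>c. f = (\<lambda>_. c)"
  then obtain c where [simp]: "f = (\<lambda>_. c)" by blast
  show "(\<forall>x\<in>V. f differentiable at x) \<and>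
      (\<forall>i. \<exists>g. (\<exists>c. g = (\<lambda>_. c)) \<and> (\<forall>x\<in>V. pderiv_at i f x = g x))"
    by (auto simp: pderiv_at_const)
qed (rule exI[of _ c], rule refl)

lemma pderiv_at_add:
  assumes "f differentiable at x" "g differentiable at x"
  shows "pderiv_at i (\<lambda>x. f x + g x) x = pderiv_at i f x + pderiv_at i g x"
proof -
  obtain F G where FG: "(f has_derivative F) (at x)" "(g has_derivative G) (at x)"
    using assms unfolding differentiable_def by blast
  show ?thesis
    unfolding pderiv_at_eqI[OF FG(1)] pderiv_at_eqI[OF FG(2)]
      pderiv_at_eqI[OF has_derivative_add[OF FG]] by simp
qed

lemma pderiv_at_mult:
  assumes "f differentiable at x" "g differentiable at x"
  shows "pderiv_at i (\<lambda>x. f x * g x) x = pderiv_at i f x * g x + f x * pderiv_at i g x"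
proof -
  obtain F G where FG: "(f has_derivative F) (at x)" "(g has_derivative G) (at x)"
    using assms unfolding differentiable_def by blast
  show ?thesis
    unfolding pderiv_at_eqI[OF FG(1)] pderiv_at_eqI[OF FG(2)]
      pderiv_at_eqI[OF has_derivative_mult[OF FG]] by simp
qed

lemma pderiv_at_inverse:
  assumes "f differentiable at x" "f x \<noteq> (0::complex)"
  shows "pderiv_at i (\<lambda>x. inverse (f x)) x = - 1 * pderiv_at i f x * (inverse (f x) * inverse (f x))"
proof -
  obtain F where F: "(f has_derivative F) (at x)"
    using assms unfolding differentiable_def by blast
  show ?thesis
    unfolding pderiv_at_eqI[OF F] pderiv_at_eqI[OF Deriv.has_derivative_inverse[OF assms(2) F]] by simp
qed

text \<open>The algebra generated by the smooth functions and by inverses of non-vanishing members is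
  closed under partial derivatives, hence consists of smooth functions.\<close>

inductive smooth_algebra :: "(real^'n::finite) set \<Rightarrow> (real^'n \<Rightarrow> complex) \<Rightarrow> bool" for V where
  base: "smooth_on V f \<Longrightarrow> smooth_algebra V f"
| add: "smooth_algebra V f \<Longrightarrow> smooth_algebra V g \<Longrightarrow> smooth_algebra V (\<lambda>x. f x + g x)"
| mult: "smooth_algebra V f \<Longrightarrow> smooth_algebra V g \<Longrightarrow> smooth_algebra V (\<lambda>x. f x * g x)"
| inverse: "smooth_algebra V f \<Longrightarrow> \<forall>x\<in>V. f x \<noteq> 0 \<Longrightarrow> smooth_algebra V (\<lambda>x. inverse (f x))"

lemma smooth_algebra_imp_smooth_on:
  assumes "open V" "smooth_algebra V f"
  shows "smooth_on V f"
proof (rule smooth_on_coinduct[OF assms(1), where P = "smooth_algebra V"])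
  show "smooth_algebra V f" by fact
next
  fix f assume "smooth_algebra V f"
  then show "(\<forall>x\<in>V. f differentiable at x) \<and>
      (\<forall>i. \<exists>g. smooth_algebra V g \<and> (\<forall>x\<in>V. pderiv_at i f x = g x))"
  proof induction
    case (base f)
    then show ?case using assms(1) smooth_onD smooth_on_pderiv smooth_algebra.base by metis
  next
    case (add f g)
    then have "\<forall>x\<in>V. (\<lambda>x. f x + g x) differentiable at x" by (auto intro: differentiable_add)
    moreover have "\<exists>h. smooth_algebra V h \<and> (\<forall>x\<in>V. pderiv_at i (\<lambda>x. f x + g x) x = h x)" for i
    proof -
      obtain f' g' where "smooth_algebra V f'" "smooth_algebra V g'"
        "\<forall>x\<in>V. pderiv_at i f x = f' x" "\<forall>x\<in>V. pderiv_at i g x = g' x" using add.IH by meson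
      then show ?thesis
        using add.IH by (intro exI[of _ "\<lambda>x. f' x + g' x"]) (auto intro: smooth_algebra.add simp: pderiv_at_add)
    qed
    ultimately show ?case by blast
  next
    case (mult f g)
    then have "\<forall>x\<in>V. (\<lambda>x. f x * g x) differentiable at x" by (auto intro: differentiable_mult)
    moreover have "\<exists>h. smooth_algebra V h \<and> (\<forall>x\<in>V. pderiv_at i (\<lambda>x. f x * g x) x = h x)" for i
    proof -
      obtain f' g' where "smooth_algebra V f'" "smooth_algebra V g'"
        "\<forall>x\<in>V. pderiv_at i f x = f' x" "\<forall>x\<in>V. pderiv_at i g x = g' x" using mult.IH by meson
      then show ?thesis
        using mult.IH mult.hyps by (intro exI[of _ "\<lambda>x. f' x * g x + f x * g' x"])
          (auto intro!: smooth_algebra.add smooth_algebra.mult simp: pderiv_at_mult)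
    qed
    ultimately show ?case by blast
  next
    case (inverse f)
    then have "\<forall>x\<in>V. (\<lambda>x. inverse (f x)) differentiable at x"
      by (auto intro: differentiable_inverse)
    moreover have "\<exists>h. smooth_algebra V h \<and> (\<forall>x\<in>V. pderiv_at i (\<lambda>x. inverse (f x)) x = h x)" for i
    proof -
      obtain f' where f': "smooth_algebra V f'" "\<forall>x\<in>V. pderiv_at i f x = f' x"
        using inverse.IH by meson
      have "smooth_algebra V (\<lambda>x. inverse (f x) * inverse (f x))"
        using inverse.hyps by (intro smooth_algebra.mult smooth_algebra.inverse)
      moreover have "smooth_algebra V (\<lambda>x. - 1 * f' x)"
        by (intro smooth_algebra.mult smooth_algebra.base smooth_on_const assms(1) f'(1))
      ultimately have "smooth_algebra V (\<lambda>x. - 1 * f' x * (inverse (f x) * inverse (f x)))"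
        by (rule smooth_algebra.mult[rotated])
      then show ?thesis
        using inverse.IH inverse.hyps f'(2)
        by (intro exI[of _ "\<lambda>x. - 1 * f' x * (inverse (f x) * inverse (f x))"])
          (simp add: pderiv_at_inverse)
    qed
    ultimately show ?case by blast
  qed
qed

lemma smooth_on_add:
  assumes "open V" "smooth_on V f" "smooth_on V g"
  shows "smooth_on V (\<lambda>x. f x + g x)"
  by (rule smooth_algebra_imp_smooth_on[OF assms(1) smooth_algebra.add[OF assms(2,3)[THEN smooth_algebra.base]]])

lemma smooth_on_mult:
  assumes "open V" "smooth_on V f" "smooth_on V g"
  shows "smooth_on V (\<lambda>x. f x * g x)"
  by (rule smooth_algebra_imp_smooth_on[OF assms(1) smooth_algebra.mult[OF assms(2,3)[THEN smooth_algebra.base]]])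

lemma smooth_on_inverse:
  assumes "open V" "smooth_on V f" "\<And>x. x \<in> V \<Longrightarrow> f x \<noteq> 0"
  shows "smooth_on V (\<lambda>x. inverse (f x))"
  by (rule smooth_algebra_imp_smooth_on[OF assms(1) smooth_algebra.inverse[OF smooth_algebra.base]])
    (use assms in auto)

lemma smooth_on_sum:
  assumes "open V" "finite I" "\<And>i. i \<in> I \<Longrightarrow> smooth_on V (f i)"
  shows "smooth_on V (\<lambda>x. \<Sum>i\<in>I. f i x)"
  using assms(2,3)
  by (induction I rule: finite_induct) (auto intro: smooth_on_const smooth_on_add assms(1))

lemma smooth_on_diff:
  assumes "open V" "smooth_on V f" "smooth_on V g"
  shows "smooth_on V (\<lambda>x. f x - g x)"
  using smooth_on_add[OF assms(1,2) smooth_on_mult[OF assms(1) smooth_on_const[OF assms(1), of "-1"] assms(3)]]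
  by simp

definition fourier_kernel :: "real^'n \<Rightarrow> real^'n::finite \<Rightarrow> complex" where
  "fourier_kernel \<xi> x = exp (- \<i> * complex_of_real (\<xi> \<bullet> x))"

lemma fourier_kernel_has_derivative:
  "(fourier_kernel \<xi> has_derivative (\<lambda>h. fourier_kernel \<xi> x * (- \<i> * complex_of_real (\<xi> \<bullet> h)))) (at x)"
proof -
  have "((\<lambda>x. - \<i> * complex_of_real (\<xi> \<bullet> x)) has_derivative (\<lambda>h. - \<i> * complex_of_real (\<xi> \<bullet> h))) (at x)"
    by (intro derivative_intros bounded_linear.has_derivative[OF bounded_linear_of_real]
      bounded_linear.has_derivative[OF bounded_linear_inner_right])
  from has_derivative_compose[OF this DERIV_exp[unfolded has_field_derivative_def]]
  show ?thesis unfolding fourier_kernel_def .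
qed

lemma pderiv_fourier_kernel:
  "pderiv_at j (fourier_kernel \<xi>) x = - \<i> * complex_of_real (\<xi> $ j) * fourier_kernel \<xi> x"
  by (simp add: pderiv_at_eqI[OF fourier_kernel_has_derivative] inner_axis)

lemma smooth_on_fourier_kernel: "smooth_on UNIV (fourier_kernel \<xi>)"
proof (rule smooth_on_coinduct[where P = "\<lambda>f. \<exists>c. f = (\<lambda>x. c * fourier_kernel \<xi> x)"])
  show "\<exists>c. fourier_kernel \<xi> = (\<lambda>x. c * fourier_kernel \<xi> x)" by (rule exI[of _ 1]) simp
  fix f assume "\<exists>c. f = (\<lambda>x. c * fourier_kernel \<xi> x)"
  then obtain c where f: "f = (\<lambda>x. c * fourier_kernel \<xi> x)" by blast
  have d: "fourier_kernel \<xi> differentiable at x" for x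
    using fourier_kernel_has_derivative unfolding differentiable_def by blast
  have "f differentiable at x" for x unfolding f by (intro differentiable_mult d) auto
  moreover have "pderiv_at i f x = (c * (- \<i> * complex_of_real (\<xi> $ i))) * fourier_kernel \<xi> x" for i x
    unfolding f by (subst pderiv_at_mult)
      (auto simp: d pderiv_fourier_kernel pderiv_at_const)
  ultimately show "(\<forall>x\<in>UNIV. f differentiable at x) \<and>
      (\<forall>i. \<exists>g. (\<exists>c. g = (\<lambda>x. c * fourier_kernel \<xi> x)) \<and> (\<forall>x\<in>UNIV. pderiv_at i f x = g x))"
    by blast
qed auto

lemma norm_fourier_kernel [simp]: "cmod (fourier_kernel \<xi> x) = 1"
  unfolding fourier_kernel_def by simp

section \<open>Jets\<close>

text \<open>Every sequence of directions is counted, although many of them give the same derivative; in return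
  the recursion on the order yields the estimates for sums, products and inverses by plain induction,
  without multi-indices.\<close>

fun jet :: "nat \<Rightarrow> (real^'n::finite \<Rightarrow> complex) \<Rightarrow> real^'n \<Rightarrow> real" where
  "jet 0 f x = cmod (f x)"
| "jet (Suc k) f x = cmod (f x) + (\<Sum>j\<in>UNIV. jet k (pderiv_at j f) x)"

lemma jet_nonneg: "0 \<le> jet k f x"
  by (induction k arbitrary: f) (auto intro!: add_nonneg_nonneg sum_nonneg)

lemma jet_mono_Suc: "jet k f x \<le> jet (Suc k) f x"
proof (induction k arbitrary: f)
  case 0
  then show ?case by (auto intro!: sum_nonneg)
next
  case (Suc k)
  have "(\<Sum>j\<in>UNIV. jet k (pderiv_at j f) x) \<le> (\<Sum>j\<in>UNIV. jet (Suc k) (pderiv_at j f) x)"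
    by (intro sum_mono Suc)
  then show ?case by (subst (1 2) jet.simps(2)) linarith
qed

lemma jet_mono: "k \<le> l \<Longrightarrow> jet k f x \<le> jet l f x"
  by (induction l rule: dec_induct) (use jet_mono_Suc order_trans in \<open>auto simp del: jet.simps, blast\<close>)

lemma jet_pderiv_le: "jet k (pderiv_at j f) x \<le> jet (Suc k) f x"
proof -
  have "jet k (pderiv_at j f) x \<le> (\<Sum>j\<in>UNIV. jet k (pderiv_at j f) x)"
    by (rule member_le_sum) (auto intro: jet_nonneg)
  then show ?thesis by (simp add: add_increasing)
qed

lemma iterated_pderiv_le_jet: "cmod (foldr pderiv_at is f x) \<le> jet (length is) f x"
proof (induction "is" arbitrary: f rule: rev_induct)
  case (snoc i "is")
  show ?case using order_trans[OF snoc jet_pderiv_le[of _ i]] by simp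
qed simp

lemma jet_cong:
  assumes "open V" "\<And>y. y \<in> V \<Longrightarrow> f y = g y" "x \<in> V"
  shows "jet k f x = jet k g x"
  using assms(2)
proof (induction k arbitrary: f g)
  case (Suc k)
  have "jet k (pderiv_at j f) x = jet k (pderiv_at j g) x" for j
    by (rule Suc.IH) (use pderiv_at_cong[OF assms(1)] Suc.prems in blast)
  then show ?case using Suc.prems assms(3) by simp
qed (use assms in auto)

lemma jet_const: "jet k (\<lambda>_. c) x = cmod c"
proof (induction k arbitrary: c)
  case (Suc k)
  show ?case using Suc[of 0] by (simp add: pderiv_at_const)
qed auto

lemma jet_add_le:
  assumes "open V" "smooth_on V f" "smooth_on V g" "x \<in> V"
  shows "jet k (\<lambda>x. f x + g x) x \<le> jet k f x + jet k g x"
  using assms(2,3)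
proof (induction k arbitrary: f g)
  case (Suc k)
  have "jet k (pderiv_at j (\<lambda>x. f x + g x)) x \<le> jet k (pderiv_at j f) x + jet k (pderiv_at j g) x" for j
  proof -
    have "jet k (pderiv_at j (\<lambda>x. f x + g x)) x = jet k (\<lambda>x. pderiv_at j f x + pderiv_at j g x) x"
      by (rule jet_cong[OF assms(1) _ assms(4)])
        (use Suc.prems smooth_onD[OF _ assms(1)] in \<open>auto intro!: pderiv_at_add\<close>)
    then show ?thesis using Suc.IH Suc.prems smooth_on_pderiv by metis
  qed
  then have "(\<Sum>j\<in>UNIV. jet k (pderiv_at j (\<lambda>x. f x + g x)) x)
      \<le> (\<Sum>j\<in>UNIV. jet k (pderiv_at j f) x) + (\<Sum>j\<in>UNIV. jet k (pderiv_at j g) x)"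
    unfolding sum.distrib[symmetric] by (intro sum_mono)
  then show ?case using norm_triangle_ineq[of "f x" "g x"] by simp
qed (auto intro: norm_triangle_ineq)

text \<open>Differentiating a product yields two products, which is where the factor \<open>2\<close> per order comes from.\<close>

lemma jet_mult_le:
  assumes "open V" "smooth_on V f" "smooth_on V g" "x \<in> V"
  shows "jet k (\<lambda>x. f x * g x) x \<le> 2^k * (jet k f x * jet k g x)"
  using assms(2,3)
proof (induction k arbitrary: f g)
  case (Suc k)
  let ?F = "\<Sum>j\<in>UNIV. jet k (pderiv_at j f) x" and ?G = "\<Sum>j\<in>UNIV. jet k (pderiv_at j g) x"
  let ?f = "jet k f x" and ?g = "jet k g x"
  have "jet k (pderiv_at j (\<lambda>x. f x * g x)) x
      \<le> 2^k * (jet k (pderiv_at j f) x * ?g + ?f * jet k (pderiv_at j g) x)" for j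
  proof -
    have "jet k (pderiv_at j (\<lambda>x. f x * g x)) x
        = jet k (\<lambda>x. pderiv_at j f x * g x + f x * pderiv_at j g x) x"
      by (rule jet_cong[OF assms(1) _ assms(4)])
        (use Suc.prems smooth_onD[OF _ assms(1)] in \<open>auto intro!: pderiv_at_mult\<close>)
    also have "\<dots> \<le> jet k (\<lambda>x. pderiv_at j f x * g x) x + jet k (\<lambda>x. f x * pderiv_at j g x) x"
      by (intro jet_add_le[OF assms(1) _ _ assms(4)] smooth_on_mult assms smooth_on_pderiv Suc.prems)
    also have "\<dots> \<le> 2^k * (jet k (pderiv_at j f) x * ?g) + 2^k * (?f * jet k (pderiv_at j g) x)"
      by (intro add_mono Suc.IH smooth_on_pderiv Suc.prems)
    finally show ?thesis by (simp add: algebra_simps)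
  qed
  then have "(\<Sum>j\<in>UNIV. jet k (pderiv_at j (\<lambda>x. f x * g x)) x)
      \<le> (\<Sum>j\<in>UNIV. 2^k * (jet k (pderiv_at j f) x * ?g + ?f * jet k (pderiv_at j g) x))"
    by (intro sum_mono)
  also have "\<dots> = 2^k * (?F * ?g + ?f * ?G)"
    by (simp add: sum_distrib_left sum_distrib_right sum.distrib algebra_simps)
  also have "\<dots> \<le> 2^k * (?F * (cmod (g x) + ?G) + (cmod (f x) + ?F) * ?G)"
    using jet_mono_Suc[of k f x] jet_mono_Suc[of k g x]
    by (intro mult_left_mono add_mono mult_mono) (auto intro!: sum_nonneg add_nonneg_nonneg jet_nonneg)
  finally have 1: "(\<Sum>j\<in>UNIV. jet k (pderiv_at j (\<lambda>x. f x * g x)) x)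
      \<le> 2^k * (?F * (cmod (g x) + ?G) + (cmod (f x) + ?F) * ?G)" .
  have 2: "cmod (f x * g x) \<le> 2^k * (cmod (f x) * cmod (g x))"
    using mult_right_mono[of 1 "2^k" "cmod (f x) * cmod (g x)"] by (simp add: norm_mult)
  have nn: "0 \<le> ?F" "0 \<le> ?G" by (auto intro!: sum_nonneg jet_nonneg)
  have "cmod (f x) * cmod (g x) + (?F * (cmod (g x) + ?G) + (cmod (f x) + ?F) * ?G)
      \<le> 2 * ((cmod (f x) + ?F) * (cmod (g x) + ?G))"
    using nn by (simp add: algebra_simps)
  then have "2^k * (cmod (f x) * cmod (g x)) + 2^k * (?F * (cmod (g x) + ?G) + (cmod (f x) + ?F) * ?G)
      \<le> 2^k * (2 * ((cmod (f x) + ?F) * (cmod (g x) + ?G)))"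
    unfolding distrib_left[symmetric] by (intro mult_left_mono) auto
  then show ?case using 1 2 by (simp add: mult.assoc)
qed (auto simp: norm_mult)

lemma jet_cmult_le:
  assumes "open V" "smooth_on V f" "x \<in> V"
  shows "jet k (\<lambda>x. c * f x) x \<le> cmod c * jet k f x"
  using assms(2)
proof (induction k arbitrary: f)
  case (Suc k)
  have "jet k (pderiv_at j (\<lambda>x. c * f x)) x \<le> cmod c * jet k (pderiv_at j f) x" for j
  proof -
    have "jet k (pderiv_at j (\<lambda>x. c * f x)) x = jet k (\<lambda>x. c * pderiv_at j f x) x"
      by (rule jet_cong[OF assms(1) _ assms(3)], subst pderiv_at_mult)
        (use Suc.prems smooth_onD[OF _ assms(1)] in \<open>auto simp: pderiv_at_const\<close>)
    then show ?thesis using Suc.IH Suc.prems smooth_on_pderiv by metis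
  qed
  then have "(\<Sum>j\<in>UNIV. jet k (pderiv_at j (\<lambda>x. c * f x)) x) \<le> cmod c * (\<Sum>j\<in>UNIV. jet k (pderiv_at j f) x)"
    unfolding sum_distrib_left by (intro sum_mono)
  then show ?case by (simp add: norm_mult algebra_simps)
qed (auto simp: norm_mult)

lemma jet_sum_le:
  assumes "open V" "finite I" "\<And>i. i \<in> I \<Longrightarrow> smooth_on V (f i)" "x \<in> V"
  shows "jet k (\<lambda>x. \<Sum>i\<in>I. f i x) x \<le> (\<Sum>i\<in>I. jet k (f i) x)"
  using assms(2,3)
proof (induction I rule: finite_induct)
  case (insert i I)
  have "jet k (\<lambda>x. f i x + (\<Sum>i\<in>I. f i x)) x \<le> jet k (f i) x + jet k (\<lambda>x. \<Sum>i\<in>I. f i x) x"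
    using insert by (intro jet_add_le[OF assms(1) _ _ assms(4)] smooth_on_sum[OF assms(1)]) auto
  then show ?case using insert by fastforce
qed (simp add: jet_const)

text \<open>Only the value of \<open>1/f\<close> itself involves a division: every further derivative costs one factor
  from the jet of \<open>f\<close> and two jets of \<open>1/f\<close> of lower order.\<close>

lemma jet_inverse_le:
  assumes "open V" "smooth_on V f" "x \<in> V" "\<And>y. y \<in> V \<Longrightarrow> f y \<noteq> 0"
  shows "jet (Suc k) (\<lambda>x. inverse (f x)) x
    \<le> inverse (cmod (f x)) + 4^k * (jet (Suc k) f x * (jet k (\<lambda>x. inverse (f x)) x)^2)"
proof -
  let ?b = "\<lambda>x. inverse (f x)"
  let ?J = "jet k ?b x"
  have sb: "smooth_on V ?b" by (intro smooth_on_inverse assms)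
  have "jet k (pderiv_at j ?b) x \<le> 4^k * (jet k (pderiv_at j f) x * ?J^2)" for j
  proof -
    let ?p = "pderiv_at j f"
    have sp: "smooth_on V ?p" by (intro smooth_on_pderiv assms)
    have "jet k (pderiv_at j ?b) x = jet k (\<lambda>x. (- 1) * (?p x * (?b x * ?b x))) x"
      by (rule jet_cong[OF assms(1) _ assms(3)])
        (use assms smooth_onD[OF assms(2,1)] in \<open>auto simp: pderiv_at_inverse\<close>)
    also have "\<dots> \<le> cmod (- 1) * jet k (\<lambda>x. ?p x * (?b x * ?b x)) x"
      by (intro jet_cmult_le[OF assms(1) _ assms(3)] smooth_on_mult assms sb sp)
    also have "\<dots> \<le> 2^k * (jet k ?p x * jet k (\<lambda>x. ?b x * ?b x) x)"
      using jet_mult_le[OF assms(1) sp smooth_on_mult[OF assms(1) sb sb] assms(3)] by simp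
    also have "\<dots> \<le> 2^k * (jet k ?p x * (2^k * (?J * ?J)))"
      by (intro mult_left_mono jet_mult_le[OF assms(1) sb sb assms(3)]) (auto intro: jet_nonneg)
    also have "\<dots> = 4^k * (jet k ?p x * ?J^2)"
      using power_mult_distrib[of 2 "2::real" k] by (simp add: power2_eq_square)
    finally show ?thesis .
  qed
  then have "(\<Sum>j\<in>UNIV. jet k (pderiv_at j ?b) x) \<le> (\<Sum>j\<in>UNIV. 4^k * (jet k (pderiv_at j f) x * ?J^2))"
    by (intro sum_mono)
  also have "\<dots> = 4^k * ((\<Sum>j\<in>UNIV. jet k (pderiv_at j f) x) * ?J^2)"
    by (simp add: sum_distrib_left sum_distrib_right)
  also have "\<dots> \<le> 4^k * (jet (Suc k) f x * ?J^2)"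
    by (intro mult_left_mono mult_right_mono) auto
  finally show ?thesis by (simp add: norm_inverse)
qed

section \<open>Smooth functions supported in a compact set and their Fourier transforms\<close>

text \<open>For compact \<open>K\<close> this is the space of test functions with support in \<open>K\<close>. Fixing \<open>K\<close> makes
  it completely metrizable, as the Baire category argument requires.\<close>

definition smooth_supp :: "(real^'n::finite) set \<Rightarrow> (real^'n \<Rightarrow> complex) set" where
  "smooth_supp K = {\<phi>. smooth_on UNIV \<phi> \<and> (\<forall>x. x \<notin> K \<longrightarrow> \<phi> x = 0)}"

lemma smooth_supp_extendI:
  assumes "open V" "closed K" "K \<subseteq> V" "smooth_on V f" "\<And>x. x \<notin> K \<Longrightarrow> f x = 0"
  shows "f \<in> smooth_supp K"
proof -
  have "smooth_on (- K) f"
    by (rule smooth_on_cong[OF _ _ smooth_on_const[of "- K" 0]]) (use assms in auto)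
  then have "smooth_on (V \<union> - K) f" using assms by (intro smooth_on_Un) auto
  moreover have "V \<union> - K = UNIV" using assms(3) by auto
  ultimately show ?thesis unfolding smooth_supp_def using assms(5) by auto
qed

lemma smooth_suppD:
  assumes "\<phi> \<in> smooth_supp K"
  shows "smooth_on UNIV \<phi>" "x \<notin> K \<Longrightarrow> \<phi> x = 0" "continuous_on S \<phi>"
  using assms smooth_on_imp_continuous_on[of UNIV \<phi>] continuous_on_subset
  unfolding smooth_supp_def by blast+

lemma smooth_supp_pderiv:
  assumes "closed K" "\<phi> \<in> smooth_supp K"
  shows "pderiv_at i \<phi> \<in> smooth_supp K"
proof -
  have "pderiv_at i \<phi> x = 0" if "x \<notin> K" for x
  proof -
    have "pderiv_at i \<phi> x = pderiv_at i (\<lambda>_. 0) x"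
      by (rule pderiv_at_cong[of "- K"]) (use that assms smooth_suppD(2)[OF assms(2)] in auto)
    then show ?thesis by (simp add: pderiv_at_const)
  qed
  then show ?thesis
    using smooth_on_pderiv[OF smooth_suppD(1)[OF assms(2)]] unfolding smooth_supp_def by blast
qed

lemma smooth_supp_mult:
  assumes "open V" "closed K" "K \<subseteq> V" "\<phi> \<in> smooth_supp K" "smooth_on V g"
  shows "(\<lambda>x. \<phi> x * g x) \<in> smooth_supp K"
  by (rule smooth_supp_extendI[OF assms(1-3)])
    (use assms smooth_suppD[OF assms(4)] smooth_on_subset[of UNIV \<phi> V]
      in \<open>auto intro: smooth_on_mult\<close>)

lemma smooth_supp_add:
  "\<phi> \<in> smooth_supp K \<Longrightarrow> \<psi> \<in> smooth_supp K \<Longrightarrow> (\<lambda>x. \<phi> x + \<psi> x) \<in> smooth_supp K"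
  unfolding smooth_supp_def using smooth_on_add[of UNIV \<phi> \<psi>] by auto

lemma smooth_supp_cmult: "\<phi> \<in> smooth_supp K \<Longrightarrow> (\<lambda>x. c * \<phi> x) \<in> smooth_supp K"
  unfolding smooth_supp_def using smooth_on_mult[OF open_UNIV smooth_on_const[OF open_UNIV, of c], of \<phi>]
  by auto

lemma smooth_supp_sum:
  "finite I \<Longrightarrow> (\<And>i. i \<in> I \<Longrightarrow> \<phi> i \<in> smooth_supp K) \<Longrightarrow> (\<lambda>x. \<Sum>i\<in>I. \<phi> i x) \<in> smooth_supp K"
  unfolding smooth_supp_def using smooth_on_sum[OF open_UNIV, of I \<phi>] by auto

lemma test_functions_imp_smooth_supp:
  assumes "\<phi> \<in> test_functions U"
  obtains K where "compact K" "K \<subseteq> U" "\<phi> \<in> smooth_supp K"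
proof
  let ?K = "closure {x. \<phi> x \<noteq> 0}"
  show "compact ?K" "?K \<subseteq> U" using assms unfolding test_functions_def by blast+
  have "\<phi> x = 0" if "x \<notin> ?K" for x
    using that closure_subset[of "{x. \<phi> x \<noteq> 0}"] by blast
  moreover have "smooth_on UNIV \<phi>" using assms unfolding test_functions_def by blast
  ultimately show "\<phi> \<in> smooth_supp ?K" unfolding smooth_supp_def by blast
qed

lemma smooth_supp_imp_test_functions:
  assumes "compact K" "K \<subseteq> U" "\<phi> \<in> smooth_supp K"
  shows "\<phi> \<in> test_functions U"
proof -
  have "{x. \<phi> x \<noteq> 0} \<subseteq> K" using smooth_suppD(2)[OF assms(3)] by blast
  then have sub: "closure {x. \<phi> x \<noteq> 0} \<subseteq> K"
    by (intro closure_minimal compact_imp_closed assms)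
  then have "compact (closure {x. \<phi> x \<noteq> 0})"
    using compact_Int_closed[OF assms(1), of "closure {x. \<phi> x \<noteq> 0}"] by (simp add: Int_absorb1)
  then show ?thesis
    unfolding test_functions_def using sub assms(2) smooth_suppD(1)[OF assms(3)] by simp
qed

lemma integrable_supported:
  fixes \<phi> :: "real^'n::finite \<Rightarrow> complex"
  assumes "compact K" "continuous_on K \<phi>" "\<And>x. x \<notin> K \<Longrightarrow> \<phi> x = 0"
  shows "integrable lborel \<phi>"
proof -
  have "(\<lambda>x. indicator K x *\<^sub>R \<phi> x) = \<phi>" using assms(3) by (auto simp: indicator_def)
  then show ?thesis using borel_integrable_compact[OF assms(1,2)] by simp
qed

lemma norm_integral_supported_le:
  fixes \<phi> :: "real^'n::finite \<Rightarrow> complex"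
  assumes "compact K" "continuous_on K \<phi>" "\<And>x. x \<notin> K \<Longrightarrow> \<phi> x = 0"
    "\<And>x. x \<in> K \<Longrightarrow> cmod (\<phi> x) \<le> B"
  shows "cmod (LINT x|lborel. \<phi> x) \<le> measure lborel K * B"
proof -
  have "emeasure lborel K < \<infinity>" using emeasure_compact_finite[OF assms(1)] by simp
  then have i: "integrable lborel (\<lambda>x. indicator K x * B)"
    using assms(1) by (intro integrable_mult_left integrable_real_indicator) (auto intro: borel_compact)
  have j: "integrable lborel \<phi>" by (rule integrable_supported[OF assms(1,2)]) (rule assms(3))
  have "cmod (LINT x|lborel. \<phi> x) \<le> (LINT x|lborel. indicator K x * B)"
    by (rule Bochner_Integration.integral_norm_bound_integral[OF j i])
      (use assms in \<open>auto simp: indicator_def\<close>)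
  also have "\<dots> = measure lborel K * B" using assms(1) by (simp add: borel_compact)
  finally show ?thesis .
qed

lemma integrable_smooth_supp: "compact K \<Longrightarrow> \<phi> \<in> smooth_supp K \<Longrightarrow> integrable lborel \<phi>"
  by (rule integrable_supported) (auto dest: smooth_suppD)

lemma coordinate_line_has_derivative:
  assumes "f differentiable at (x + s *\<^sub>R axis j 1)"
  shows "((\<lambda>s. f (x + s *\<^sub>R axis j 1)) has_derivative
    (\<lambda>h. h *\<^sub>R pderiv_at j f (x + s *\<^sub>R axis j 1))) (at s)"
proof -
  obtain D where D: "(f has_derivative D) (at (x + s *\<^sub>R axis j 1))"
    using assms unfolding differentiable_def by blast
  have "((\<lambda>s. x + s *\<^sub>R axis j 1) has_derivative (\<lambda>h. h *\<^sub>R axis j 1)) (at s)"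
    by (auto intro!: derivative_eq_intros)
  from has_derivative_compose[OF this D]
  show ?thesis
    unfolding pderiv_at_eqI[OF D]
    using linear_scale[OF has_derivative_linear[OF D]] by simp
qed

lemma coordinate_line_lipschitz:
  fixes f :: "real^'n::finite \<Rightarrow> complex"
  assumes "\<And>x. f differentiable at x" "\<And>x. cmod (pderiv_at j f x) \<le> B"
  shows "cmod (f (x + s *\<^sub>R axis j 1) - f x) \<le> B * \<bar>s\<bar>"
proof -
  have "cmod (f (x + s *\<^sub>R axis j 1) - f (x + 0 *\<^sub>R axis j 1)) \<le> B * norm (s - 0)"
  proof (rule differentiable_bound[where S = UNIV and f = "\<lambda>s. f (x + s *\<^sub>R axis j 1)"
      and f' = "\<lambda>s h. h *\<^sub>R pderiv_at j f (x + s *\<^sub>R axis j 1)"])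
    fix s :: real
    show "((\<lambda>s. f (x + s *\<^sub>R axis j 1)) has_derivative (\<lambda>h. h *\<^sub>R pderiv_at j f (x + s *\<^sub>R axis j 1)))
        (at s within UNIV)"
      by (intro coordinate_line_has_derivative assms)
    show "onorm (\<lambda>h. h *\<^sub>R pderiv_at j f (x + s *\<^sub>R axis j 1)) \<le> B"
      by (rule onorm_le) (simp add: mult.commute[of B] mult_left_mono[OF assms(2)])
  qed auto
  then show ?thesis by simp
qed

lemma coordinate_line_difference_quotient:
  assumes "f differentiable at x" "t \<longlonglongrightarrow> 0" "\<And>n. t n \<noteq> (0::real)"
  shows "(\<lambda>n. (f (x + t n *\<^sub>R axis j 1) - f x) /\<^sub>R t n) \<longlonglongrightarrow> pderiv_at j f x"
proof -
  let ?d = "pderiv_at j f x"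
  have "((\<lambda>s. f (x + s *\<^sub>R axis j 1)) has_derivative (\<lambda>h. h *\<^sub>R ?d)) (at 0)"
    using coordinate_line_has_derivative[of f x 0 j] assms(1) by simp
  then have "(\<lambda>h. norm (f (x + h *\<^sub>R axis j 1) - f x - h *\<^sub>R ?d) / norm h) \<midarrow>0\<rightarrow> 0"
    unfolding has_derivative_at by simp
  moreover have "filterlim t (at 0) sequentially"
    using assms(2,3) by (simp add: filterlim_at)
  ultimately have "(\<lambda>n. norm (f (x + t n *\<^sub>R axis j 1) - f x - t n *\<^sub>R ?d) / norm (t n)) \<longlonglongrightarrow> 0"
    by (rule filterlim_compose)
  also have "(\<lambda>n. norm (f (x + t n *\<^sub>R axis j 1) - f x - t n *\<^sub>R ?d) / norm (t n)) =
      (\<lambda>n. norm ((f (x + t n *\<^sub>R axis j 1) - f x) /\<^sub>R t n - ?d))"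
  proof
    fix n
    have "(f (x + t n *\<^sub>R axis j 1) - f x) /\<^sub>R t n - ?d
        = (f (x + t n *\<^sub>R axis j 1) - f x - t n *\<^sub>R ?d) /\<^sub>R t n"
      using assms(3)[of n] by (simp add: scaleR_diff_right)
    then show "norm (f (x + t n *\<^sub>R axis j 1) - f x - t n *\<^sub>R ?d) / norm (t n) =
        norm ((f (x + t n *\<^sub>R axis j 1) - f x) /\<^sub>R t n - ?d)"
      by (simp add: divide_inverse mult.commute)
  qed
  finally show ?thesis by (subst LIM_zero_iff[symmetric], subst tendsto_norm_zero_iff[symmetric])
qed

text \<open>Lebesgue measure is translation invariant, so the difference quotients of \<open>\<phi>\<close> in a
  coordinate direction all have integral zero; dominated convergence passes this to the
  derivative.\<close>

lemma integral_pderiv_eq_0: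
  assumes "compact K" "\<phi> \<in> smooth_supp K"
  shows "(LINT x|lborel. pderiv_at j \<phi> x) = 0"
proof -
  define t where "t n = inverse (real (Suc n))" for n
  have t: "t \<longlonglongrightarrow> 0" "\<And>n. t n \<noteq> 0" "\<And>n. \<bar>t n\<bar> \<le> 1"
    unfolding t_def using LIMSEQ_inverse_real_of_nat by (auto simp: field_simps)
  \<comment> \<open>\<open>?q n\<close> is the difference quotient with step \<open>t n\<close>; its support stays in a fixed ball, since \<open>t n \<le> 1\<close>.\<close>
  let ?e = "axis j 1 :: real^'a" and ?q = "\<lambda>n x. (\<phi> (x + t n *\<^sub>R axis j 1) - \<phi> x) /\<^sub>R t n"
  have clK: "closed K" using assms(1) by (rule compact_imp_closed)
  note p = smooth_supp_pderiv[OF clK assms(2), of j]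
  have diff: "\<phi> differentiable at x" for x
    using smooth_onD[OF smooth_suppD(1)[OF assms(2)]] by simp
  have "bounded (pderiv_at j \<phi> ` K)"
    by (intro compact_imp_bounded compact_continuous_image smooth_suppD(3)[OF p] assms)
  then obtain B where B: "B > 0" "\<And>x. x \<in> K \<Longrightarrow> cmod (pderiv_at j \<phi> x) \<le> B"
    unfolding bounded_pos by auto
  then have B': "cmod (pderiv_at j \<phi> x) \<le> B" for x
    using smooth_suppD(2)[OF p, of x] by (cases "x \<in> K") auto
  obtain R where R: "\<And>x. x \<in> K \<Longrightarrow> norm x \<le> R"
    using compact_imp_bounded[OF assms(1)] unfolding bounded_iff by blast
  have "\<phi> \<in> borel_measurable borel"
    by (intro borel_measurable_continuous_onI smooth_suppD(3)[OF assms(2)])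
  then have m[measurable]: "\<phi> \<in> borel_measurable borel" .
  have int: "integrable lborel \<phi>" by (rule integrable_smooth_supp[OF assms])
  have shift: "integrable lborel (\<lambda>x. \<phi> (x + c))" "(LINT x|lborel. \<phi> (x + c)) = (LINT x|lborel. \<phi> x)" for c
  proof -
    have d: "distr lborel borel (\<lambda>x. x + c) = lborel"
      using lborel_distr_plus[of c] by (simp add: add.commute[of _ c])
    have "integrable (distr lborel borel (\<lambda>x. x + c)) \<phi>" unfolding d by (rule int)
    then show "integrable lborel (\<lambda>x. \<phi> (x + c))" by (subst (asm) integrable_distr_eq) auto
    have "(LINT x|distr lborel borel (\<lambda>x. x + c). \<phi> x) = (LINT x|lborel. \<phi> (x + c))"
      by (rule integral_distr) auto
    then show "(LINT x|lborel. \<phi> (x + c)) = (LINT x|lborel. \<phi> x)" unfolding d by simp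
  qed
  have q0: "(LINT x|lborel. ?q n x) = 0" for n
    using shift[of "t n *\<^sub>R ?e"] int by (simp add: Bochner_Integration.integral_diff)
  have "(\<lambda>n. LINT x|lborel. ?q n x) \<longlonglongrightarrow> (LINT x|lborel. pderiv_at j \<phi> x)"
  proof (rule integral_dominated_convergence)
    show "pderiv_at j \<phi> \<in> borel_measurable lborel"
      using borel_measurable_continuous_onI[OF smooth_suppD(3)[OF p]] by simp
    show "?q n \<in> borel_measurable lborel" for n by measurable
    show "integrable lborel (\<lambda>x. indicator (cball (0::real^'a) (R + 1)) x * B)"
      by (intro integrable_mult_left integrable_real_indicator)
        (use emeasure_compact_finite[OF compact_cball, of 0 "R + 1"] in auto)
    show "AE x in lborel. (\<lambda>n. ?q n x) \<longlonglongrightarrow> pderiv_at j \<phi> x"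
      by (intro AE_I2 coordinate_line_difference_quotient diff t)
    show "AE x in lborel. norm (?q n x) \<le> indicator (cball (0::real^'a) (R + 1)) x * B" for n
    proof (rule AE_I2)
      fix x
      show "norm (?q n x) \<le> indicator (cball (0::real^'a) (R + 1)) x * B"
      proof (cases "x \<in> cball 0 (R + 1)")
        case True
        have "cmod (\<phi> (x + t n *\<^sub>R ?e) - \<phi> x) \<le> B * \<bar>t n\<bar>"
          by (rule coordinate_line_lipschitz) (use diff B' in auto)
        moreover have "norm (?q n x) = cmod (\<phi> (x + t n *\<^sub>R ?e) - \<phi> x) / \<bar>t n\<bar>"
          by (simp only: norm_scaleR) (simp add: divide_inverse_commute)
        ultimately have "norm (?q n x) \<le> B" using t(2)[of n] by (simp add: pos_divide_le_eq)
        then show ?thesis using True by simp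
      next
        case False
        then have n: "norm x > R + 1" by simp
        have "norm x \<le> norm (x + t n *\<^sub>R ?e) + norm (t n *\<^sub>R ?e)"
          using norm_triangle_ineq4[of "x + t n *\<^sub>R ?e" "t n *\<^sub>R ?e"] by simp
        then have "x \<notin> K" "x + t n *\<^sub>R ?e \<notin> K"
          using R[of x] R[of "x + t n *\<^sub>R ?e"] n t(3)[of n] by auto
        then show ?thesis using smooth_suppD(2)[OF assms(2)] B by simp
      qed
    qed
  qed
  then show ?thesis unfolding q0 by (simp add: LIMSEQ_const_iff)
qed

lemma fourier_eq: "fourier v \<xi> = (LINT x|lborel. v x * fourier_kernel \<xi> x)"
  unfolding fourier_def fourier_kernel_def ..

lemma integrable_fourier:
  assumes "compact K" "continuous_on K v" "\<And>x. x \<notin> K \<Longrightarrow> v x = 0"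
  shows "integrable lborel (\<lambda>x. v x * fourier_kernel \<xi> x)"
  by (rule integrable_supported[OF assms(1)])
    (use assms smooth_on_imp_continuous_on[OF smooth_on_fourier_kernel]
     in \<open>auto intro!: continuous_on_mult intro: continuous_on_subset\<close>)

lemma norm_fourier_le:
  assumes "compact K" "continuous_on K v" "\<And>x. x \<notin> K \<Longrightarrow> v x = 0"
    "\<And>x. x \<in> K \<Longrightarrow> cmod (v x) \<le> B"
  shows "cmod (fourier v \<xi>) \<le> measure lborel K * B"
  unfolding fourier_eq
  by (rule norm_integral_supported_le[OF assms(1)])
    (use assms smooth_on_imp_continuous_on[OF smooth_on_fourier_kernel]
     in \<open>auto intro!: continuous_on_mult intro: continuous_on_subset simp: norm_mult\<close>)

lemma fourier_add:
  assumes "compact K" "continuous_on K v" "\<And>x. x \<notin> K \<Longrightarrow> v x = 0"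
    "continuous_on K w" "\<And>x. x \<notin> K \<Longrightarrow> w x = 0"
  shows "fourier (\<lambda>x. v x + w x) \<xi> = fourier v \<xi> + fourier w \<xi>"
  unfolding fourier_eq distrib_right
  by (rule Bochner_Integration.integral_add) (use assms in \<open>auto intro!: integrable_fourier\<close>)

lemma fourier_cmult: "fourier (\<lambda>x. c * v x) \<xi> = c * fourier v \<xi>"
  unfolding fourier_eq by (simp add: mult.assoc)

lemma fourier_sum:
  assumes "compact K" "finite I" "\<And>i. i \<in> I \<Longrightarrow> continuous_on K (v i)"
    "\<And>i x. i \<in> I \<Longrightarrow> x \<notin> K \<Longrightarrow> v i x = 0"
  shows "fourier (\<lambda>x. \<Sum>i\<in>I. v i x) \<xi> = (\<Sum>i\<in>I. fourier (v i) \<xi>)"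
  unfolding fourier_eq sum_distrib_right
  by (rule Bochner_Integration.integral_sum) (use assms in \<open>auto intro!: integrable_fourier\<close>)

lemma fourier_pderiv:
  assumes "compact K" "\<phi> \<in> smooth_supp K"
  shows "fourier (pderiv_at j \<phi>) \<xi> = \<i> * complex_of_real (\<xi> $ j) * fourier \<phi> \<xi>"
proof -
  let ?e = "fourier_kernel \<xi>"
  have clK: "closed K" using assms(1) by (rule compact_imp_closed)
  have d: "\<phi> differentiable at x" "?e differentiable at x" for x
    using smooth_onD[OF smooth_suppD(1)[OF assms(2)]] smooth_onD[OF smooth_on_fourier_kernel] by simp_all
  note p = smooth_supp_pderiv[OF clK assms(2), of j]
  have m: "(\<lambda>x. \<phi> x * ?e x) \<in> smooth_supp K"
    by (rule smooth_supp_mult[OF open_UNIV clK _ assms(2) smooth_on_fourier_kernel]) simp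
  have "0 = (LINT x|lborel. pderiv_at j (\<lambda>x. \<phi> x * ?e x) x)"
    using integral_pderiv_eq_0[OF assms(1) m] by simp
  also have "\<dots> = (LINT x|lborel. pderiv_at j \<phi> x * ?e x + - \<i> * complex_of_real (\<xi> $ j) * (\<phi> x * ?e x))"
    by (simp add: pderiv_at_mult d pderiv_fourier_kernel algebra_simps)
  also have "\<dots> = (LINT x|lborel. pderiv_at j \<phi> x * ?e x) +
      (LINT x|lborel. - \<i> * complex_of_real (\<xi> $ j) * (\<phi> x * ?e x))"
    using assms smooth_suppD[OF assms(2)] smooth_suppD[OF p]
    by (intro Bochner_Integration.integral_add integrable_mult_right integrable_fourier) auto
  also have "\<dots> = fourier (pderiv_at j \<phi>) \<xi> - \<i> * complex_of_real (\<xi> $ j) * fourier \<phi> \<xi>"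
    unfolding fourier_eq by (subst integral_mult_right_zero) simp
  finally show ?thesis by simp
qed

text \<open>One factor \<open>1 + |\<xi>|\<close> is traded for a derivative at a time: \<open>|\<xi>|\<close> is at most the sum of the
  \<open>|\<xi>\<^sub>j|\<close>, and multiplication by \<open>i \<xi>\<^sub>j\<close> is the transform of \<open>\<partial>\<^sub>j\<close>.\<close>

lemma fourier_decay:
  assumes "compact K" "\<phi> \<in> smooth_supp K" "\<And>x. x \<in> K \<Longrightarrow> jet l \<phi> x \<le> B"
  shows "(1 + norm \<xi>) ^ l * cmod (fourier \<phi> (\<xi>::real^'n::finite))
    \<le> real (1 + CARD('n)) ^ l * (measure lborel K * B)"
  using assms(2,3)
proof (induction l arbitrary: \<phi>)
  case 0
  then show ?case
    using norm_fourier_le[OF assms(1) smooth_suppD(3)[OF 0(1)] smooth_suppD(2)[OF 0(1)]] by simp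
next
  case (Suc l)
  let ?M = "real (1 + CARD('n)) ^ l * (measure lborel K * B)"
  have step: "(1 + norm \<xi>) ^ l * cmod (fourier \<psi> \<xi>) \<le> ?M"
    if "\<psi> \<in> smooth_supp K" "\<And>x. jet l \<psi> x \<le> jet (Suc l) \<phi> x" for \<psi>
    using Suc.IH[OF that(1)] that(2) Suc.prems(2) order_trans by blast
  have "norm \<xi> \<le> (\<Sum>j\<in>UNIV. \<bar>\<xi> $ j\<bar>)" by (rule norm_le_l1_cart)
  then have "(1 + norm \<xi>) * cmod (fourier \<phi> \<xi>) \<le> (1 + (\<Sum>j\<in>UNIV. \<bar>\<xi> $ j\<bar>)) * cmod (fourier \<phi> \<xi>)"
    by (intro mult_right_mono) auto
  also have "\<dots> = cmod (fourier \<phi> \<xi>) + (\<Sum>j\<in>UNIV. cmod (fourier (pderiv_at j \<phi>) \<xi>))"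
    by (simp add: fourier_pderiv[OF assms(1) Suc.prems(1)] norm_mult sum_distrib_right distrib_right)
  finally have "(1 + norm \<xi>) ^ l * ((1 + norm \<xi>) * cmod (fourier \<phi> \<xi>))
      \<le> (1 + norm \<xi>) ^ l * (cmod (fourier \<phi> \<xi>) + (\<Sum>j\<in>UNIV. cmod (fourier (pderiv_at j \<phi>) \<xi>)))"
    by (intro mult_left_mono) auto
  also have "\<dots> = (1 + norm \<xi>) ^ l * cmod (fourier \<phi> \<xi>)
      + (\<Sum>j\<in>UNIV. (1 + norm \<xi>) ^ l * cmod (fourier (pderiv_at j \<phi>) \<xi>))"
    by (simp add: distrib_left sum_distrib_left)
  also have "\<dots> \<le> ?M + (\<Sum>j\<in>(UNIV::'n set). ?M)"
    using assms(1) Suc.prems(1)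
    by (intro add_mono sum_mono step)
      (auto intro: jet_mono_Suc jet_pderiv_le smooth_supp_pderiv compact_imp_closed simp del: jet.simps)
  also have "\<dots> = real (1 + CARD('n)) ^ Suc l * (measure lborel K * B)"
    by (simp add: algebra_simps)
  finally show ?case by (simp add: mult.assoc mult.left_commute)
qed

section \<open>Symmetry of partial derivatives\<close>

text \<open>The second difference of \<open>f\<close> along two coordinate directions is symmetric in the directions,
  and the mean value inequality, applied in one direction and then in the other, identifies it
  with \<open>s t\<close> times the corresponding mixed derivative, up to \<open>o(s t)\<close>.\<close>

lemma second_difference_bound:
  fixes f :: "real^'n::finite \<Rightarrow> complex"
  assumes V: "open V" "smooth_on V f" "x \<in> V" and \<eta>: "\<eta> > 0"
  shows "\<exists>\<delta>>0. \<forall>s t. \<bar>s\<bar> < \<delta> \<longrightarrow> \<bar>t\<bar> < \<delta> \<longrightarrow>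
    cmod (f (x + t *\<^sub>R axis j 1 + s *\<^sub>R axis i 1) - f (x + s *\<^sub>R axis i 1) - f (x + t *\<^sub>R axis j 1) + f x
      - s *\<^sub>R t *\<^sub>R pderiv_at j (pderiv_at i f) x) \<le> \<eta> * \<bar>t\<bar> * \<bar>s\<bar>"
proof -
  let ?i = "axis i 1 :: real^'n" and ?j = "axis j 1 :: real^'n"
  let ?p = "pderiv_at i f" and ?q = "pderiv_at j (pderiv_at i f)"
  let ?c = "?q x"
  have sp: "smooth_on V ?p" and sq: "smooth_on V ?q" by (intro smooth_on_pderiv V)+
  have "isCont ?q x" using smooth_on_imp_continuous_on[OF sq] V by (simp add: continuous_on_eq_continuous_at)
  then obtain d1 where d1: "d1 > 0" "\<And>y. dist y x < d1 \<Longrightarrow> dist (?q y) ?c < \<eta>"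
    using \<eta> unfolding continuous_at_eps_delta by meson
  obtain d2 where d2: "d2 > 0" "ball x d2 \<subseteq> V" using V(1,3) by (meson open_contains_ball)
  define \<delta> where "\<delta> = min d1 d2 / 2"
  have \<delta>: "\<delta> > 0" using d1 d2 by (simp add: \<delta>_def)
  have near: "x + t *\<^sub>R ?j + s *\<^sub>R ?i \<in> V" "dist (?q (x + t *\<^sub>R ?j + s *\<^sub>R ?i)) ?c < \<eta>"
    if "\<bar>s\<bar> < \<delta>" "\<bar>t\<bar> < \<delta>" for s t
  proof -
    have "dist (x + t *\<^sub>R ?j + s *\<^sub>R ?i) x \<le> norm (t *\<^sub>R ?j) + norm (s *\<^sub>R ?i)"
      using norm_triangle_ineq[of "t *\<^sub>R ?j" "s *\<^sub>R ?i"] by (simp add: dist_norm)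
    also have "\<dots> < min d1 d2" using that by (simp add: \<delta>_def)
    finally have "dist (x + t *\<^sub>R ?j + s *\<^sub>R ?i) x < min d1 d2" .
    then show "x + t *\<^sub>R ?j + s *\<^sub>R ?i \<in> V" "dist (?q (x + t *\<^sub>R ?j + s *\<^sub>R ?i)) ?c < \<eta>"
      using d1(2)[of "x + t *\<^sub>R ?j + s *\<^sub>R ?i"] d2(2) by (auto simp: dist_commute)
  qed
  have inner: "cmod (?p (x + s *\<^sub>R ?i + t *\<^sub>R ?j) - ?p (x + s *\<^sub>R ?i) - t *\<^sub>R ?c) \<le> \<eta> * \<bar>t\<bar>"
    if "\<bar>s\<bar> < \<delta>" "\<bar>t\<bar> < \<delta>" for s t
  proof -
    let ?g = "\<lambda>t. ?p (x + s *\<^sub>R ?i + t *\<^sub>R ?j) - t *\<^sub>R ?c"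
    have "norm (?g t - ?g 0) \<le> \<eta> * norm (t - 0)"
    proof (rule differentiable_bound[where S = "{-\<delta><..<\<delta>}"
        and f' = "\<lambda>t h. h *\<^sub>R ?q (x + s *\<^sub>R ?i + t *\<^sub>R ?j) - h *\<^sub>R ?c"])
      fix t' assume "t' \<in> {-\<delta><..<\<delta>}"
      then have t': "\<bar>t'\<bar> < \<delta>" by auto
      note n = near[OF that(1) t'] 
      have e: "x + t' *\<^sub>R ?j + s *\<^sub>R ?i = x + s *\<^sub>R ?i + t' *\<^sub>R ?j" by simp
      have "?p differentiable at (x + s *\<^sub>R ?i + t' *\<^sub>R ?j)"
        using smooth_onD[OF sp V(1) n(1)] unfolding e .
      from has_derivative_diff[OF has_derivative_at_withinI[OF coordinate_line_has_derivative[OF this]]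
        has_derivative_scaleR_left[OF has_derivative_ident]]
      show "(?g has_derivative (\<lambda>h. h *\<^sub>R ?q (x + s *\<^sub>R ?i + t' *\<^sub>R ?j) - h *\<^sub>R ?c)) (at t' within {-\<delta><..<\<delta>})" .
      show "onorm (\<lambda>h. h *\<^sub>R ?q (x + s *\<^sub>R ?i + t' *\<^sub>R ?j) - h *\<^sub>R ?c) \<le> \<eta>"
      proof (rule onorm_le)
        fix h :: real
        have "norm (h *\<^sub>R ?q (x + s *\<^sub>R ?i + t' *\<^sub>R ?j) - h *\<^sub>R ?c) = \<bar>h\<bar> * dist (?q (x + s *\<^sub>R ?i + t' *\<^sub>R ?j)) ?c"
          unfolding scaleR_diff_right[symmetric] by (simp add: dist_norm)
        also have "\<dots> \<le> \<bar>h\<bar> * \<eta>" using n(2) unfolding e by (intro mult_left_mono) auto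
        finally show "norm (h *\<^sub>R ?q (x + s *\<^sub>R ?i + t' *\<^sub>R ?j) - h *\<^sub>R ?c) \<le> \<eta> * norm h"
          by (simp add: mult.commute)
      qed
    qed (use that \<delta> in auto)
    then show ?thesis by (simp add: algebra_simps)
  qed
  have outer: "cmod (f (x + t *\<^sub>R ?j + s *\<^sub>R ?i) - f (x + s *\<^sub>R ?i) - f (x + t *\<^sub>R ?j) + f x - s *\<^sub>R t *\<^sub>R ?c)
      \<le> \<eta> * \<bar>t\<bar> * \<bar>s\<bar>" if "\<bar>s\<bar> < \<delta>" "\<bar>t\<bar> < \<delta>" for s t
  proof -
    let ?g = "\<lambda>s. f (x + t *\<^sub>R ?j + s *\<^sub>R ?i) - f (x + s *\<^sub>R ?i) - s *\<^sub>R t *\<^sub>R ?c"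
    have "norm (?g s - ?g 0) \<le> (\<eta> * \<bar>t\<bar>) * norm (s - 0)"
    proof (rule differentiable_bound[where S = "{-\<delta><..<\<delta>}"
        and f' = "\<lambda>s h. h *\<^sub>R ?p (x + t *\<^sub>R ?j + s *\<^sub>R ?i) - h *\<^sub>R ?p (x + s *\<^sub>R ?i) - h *\<^sub>R t *\<^sub>R ?c"])
      fix s' assume "s' \<in> {-\<delta><..<\<delta>}"
      then have s': "\<bar>s'\<bar> < \<delta>" by auto
      have "f differentiable at (x + t *\<^sub>R ?j + s' *\<^sub>R ?i)" "f differentiable at (x + s' *\<^sub>R ?i)"
        using smooth_onD[OF V(2,1) near(1)[OF s' that(2)]] smooth_onD[OF V(2,1) near(1)[OF s', of 0]] \<delta>
        by auto
      note d = has_derivative_at_withinI[OF coordinate_line_has_derivative[OF this(1)]]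
        has_derivative_at_withinI[OF coordinate_line_has_derivative[OF this(2)]]
      show "(?g has_derivative (\<lambda>h. h *\<^sub>R ?p (x + t *\<^sub>R ?j + s' *\<^sub>R ?i) - h *\<^sub>R ?p (x + s' *\<^sub>R ?i)
          - h *\<^sub>R t *\<^sub>R ?c)) (at s' within {-\<delta><..<\<delta>})"
        by (rule has_derivative_diff[OF has_derivative_diff[OF d] has_derivative_scaleR_left[OF has_derivative_ident]])
      show "onorm (\<lambda>h. h *\<^sub>R ?p (x + t *\<^sub>R ?j + s' *\<^sub>R ?i) - h *\<^sub>R ?p (x + s' *\<^sub>R ?i) - h *\<^sub>R t *\<^sub>R ?c) \<le> \<eta> * \<bar>t\<bar>"
      proof (rule onorm_le)
        fix h :: real
        have "norm (h *\<^sub>R ?p (x + t *\<^sub>R ?j + s' *\<^sub>R ?i) - h *\<^sub>R ?p (x + s' *\<^sub>R ?i) - h *\<^sub>R t *\<^sub>R ?c)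
            = \<bar>h\<bar> * cmod (?p (x + s' *\<^sub>R ?i + t *\<^sub>R ?j) - ?p (x + s' *\<^sub>R ?i) - t *\<^sub>R ?c)"
          unfolding scaleR_diff_right[symmetric] by (simp add: add_ac)
        also have "\<dots> \<le> \<bar>h\<bar> * (\<eta> * \<bar>t\<bar>)" by (intro mult_left_mono inner s' that) auto
        finally show "norm (h *\<^sub>R ?p (x + t *\<^sub>R ?j + s' *\<^sub>R ?i) - h *\<^sub>R ?p (x + s' *\<^sub>R ?i) - h *\<^sub>R t *\<^sub>R ?c)
            \<le> \<eta> * \<bar>t\<bar> * norm h" by (simp add: mult.commute)
      qed
    qed (use that \<delta> in auto)
    then show ?thesis by (simp add: algebra_simps)
  qed
  show ?thesis using \<delta> outer by (intro exI[of _ \<delta>] conjI allI impI)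
qed

text \<open>If the two mixed derivatives differed, the common second difference along the diagonal \<open>s = t\<close>
  could not be close to both multiples of \<open>s\<^sup>2\<close>.\<close>

lemma pderiv_at_commute:
  assumes "open V" "smooth_on V f" "x \<in> V"
  shows "pderiv_at i (pderiv_at j f) x = pderiv_at j (pderiv_at i f) x"
proof (rule ccontr)
  let ?c = "pderiv_at j (pderiv_at i f) x" and ?d = "pderiv_at i (pderiv_at j f) x"
  assume "?d \<noteq> ?c"
  then have pos: "dist ?c ?d / 4 > 0" by simp
  let ?\<Delta> = "\<lambda>s. f (x + s *\<^sub>R axis j 1 + s *\<^sub>R axis i 1) - f (x + s *\<^sub>R axis i 1) - f (x + s *\<^sub>R axis j 1) + f x"
  obtain \<delta>1 where d1: "\<delta>1 > 0" "\<And>s. \<bar>s\<bar> < \<delta>1 \<Longrightarrow>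
      cmod (?\<Delta> s - s *\<^sub>R s *\<^sub>R ?c) \<le> dist ?c ?d / 4 * \<bar>s\<bar> * \<bar>s\<bar>"
    using second_difference_bound[OF assms pos, of j i] by metis
  obtain \<delta>2 where d2: "\<delta>2 > 0" "\<And>s. \<bar>s\<bar> < \<delta>2 \<Longrightarrow>
      cmod (f (x + s *\<^sub>R axis i 1 + s *\<^sub>R axis j 1) - f (x + s *\<^sub>R axis j 1) - f (x + s *\<^sub>R axis i 1) + f x
        - s *\<^sub>R s *\<^sub>R ?d) \<le> dist ?c ?d / 4 * \<bar>s\<bar> * \<bar>s\<bar>"
    using second_difference_bound[OF assms pos, of i j] by metis
  define s where "s = min \<delta>1 \<delta>2 / 2"
  have s: "s > 0" "s < \<delta>1" "s < \<delta>2" using d1 d2 by (auto simp: s_def)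
  have e: "f (x + s *\<^sub>R axis i 1 + s *\<^sub>R axis j 1) - f (x + s *\<^sub>R axis j 1) - f (x + s *\<^sub>R axis i 1) + f x = ?\<Delta> s"
    by (simp add: add_ac)
  have "cmod ((?\<Delta> s - s *\<^sub>R s *\<^sub>R ?d) - (?\<Delta> s - s *\<^sub>R s *\<^sub>R ?c))
      \<le> dist ?c ?d / 4 * s * s + dist ?c ?d / 4 * s * s"
    using norm_triangle_le_diff[OF add_mono[OF d2(2)[of s, unfolded e] d1(2)[of s]]] s by simp
  moreover have "(?\<Delta> s - s *\<^sub>R s *\<^sub>R ?d) - (?\<Delta> s - s *\<^sub>R s *\<^sub>R ?c) = (s * s) *\<^sub>R (?c - ?d)"
    by (simp add: scaleR_diff_right)
  ultimately have "(s * s) * dist ?c ?d \<le> (s * s) * (dist ?c ?d / 2)"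
    by (simp add: dist_norm mult_ac)
  then show False using s \<open>?d \<noteq> ?c\<close> by (simp add: mult_le_cancel_left)
qed

lemma iterated_pderiv_move:
  assumes "open V" "smooth_on V f" "x \<in> V"
  shows "foldr pderiv_at (us @ i # ws) f x = foldr pderiv_at (i # us @ ws) f x"
  using assms(3)
proof (induction us arbitrary: x)
  case (Cons u us)
  have "pderiv_at u (foldr pderiv_at (us @ i # ws) f) x = pderiv_at u (foldr pderiv_at (i # us @ ws) f) x"
    by (rule pderiv_at_cong[OF assms(1)]) (use Cons in auto)
  also have "\<dots> = pderiv_at i (pderiv_at u (foldr pderiv_at (us @ ws) f)) x"
    using pderiv_at_commute[OF assms(1) smooth_on_foldr[OF assms(2)] Cons.prems, of u i "us @ ws"] by simp
  finally show ?case by simp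
qed simp

lemma iterated_pderiv_permute:
  assumes "open V" "smooth_on V f" "x \<in> V" "mset xs = mset ys"
  shows "foldr pderiv_at xs f x = foldr pderiv_at ys f x"
  using assms(3,4)
proof (induction xs arbitrary: ys x)
  case (Cons i xs)
  then have "i \<in> set ys" by (metis list.set_intros(1) set_mset_mset)
  then obtain us ws where ys: "ys = us @ i # ws" by (meson split_list)
  then have m: "mset xs = mset (us @ ws)" using Cons.prems(2) by simp
  have "foldr pderiv_at (i # xs) f x = foldr pderiv_at (i # us @ ws) f x"
    unfolding foldr_Cons o_apply
    by (rule pderiv_at_cong[OF assms(1)]) (use Cons.prems Cons.IH[OF _ m] in auto)
  also have "\<dots> = foldr pderiv_at ys f x"
    unfolding ys by (rule iterated_pderiv_move[OF assms(1,2) Cons.prems(1), symmetric])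
  finally show ?case .
qed simp

lemma coordinates: "distinct (coordinates :: 'n::finite list)" "set (coordinates :: 'n list) = UNIV"
proof -
  have "\<exists>is. distinct is \<and> set is = (UNIV :: 'n set)" using finite_distinct_list[OF finite] by metis
  from someI_ex[OF this] show "distinct (coordinates :: 'n list)" "set (coordinates :: 'n list) = UNIV"
    unfolding coordinates_def by auto
qed

lemma foldr_funpow_concat:
  "foldr (\<lambda>i. g i ^^ \<alpha> i) xs = foldr g (concat (map (\<lambda>i. replicate (\<alpha> i) i) xs))"
proof (induction xs)
  case (Cons x xs)
  have "foldr g (replicate n x) = g x ^^ n" for n by (induction n) auto
  then show ?case using Cons by (simp add: foldr_append fun_eq_iff)
qed simp

lemma count_concat_replicate:
  "distinct xs \<Longrightarrow> count (mset (concat (map (\<lambda>i. replicate (\<alpha> i) i) xs))) i = (if i \<in> set xs then \<alpha> i else 0)"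
  by (induction xs) auto

lemma mderiv_conv_foldr:
  "mderiv \<alpha> f = foldr pderiv_at (concat (map (\<lambda>i. replicate (\<alpha> i) i) coordinates)) f"
  unfolding mderiv_def by (simp add: foldr_funpow_concat)

text \<open>The growth conditions on generalized functions bound the derivatives \<open>\<partial>\<^sup>\<alpha>\<close>, taken in a fixed order;
  jets involve all sequences of directions. Symmetry of the derivatives translates one into the other.\<close>

lemma iterated_pderiv_eq_mderiv:
  assumes "open V" "smooth_on V f" "x \<in> V"
  shows "foldr pderiv_at is f x = mderiv (count (mset is)) f x"
  unfolding mderiv_conv_foldr
  by (rule iterated_pderiv_permute[OF assms])
    (auto intro!: multiset_eqI simp: count_concat_replicate[OF coordinates(1)] coordinates(2))

lemma smooth_on_mderiv: "smooth_on V f \<Longrightarrow> smooth_on V (mderiv \<alpha> f)"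
  unfolding mderiv_conv_foldr by (rule smooth_on_foldr)

lemma le_sup_on:
  assumes "compact K" "continuous_on K f" "x \<in> K"
  shows "cmod (f x) \<le> sup_on K f"
proof -
  have "compact ((\<lambda>x. cmod (f x)) ` K)"
    by (intro compact_continuous_image continuous_on_norm assms)
  then have "bdd_above ((\<lambda>x. cmod (f x)) ` K)"
    by (rule bounded_imp_bdd_above[OF compact_imp_bounded])
  then show ?thesis unfolding sup_on_def using assms(3) by (auto intro: cSUP_upper)
qed

lemma jet_le_sum_iterated_pderivs:
  "jet k f x \<le> (\<Sum>is\<in>{is. length is \<le> k}. cmod (foldr pderiv_at is f x))"
proof (induction k arbitrary: f)
  case (Suc k)
  have fin: "finite {is :: 'a list. length is \<le> k}" for k
    using finite_lists_length_le[of "UNIV :: 'a set" k] by simp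
  let ?F = "\<lambda>is. cmod (foldr pderiv_at is f x)"
  let ?h = "\<lambda>(j, is). is @ [j]"
  have "(\<Sum>j\<in>UNIV. jet k (pderiv_at j f) x)
      \<le> (\<Sum>j\<in>UNIV. \<Sum>is\<in>{is. length is \<le> k}. ?F (is @ [j]))"
    by (intro sum_mono order_trans[OF Suc.IH]) simp
  also have "\<dots> = (\<Sum>p\<in>UNIV \<times> {is. length is \<le> k}. ?F (?h p))"
    by (subst sum.cartesian_product) (simp add: case_prod_unfold)
  also have "\<dots> = (\<Sum>is\<in>?h ` (UNIV \<times> {is. length is \<le> k}). ?F is)"
    by (subst sum.reindex) (auto simp: inj_on_def)
  finally have "jet (Suc k) f x \<le> ?F [] + (\<Sum>is\<in>?h ` (UNIV \<times> {is. length is \<le> k}). ?F is)" by simp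
  also have "\<dots> = (\<Sum>is\<in>insert [] (?h ` (UNIV \<times> {is. length is \<le> k})). ?F is)"
    by (subst sum.insert) (auto simp: fin)
  also have "\<dots> \<le> (\<Sum>is\<in>{is. length is \<le> Suc k}. ?F is)"
    by (rule sum_mono2) (auto simp: fin)
  finally show ?case .
qed simp

lemma jet_le_sup_on:
  assumes "open V" "smooth_on V f" "compact K" "K \<subseteq> V" "x \<in> K"
  shows "jet k f x \<le> (\<Sum>is\<in>{is. length is \<le> k}. sup_on K (mderiv (count (mset is)) f))"
proof (rule order_trans[OF jet_le_sum_iterated_pderivs sum_mono])
  fix "is" :: "'a list"
  show "cmod (foldr pderiv_at is f x) \<le> sup_on K (mderiv (count (mset is)) f)"
    using assms iterated_pderiv_eq_mderiv[OF assms(1,2), of x "is"]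
      le_sup_on[OF assms(3) continuous_on_subset[OF smooth_on_imp_continuous_on[OF smooth_on_mderiv[OF assms(2)]] assms(4)] assms(5)]
    by (metis subsetD)
qed

section \<open>Nets of slow scale, moderate and negligible nets\<close>

lemma eventually_small: "0 < c \<Longrightarrow> \<forall>\<^sub>F \<epsilon> in at_right (0::real). 0 < \<epsilon> \<and> \<epsilon> < c"
  using eventually_at_right_real[of 0 c] by simp

lemma eventually_right0E:
  assumes "\<forall>\<^sub>F \<epsilon> in at_right (0::real). Q \<epsilon>"
  obtains \<epsilon>\<^sub>0 where "\<epsilon>\<^sub>0 > 0" "\<And>\<epsilon>. \<epsilon> \<in> {0<..<\<epsilon>\<^sub>0} \<Longrightarrow> Q \<epsilon>"
  using assms unfolding eventually_at_right_field by auto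

lemma eventually_right0I:
  "\<epsilon>\<^sub>0 > 0 \<Longrightarrow> (\<And>\<epsilon>. \<epsilon> \<in> {0<..<\<epsilon>\<^sub>0} \<Longrightarrow> Q \<epsilon>) \<Longrightarrow> \<forall>\<^sub>F \<epsilon> in at_right (0::real). Q \<epsilon>"
  unfolding eventually_at_right_field by auto

text \<open>Growth conditions on nets of functions, uniform over an index set. A constant factor in front
  of a power of \<open>\<epsilon>\<close> is absorbed by one more power of \<open>\<epsilon>\<close>, and natural exponents suffice for
  slow scale because the bound \<open>1 / \<epsilon>\<close> exceeds \<open>1\<close>.\<close>

definition slow_net :: "'p set \<Rightarrow> (real \<Rightarrow> 'p \<Rightarrow> real) \<Rightarrow> bool" where
  "slow_net P G \<longleftrightarrow> (\<forall>n::nat. \<forall>\<^sub>F \<epsilon> in at_right 0. \<forall>p\<in>P. \<bar>G \<epsilon> p\<bar> ^ n \<le> 1 / \<epsilon>)"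

definition moderate_net :: "'p set \<Rightarrow> (real \<Rightarrow> 'p \<Rightarrow> real) \<Rightarrow> bool" where
  "moderate_net P G \<longleftrightarrow> (\<exists>p. \<forall>\<^sub>F \<epsilon> in at_right 0. \<forall>x\<in>P. \<bar>G \<epsilon> x\<bar> \<le> \<epsilon> powr (- p))"

definition negligible_net :: "'p set \<Rightarrow> (real \<Rightarrow> 'p \<Rightarrow> real) \<Rightarrow> bool" where
  "negligible_net P G \<longleftrightarrow> (\<forall>q. \<forall>\<^sub>F \<epsilon> in at_right 0. \<forall>x\<in>P. \<bar>G \<epsilon> x\<bar> \<le> \<epsilon> powr q)"

lemma slow_net_mono:
  assumes "slow_net P H" "\<forall>\<^sub>F \<epsilon> in at_right 0. \<forall>p\<in>P. \<bar>G \<epsilon> p\<bar> \<le> H \<epsilon> p"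
  shows "slow_net P G"
  unfolding slow_net_def
proof
  fix n :: nat
  have "\<forall>\<^sub>F \<epsilon> in at_right 0. \<forall>p\<in>P. \<bar>H \<epsilon> p\<bar> ^ n \<le> 1 / \<epsilon>" using assms(1) unfolding slow_net_def by simp
  with assms(2) show "\<forall>\<^sub>F \<epsilon> in at_right 0. \<forall>p\<in>P. \<bar>G \<epsilon> p\<bar> ^ n \<le> 1 / \<epsilon>"
  proof eventually_elim
    case (elim \<epsilon>)
    show ?case
    proof
      fix p assume "p \<in> P"
      then have "\<bar>G \<epsilon> p\<bar> ^ n \<le> \<bar>H \<epsilon> p\<bar> ^ n" using elim(1) by (intro power_mono) force+
      then show "\<bar>G \<epsilon> p\<bar> ^ n \<le> 1 / \<epsilon>" using elim(2) \<open>p \<in> P\<close> by force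
    qed
  qed
qed

lemma slow_net_const: "slow_net P (\<lambda>_ _. c)"
  unfolding slow_net_def
proof
  fix n :: nat
  have "0 < 1 / (\<bar>c\<bar> ^ n + 1)" by (simp add: add_nonneg_pos)
  from eventually_small[OF this] show "\<forall>\<^sub>F \<epsilon> in at_right 0. \<forall>p\<in>P. \<bar>c\<bar> ^ n \<le> 1 / \<epsilon>"
  proof eventually_elim
    case (elim \<epsilon>)
    then have "\<epsilon> * (\<bar>c\<bar> ^ n + 1) < 1" by (simp add: pos_less_divide_eq add_nonneg_pos)
    then have "\<bar>c\<bar> ^ n \<le> 1 / \<epsilon>" using elim by (simp add: pos_le_divide_eq algebra_simps)
    then show ?case by simp
  qed
qed

text \<open>Since the exponent in the definition is arbitrary, the square roots that the product would need are
  obtained by doubling it.\<close>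

lemma slow_net_mult:
  assumes "slow_net P G" "slow_net P H"
  shows "slow_net P (\<lambda>\<epsilon> p. G \<epsilon> p * H \<epsilon> p)"
  unfolding slow_net_def
proof
  fix n :: nat
  have "\<forall>\<^sub>F \<epsilon> in at_right 0. \<forall>p\<in>P. \<bar>G \<epsilon> p\<bar> ^ (2 * n) \<le> 1 / \<epsilon>" "\<forall>\<^sub>F \<epsilon> in at_right 0. \<forall>p\<in>P. \<bar>H \<epsilon> p\<bar> ^ (2 * n) \<le> 1 / \<epsilon>"
    using assms unfolding slow_net_def by simp_all
  with eventually_small[OF zero_less_one] show "\<forall>\<^sub>F \<epsilon> in at_right 0. \<forall>p\<in>P. \<bar>G \<epsilon> p * H \<epsilon> p\<bar> ^ n \<le> 1 / \<epsilon>"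
  proof eventually_elim
    case (elim \<epsilon>)
    show ?case
    proof
      fix p assume p: "p \<in> P"
      have "(\<bar>G \<epsilon> p * H \<epsilon> p\<bar> ^ n)\<^sup>2 = \<bar>G \<epsilon> p\<bar> ^ (2 * n) * \<bar>H \<epsilon> p\<bar> ^ (2 * n)"
        by (simp only: abs_mult power_mult_distrib power_even_eq)
      also have "\<dots> \<le> (1 / \<epsilon>) * (1 / \<epsilon>)"
        by (rule mult_mono[OF bspec[OF elim(2) p] bspec[OF elim(3) p]]) (use elim(1) in simp_all)
      also have "\<dots> = (1 / \<epsilon>)\<^sup>2" by (rule power2_eq_square[symmetric])
      finally show "\<bar>G \<epsilon> p * H \<epsilon> p\<bar> ^ n \<le> 1 / \<epsilon>"
        by (rule power2_le_imp_le) (use elim(1) in simp)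
    qed
  qed
qed

lemma slow_net_add:
  assumes "slow_net P G" "slow_net P H"
  shows "slow_net P (\<lambda>\<epsilon> p. G \<epsilon> p + H \<epsilon> p)"
proof (rule slow_net_mono)
  have "slow_net P (\<lambda>\<epsilon> p. max \<bar>G \<epsilon> p\<bar> \<bar>H \<epsilon> p\<bar>)"
    unfolding slow_net_def
  proof
    fix n :: nat
    have "\<forall>\<^sub>F \<epsilon> in at_right 0. \<forall>p\<in>P. \<bar>G \<epsilon> p\<bar> ^ n \<le> 1 / \<epsilon>" "\<forall>\<^sub>F \<epsilon> in at_right 0. \<forall>p\<in>P. \<bar>H \<epsilon> p\<bar> ^ n \<le> 1 / \<epsilon>"
      using assms unfolding slow_net_def by simp_all
    then show "\<forall>\<^sub>F \<epsilon> in at_right 0. \<forall>p\<in>P. \<bar>max \<bar>G \<epsilon> p\<bar> \<bar>H \<epsilon> p\<bar>\<bar> ^ n \<le> 1 / \<epsilon>"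
      by eventually_elim (auto simp: max_def)
  qed
  then show "slow_net P (\<lambda>\<epsilon> p. 2 * max \<bar>G \<epsilon> p\<bar> \<bar>H \<epsilon> p\<bar>)"
    by (intro slow_net_mult slow_net_const)
  show "\<forall>\<^sub>F \<epsilon> in at_right 0. \<forall>p\<in>P. \<bar>G \<epsilon> p + H \<epsilon> p\<bar> \<le> 2 * max \<bar>G \<epsilon> p\<bar> \<bar>H \<epsilon> p\<bar>"
    by (intro always_eventually allI ballI) linarith
qed

lemma slow_net_sum:
  "finite I \<Longrightarrow> (\<And>i. i \<in> I \<Longrightarrow> slow_net P (G i)) \<Longrightarrow> slow_net P (\<lambda>\<epsilon> p. \<Sum>i\<in>I. G i \<epsilon> p)"
proof (induction I rule: finite_induct)
  case (insert i I)
  have "slow_net P (\<lambda>\<epsilon> p. G i \<epsilon> p + (\<Sum>i\<in>I. G i \<epsilon> p))" by (rule slow_net_add) (use insert in auto)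
  then show ?case using insert by simp
qed (simp add: slow_net_const)

lemma slow_net_le_inverse: "slow_net P G \<Longrightarrow> \<forall>\<^sub>F \<epsilon> in at_right 0. \<forall>p\<in>P. \<bar>G \<epsilon> p\<bar> \<le> 1 / \<epsilon>"
  unfolding slow_net_def by (drule spec[of _ 1]) simp

lemma slow_net_pullback:
  assumes "slow_net Q G" "\<And>p. p \<in> P \<Longrightarrow> \<pi> p \<in> Q"
  shows "slow_net P (\<lambda>\<epsilon> p. G \<epsilon> (\<pi> p))"
  unfolding slow_net_def
proof
  fix n :: nat
  have "\<forall>\<^sub>F \<epsilon> in at_right 0. \<forall>p\<in>Q. \<bar>G \<epsilon> p\<bar> ^ n \<le> 1 / \<epsilon>" using assms(1) unfolding slow_net_def by simp
  then show "\<forall>\<^sub>F \<epsilon> in at_right 0. \<forall>p\<in>P. \<bar>G \<epsilon> (\<pi> p)\<bar> ^ n \<le> 1 / \<epsilon>"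
    by eventually_elim (use assms(2) in blast)
qed

lemma slow_scale_imp_slow_net:
  assumes "slow_scale r"
  shows "slow_net P (\<lambda>\<epsilon> _. norm (r \<epsilon>))"
  unfolding slow_net_def
proof
  fix n :: nat
  obtain \<epsilon>\<^sub>t where t: "\<epsilon>\<^sub>t > 0" "\<And>\<epsilon>. \<epsilon> \<in> {0<..<\<epsilon>\<^sub>t} \<Longrightarrow> norm (r \<epsilon>) powr real n \<le> 1 / \<epsilon>"
    using assms unfolding slow_scale_def by (meson of_nat_0_le_iff)
  have "norm (r \<epsilon>) ^ n \<le> 1 / \<epsilon>" if "\<epsilon> \<in> {0<..<min \<epsilon>\<^sub>t 1}" for \<epsilon>
  proof (cases "norm (r \<epsilon>) = 0")
    case True
    then have "norm (r \<epsilon>) ^ n \<le> 1" by (cases n) auto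
    also have "1 \<le> 1 / \<epsilon>" using that by simp
    finally show ?thesis .
  next
    case False
    then show ?thesis using t(2)[of \<epsilon>] that by (simp add: powr_realpow)
  qed
  then show "\<forall>\<^sub>F \<epsilon> in at_right 0. \<forall>p\<in>P. \<bar>norm (r \<epsilon>)\<bar> ^ n \<le> 1 / \<epsilon>"
    by (intro eventually_right0I[of "min \<epsilon>\<^sub>t 1"]) (use t in auto)
qed

lemma finite_lists_length_atMost: "finite {is :: 'n::finite list. length is \<le> k}"
  using finite_lists_length_le[of "UNIV :: 'n set" k] by simp

lemma eventually_jet_le_sup_on:
  fixes a :: "'n::finite family"
  assumes "open \<Omega>" "\<And>\<epsilon>. \<epsilon> \<in> {0<..1} \<Longrightarrow> smooth_on \<Omega> (a \<epsilon>)" "compact K" "K \<subseteq> \<Omega>"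
  shows "\<forall>\<^sub>F \<epsilon> in at_right 0. \<forall>x\<in>K. \<bar>jet k (a \<epsilon>) x\<bar> \<le>
      (\<Sum>is\<in>{is. length is \<le> k}. sup_on K (mderiv (count (mset is)) (a \<epsilon>)))"
  using eventually_small[OF zero_less_one]
proof eventually_elim
  case (elim \<epsilon>)
  show ?case
  proof
    fix x assume x: "x \<in> K"
    have "jet k (a \<epsilon>) x \<le> (\<Sum>is\<in>{is. length is \<le> k}. sup_on K (mderiv (count (mset is)) (a \<epsilon>)))"
      by (rule jet_le_sup_on[OF assms(1) _ assms(3,4) x]) (use elim assms(2) in auto)
    then show "\<bar>jet k (a \<epsilon>) x\<bar> \<le> (\<Sum>is\<in>{is. length is \<le> k}. sup_on K (mderiv (count (mset is)) (a \<epsilon>)))"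
      using jet_nonneg[of k "a \<epsilon>" x] by simp
  qed
qed

lemma slow_net_jet:
  fixes a :: "'n::finite family"
  assumes "open \<Omega>" "\<And>\<epsilon>. \<epsilon> \<in> {0<..1} \<Longrightarrow> smooth_on \<Omega> (a \<epsilon>)" "compact K" "K \<subseteq> \<Omega>"
    "\<And>\<alpha>. slow_scale (\<lambda>\<epsilon>. sup_on K (mderiv \<alpha> (a \<epsilon>)))"
  shows "slow_net K (\<lambda>\<epsilon>. jet k (a \<epsilon>))"
proof (rule slow_net_mono)
  show "slow_net K (\<lambda>\<epsilon> _. \<Sum>is\<in>{is. length is \<le> k}. sup_on K (mderiv (count (mset is)) (a \<epsilon>)))"
  proof (intro slow_net_sum finite_lists_length_atMost)
    fix "is" :: "'n list"
    show "slow_net K (\<lambda>\<epsilon> _. sup_on K (mderiv (count (mset is)) (a \<epsilon>)))"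
      by (rule slow_net_mono[OF slow_scale_imp_slow_net[OF assms(5)[of "count (mset is)"]]]) simp
  qed
  show "\<forall>\<^sub>F \<epsilon> in at_right 0. \<forall>x\<in>K. \<bar>jet k (a \<epsilon>) x\<bar> \<le>
      (\<Sum>is\<in>{is. length is \<le> k}. sup_on K (mderiv (count (mset is)) (a \<epsilon>)))"
    by (rule eventually_jet_le_sup_on[OF assms(1-4)])
qed

lemma powr_add_le:
  fixes \<epsilon> :: real
  assumes "0 < \<epsilon>" "\<epsilon> < 1 / 2" "q' \<ge> q + 1"
  shows "\<epsilon> powr q' + \<epsilon> powr q' \<le> \<epsilon> powr q"
proof -
  have "\<epsilon> powr q' \<le> \<epsilon> powr (q + 1)" using assms by (intro powr_mono') auto
  also have "\<dots> = \<epsilon> powr q * \<epsilon>" using assms by (simp add: powr_add)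
  also have "\<dots> \<le> \<epsilon> powr q * (1/2)" using assms by (intro mult_left_mono) auto
  finally show ?thesis by simp
qed

lemma negligible_net_mono:
  assumes "negligible_net P H" "\<forall>\<^sub>F \<epsilon> in at_right 0. \<forall>x\<in>P. \<bar>G \<epsilon> x\<bar> \<le> H \<epsilon> x"
  shows "negligible_net P G"
  unfolding negligible_net_def
proof
  fix q
  have "\<forall>\<^sub>F \<epsilon> in at_right 0. \<forall>x\<in>P. \<bar>H \<epsilon> x\<bar> \<le> \<epsilon> powr q"
    using assms(1) unfolding negligible_net_def by simp
  with assms(2) show "\<forall>\<^sub>F \<epsilon> in at_right 0. \<forall>x\<in>P. \<bar>G \<epsilon> x\<bar> \<le> \<epsilon> powr q"
    by eventually_elim fastforce
qed

lemma negligible_net_add: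
  assumes "negligible_net P G" "negligible_net P H"
  shows "negligible_net P (\<lambda>\<epsilon> x. G \<epsilon> x + H \<epsilon> x)"
  unfolding negligible_net_def
proof
  fix q :: real
  have "\<forall>\<^sub>F \<epsilon> in at_right 0. \<forall>x\<in>P. \<bar>G \<epsilon> x\<bar> \<le> \<epsilon> powr (q + 1)" "\<forall>\<^sub>F \<epsilon> in at_right 0. \<forall>x\<in>P. \<bar>H \<epsilon> x\<bar> \<le> \<epsilon> powr (q + 1)"
    using assms unfolding negligible_net_def by simp_all
  moreover have "\<forall>\<^sub>F \<epsilon> in at_right (0::real). 0 < \<epsilon> \<and> \<epsilon> < 1 / 2" by (rule eventually_small) simp
  ultimately show "\<forall>\<^sub>F \<epsilon> in at_right 0. \<forall>x\<in>P. \<bar>G \<epsilon> x + H \<epsilon> x\<bar> \<le> \<epsilon> powr q"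
  proof eventually_elim
    case (elim \<epsilon>)
    then show ?case using powr_add_le[of \<epsilon> q "q + 1"] by fastforce
  qed
qed

lemma negligible_net_0: "negligible_net P (\<lambda>_ _. 0)"
  unfolding negligible_net_def by simp

lemma negligible_net_sum:
  "finite I \<Longrightarrow> (\<And>i. i \<in> I \<Longrightarrow> negligible_net P (G i)) \<Longrightarrow> negligible_net P (\<lambda>\<epsilon> p. \<Sum>i\<in>I. G i \<epsilon> p)"
proof (induction I rule: finite_induct)
  case (insert i I)
  have "negligible_net P (\<lambda>\<epsilon> p. G i \<epsilon> p + (\<Sum>i\<in>I. G i \<epsilon> p))" by (rule negligible_net_add) (use insert in auto)
  then show ?case using insert by simp
qed (simp add: negligible_net_0)

lemma moderate_net_const: "moderate_net P (\<lambda>_ _. c)"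
proof -
  have "\<forall>\<^sub>F \<epsilon> in at_right 0. \<forall>x\<in>P. \<bar>c\<bar> \<le> \<epsilon> powr (- 1)"
    using slow_net_le_inverse[OF slow_net_const[of P c]] eventually_small[OF zero_less_one]
    by eventually_elim (auto simp: powr_minus divide_inverse)
  then show ?thesis unfolding moderate_net_def by blast
qed

lemma moderate_net_mono:
  assumes "moderate_net P H" "\<forall>\<^sub>F \<epsilon> in at_right 0. \<forall>x\<in>P. \<bar>G \<epsilon> x\<bar> \<le> H \<epsilon> x"
  shows "moderate_net P G"
proof -
  obtain p where "\<forall>\<^sub>F \<epsilon> in at_right 0. \<forall>x\<in>P. \<bar>H \<epsilon> x\<bar> \<le> \<epsilon> powr (- p)"
    using assms(1) unfolding moderate_net_def by blast
  with assms(2) have "\<forall>\<^sub>F \<epsilon> in at_right 0. \<forall>x\<in>P. \<bar>G \<epsilon> x\<bar> \<le> \<epsilon> powr (- p)"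
    by eventually_elim fastforce
  then show ?thesis unfolding moderate_net_def by blast
qed

lemma moderate_net_add:
  assumes "moderate_net P G" "moderate_net P H"
  shows "moderate_net P (\<lambda>\<epsilon> x. G \<epsilon> x + H \<epsilon> x)"
proof -
  obtain p r where pr: "\<forall>\<^sub>F \<epsilon> in at_right 0. \<forall>x\<in>P. \<bar>G \<epsilon> x\<bar> \<le> \<epsilon> powr (- p)"
    "\<forall>\<^sub>F \<epsilon> in at_right 0. \<forall>x\<in>P. \<bar>H \<epsilon> x\<bar> \<le> \<epsilon> powr (- r)"
    using assms unfolding moderate_net_def by blast
  have "\<forall>\<^sub>F \<epsilon> in at_right (0::real). 0 < \<epsilon> \<and> \<epsilon> < 1/2" by (rule eventually_small) simp
  with pr have "\<forall>\<^sub>F \<epsilon> in at_right 0. \<forall>x\<in>P. \<bar>G \<epsilon> x + H \<epsilon> x\<bar> \<le> \<epsilon> powr (- (max p r + 1))"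
  proof eventually_elim
    case (elim \<epsilon>)
    have "\<epsilon> powr (- p) \<le> \<epsilon> powr (- max p r)" "\<epsilon> powr (- r) \<le> \<epsilon> powr (- max p r)"
      using elim by (auto intro!: powr_mono')
    then show ?case
      using elim powr_add_le[of \<epsilon> "- (max p r + 1)" "- max p r"] by fastforce
  qed
  then show ?thesis unfolding moderate_net_def by blast
qed

lemma moderate_net_sum:
  "finite I \<Longrightarrow> (\<And>i. i \<in> I \<Longrightarrow> moderate_net P (G i)) \<Longrightarrow> moderate_net P (\<lambda>\<epsilon> p. \<Sum>i\<in>I. G i \<epsilon> p)"
proof (induction I rule: finite_induct)
  case (insert i I)
  have "moderate_net P (\<lambda>\<epsilon> p. G i \<epsilon> p + (\<Sum>i\<in>I. G i \<epsilon> p))" by (rule moderate_net_add) (use insert in auto)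
  then show ?case using insert by simp
qed (simp add: moderate_net_const)

lemma negligible_net_mult_moderate:
  assumes "negligible_net P G" "moderate_net P H"
  shows "negligible_net P (\<lambda>\<epsilon> x. G \<epsilon> x * H \<epsilon> x)"
  unfolding negligible_net_def
proof
  fix q :: real
  obtain p where p: "\<forall>\<^sub>F \<epsilon> in at_right 0. \<forall>x\<in>P. \<bar>H \<epsilon> x\<bar> \<le> \<epsilon> powr (- p)"
    using assms unfolding moderate_net_def by blast
  have "\<forall>\<^sub>F \<epsilon> in at_right 0. \<forall>x\<in>P. \<bar>G \<epsilon> x\<bar> \<le> \<epsilon> powr (q + p)"
    using assms unfolding negligible_net_def by simp
  with p show "\<forall>\<^sub>F \<epsilon> in at_right 0. \<forall>x\<in>P. \<bar>G \<epsilon> x * H \<epsilon> x\<bar> \<le> \<epsilon> powr q"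
  proof eventually_elim
    case (elim \<epsilon>)
    show ?case
    proof
      fix x assume "x \<in> P"
      then have "\<bar>G \<epsilon> x * H \<epsilon> x\<bar> \<le> \<epsilon> powr (q + p) * \<epsilon> powr (- p)"
        unfolding abs_mult using elim by (intro mult_mono) auto
      then show "\<bar>G \<epsilon> x * H \<epsilon> x\<bar> \<le> \<epsilon> powr q" by (simp add: powr_add[symmetric])
    qed
  qed
qed

lemma bigo_powr_imp_eventually_le:
  assumes "S \<in> O[at_right 0](\<lambda>\<epsilon>. \<epsilon> powr (q + 1))"
  shows "\<forall>\<^sub>F \<epsilon> in at_right 0. \<bar>S \<epsilon>\<bar> \<le> \<epsilon> powr (q::real)"
proof -
  obtain c where c: "c > 0" "\<forall>\<^sub>F \<epsilon> in at_right 0. norm (S \<epsilon>) \<le> c * norm (\<epsilon> powr (q + 1))"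
    using landau_o.bigE[OF assms] by blast
  have "\<forall>\<^sub>F \<epsilon> in at_right (0::real). 0 < \<epsilon> \<and> \<epsilon> < 1 / c" by (rule eventually_small) (use c in simp)
  with c(2) show ?thesis
  proof eventually_elim
    case (elim \<epsilon>)
    then have "\<bar>S \<epsilon>\<bar> \<le> (c * \<epsilon>) * \<epsilon> powr q" by (simp add: powr_add mult_ac)
    also have "\<dots> \<le> 1 * \<epsilon> powr q" using elim c by (intro mult_right_mono) (auto simp: field_simps)
    finally show ?case by simp
  qed
qed

lemma moderate_imp_moderate_net_jet:
  assumes "open \<Omega>" "u \<in> moderate \<Omega>" "compact K" "K \<subseteq> \<Omega>"
  shows "moderate_net K (\<lambda>\<epsilon>. jet k (u \<epsilon>))"
proof (rule moderate_net_mono)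
  show "moderate_net K (\<lambda>\<epsilon> _. \<Sum>is\<in>{is. length is \<le> k}. sup_on K (mderiv (count (mset is)) (u \<epsilon>)))"
  proof (intro moderate_net_sum finite_lists_length_atMost)
    fix "is" :: "'a list"
    obtain p where "(\<lambda>\<epsilon>. sup_on K (mderiv (count (mset is)) (u \<epsilon>))) \<in> O[at_right 0](\<lambda>\<epsilon>. \<epsilon> powr (- p))"
      using assms unfolding moderate_def by blast
    then have "\<forall>\<^sub>F \<epsilon> in at_right 0. \<bar>sup_on K (mderiv (count (mset is)) (u \<epsilon>))\<bar> \<le> \<epsilon> powr (- (p + 1))"
      by (intro bigo_powr_imp_eventually_le) simp
    then have "\<forall>\<^sub>F \<epsilon> in at_right 0. \<forall>x\<in>K. \<bar>sup_on K (mderiv (count (mset is)) (u \<epsilon>))\<bar> \<le> \<epsilon> powr (- (p + 1))"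
      by eventually_elim simp
    then show "moderate_net K (\<lambda>\<epsilon> _. sup_on K (mderiv (count (mset is)) (u \<epsilon>)))"
      unfolding moderate_net_def by blast
  qed
  show "\<forall>\<^sub>F \<epsilon> in at_right 0. \<forall>x\<in>K. \<bar>jet k (u \<epsilon>) x\<bar> \<le>
      (\<Sum>is\<in>{is. length is \<le> k}. sup_on K (mderiv (count (mset is)) (u \<epsilon>)))"
    by (rule eventually_jet_le_sup_on) (use assms in \<open>auto simp: moderate_def\<close>)
qed

lemma negligible_imp_negligible_net_jet:
  assumes "open \<Omega>" "u \<in> negligible_families \<Omega>" "compact K" "K \<subseteq> \<Omega>"
  shows "negligible_net K (\<lambda>\<epsilon>. jet k (u \<epsilon>))"
proof (rule negligible_net_mono)
  show "negligible_net K (\<lambda>\<epsilon> _. \<Sum>is\<in>{is. length is \<le> k}. sup_on K (mderiv (count (mset is)) (u \<epsilon>)))"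
  proof (intro negligible_net_sum finite_lists_length_atMost)
    fix "is" :: "'a list"
    show "negligible_net K (\<lambda>\<epsilon> _. sup_on K (mderiv (count (mset is)) (u \<epsilon>)))"
      unfolding negligible_net_def
    proof
      fix q :: real
      have "(\<lambda>\<epsilon>. sup_on K (mderiv (count (mset is)) (u \<epsilon>))) \<in> O[at_right 0](\<lambda>\<epsilon>. \<epsilon> powr (max q 0 + 1))"
        using assms unfolding negligible_families_def by simp
      then have "\<forall>\<^sub>F \<epsilon> in at_right 0. \<bar>sup_on K (mderiv (count (mset is)) (u \<epsilon>))\<bar> \<le> \<epsilon> powr (max q 0)"
        by (rule bigo_powr_imp_eventually_le)
      with eventually_small[OF zero_less_one]
      show "\<forall>\<^sub>F \<epsilon> in at_right 0. \<forall>x\<in>K. \<bar>sup_on K (mderiv (count (mset is)) (u \<epsilon>))\<bar> \<le> \<epsilon> powr q"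
      proof eventually_elim
        case (elim \<epsilon>)
        have "\<epsilon> powr (max q 0) \<le> \<epsilon> powr q" using elim by (intro powr_mono') auto
        then show ?case using elim by simp
      qed
    qed
  qed
  show "\<forall>\<^sub>F \<epsilon> in at_right 0. \<forall>x\<in>K. \<bar>jet k (u \<epsilon>) x\<bar> \<le>
      (\<Sum>is\<in>{is. length is \<le> k}. sup_on K (mderiv (count (mset is)) (u \<epsilon>)))"
    by (rule eventually_jet_le_sup_on) (use assms in \<open>auto simp: negligible_families_def\<close>)
qed

section \<open>Baire category in the space of smooth functions supported in a compact set\<close>

lemma iterated_pderiv_add:
  assumes "smooth_on UNIV \<phi>" "smooth_on UNIV \<psi>"
  shows "foldr pderiv_at is (\<lambda>x. \<phi> x + \<psi> x) = (\<lambda>x. foldr pderiv_at is \<phi> x + foldr pderiv_at is \<psi> x)"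
proof (induction "is")
  case (Cons i "is")
  have "foldr pderiv_at is \<phi> differentiable at x" "foldr pderiv_at is \<psi> differentiable at x" for x
    using smooth_onD[OF smooth_on_foldr[OF assms(1)]] smooth_onD[OF smooth_on_foldr[OF assms(2)]] by simp_all
  then show ?case using Cons by (auto simp: pderiv_at_add)
qed simp

lemma smooth_supp_foldr: "closed K \<Longrightarrow> \<phi> \<in> smooth_supp K \<Longrightarrow> foldr pderiv_at is \<phi> \<in> smooth_supp K"
  by (induction "is") (simp_all add: smooth_supp_pderiv)

lemma smooth_supp_in_bcontfun:
  assumes "compact K" "\<phi> \<in> smooth_supp K"
  shows "\<phi> \<in> bcontfun"
proof -
  have "bounded (\<phi> ` K)"
    by (intro compact_imp_bounded compact_continuous_image smooth_suppD(3)[OF assms(2)] assms(1))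
  then obtain b where b: "\<And>x. x \<in> K \<Longrightarrow> cmod (\<phi> x) \<le> b" unfolding bounded_iff by auto
  have "cmod (\<phi> x) \<le> max b 0" for x
    using b[of x] smooth_suppD(2)[OF assms(2), of x] by (cases "x \<in> K") auto
  then show ?thesis by (rule bcontfun_normI[OF smooth_suppD(3)[OF assms(2)]])
qed

lemma has_derivative_pderivs:
  assumes "f differentiable at x"
  shows "(f has_derivative (\<lambda>h. \<Sum>j\<in>UNIV. h $ j *\<^sub>R pderiv_at j f x)) (at x)"
proof -
  obtain D where D: "(f has_derivative D) (at x)" using assms unfolding differentiable_def by blast
  have lin: "linear D" by (rule has_derivative_linear[OF D])
  have "D h = (\<Sum>j\<in>UNIV. h $ j *\<^sub>R pderiv_at j f x)" for h
  proof -
    have "D h = D (\<Sum>j\<in>UNIV. h $ j *\<^sub>R axis j 1)"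
      using basis_expansion[of h] by (simp add: scalar_mult_eq_scaleR)
    also have "\<dots> = (\<Sum>j\<in>UNIV. h $ j *\<^sub>R D (axis j 1))"
      by (simp add: linear_sum[OF lin] linear_scale[OF lin])
    finally show ?thesis by (simp add: pderiv_at_eqI[OF D])
  qed
  then have "D = (\<lambda>h. \<Sum>j\<in>UNIV. h $ j *\<^sub>R pderiv_at j f x)" by (rule ext)
  then show ?thesis using D by simp
qed

text \<open>The limit has the derivative that is assembled from the limits of the partial derivatives; the
  uniformity is needed in the operator norm, which finitely many coordinates control.\<close>

lemma pderivs_uniform_limit:
  fixes f :: "nat \<Rightarrow> real^'n::finite \<Rightarrow> complex"
  assumes diff: "\<And>n x. f n differentiable at x"
    and lim: "\<And>x. (\<lambda>n. f n x) \<longlonglongrightarrow> g x"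
    and limd: "\<And>j. uniform_limit UNIV (\<lambda>n. pderiv_at j (f n)) (d j) sequentially"
  shows "(g has_derivative (\<lambda>h. \<Sum>j\<in>UNIV. h $ j *\<^sub>R d j x)) (at x)"
proof -
  let ?f' = "\<lambda>n x h. \<Sum>j\<in>UNIV. h $ j *\<^sub>R pderiv_at j (f n) x"
  let ?g' = "\<lambda>x h. \<Sum>j\<in>UNIV. h $ j *\<^sub>R d j x"
  have "\<exists>g1. \<forall>x\<in>UNIV. (\<lambda>n. f n x) \<longlonglongrightarrow> g1 x \<and> (g1 has_derivative ?g' x) (at x within UNIV)"
  proof (rule has_derivative_sequence)
    show "(f n has_derivative ?f' n x) (at x within UNIV)" for n x
      using has_derivative_pderivs[OF diff] by simp
    show "(\<lambda>n. f n 0) \<longlonglongrightarrow> g 0" by (rule lim)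
    fix e :: real assume e: "e > 0"
    let ?e = "e / real CARD('n)"
    have "\<forall>\<^sub>F n in sequentially. \<forall>j. \<forall>x. dist (pderiv_at j (f n) x) (d j x) < ?e"
      using e limd by (intro eventually_all_finite) (auto simp: uniform_limit_iff)
    then show "\<forall>\<^sub>F n in sequentially. \<forall>x\<in>UNIV. \<forall>h. norm (?f' n x h - ?g' x h) \<le> e * norm h"
    proof eventually_elim
      case (elim n)
      show ?case
      proof (intro ballI allI)
        fix x h
        have "norm (?f' n x h - ?g' x h) = norm (\<Sum>j\<in>UNIV. h $ j *\<^sub>R (pderiv_at j (f n) x - d j x))"
          by (simp add: sum_subtractf scaleR_diff_right)
        also have "\<dots> \<le> (\<Sum>j\<in>(UNIV::'n set). norm h * ?e)"
        proof (rule order_trans[OF norm_sum sum_mono])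
          fix j :: 'n
          have "dist (pderiv_at j (f n) x) (d j x) \<le> ?e" using elim less_imp_le by blast
          then show "norm (h $ j *\<^sub>R (pderiv_at j (f n) x - d j x)) \<le> norm h * ?e"
            unfolding norm_scaleR dist_norm by (intro mult_mono) (auto simp: component_le_norm_cart)
        qed
        also have "\<dots> = e * norm h" by simp
        finally show "norm (?f' n x h - ?g' x h) \<le> e * norm h" .
      qed
    qed
  qed auto
  then obtain g1 where g1: "\<And>x. (\<lambda>n. f n x) \<longlonglongrightarrow> g1 x" "\<And>x. (g1 has_derivative ?g' x) (at x)" by auto
  then have "g1 = g" using LIMSEQ_unique[OF _ lim] by blast
  then show ?thesis using g1 by simp
qed

text \<open>All iterated partial derivatives of a function, as a point of a countable power of a Banach
  space of bounded continuous functions. The product metric on this power is complete, and the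
  topology that it induces on the smooth functions supported in a compact set is that of uniform
  convergence of all derivatives.\<close>

definition derivatives :: "(real^'n::finite \<Rightarrow> complex) \<Rightarrow> 'n list \<Rightarrow> ((real^'n) \<Rightarrow>\<^sub>C complex)" where
  "derivatives \<phi> is = Bcontfun (foldr pderiv_at is \<phi>)"

lemma apply_derivatives:
  assumes "compact K" "\<phi> \<in> smooth_supp K"
  shows "apply_bcontfun (derivatives \<phi> is) = foldr pderiv_at is \<phi>"
  unfolding derivatives_def
  by (intro Bcontfun_inverse smooth_supp_in_bcontfun[OF assms(1)] smooth_supp_foldr compact_imp_closed assms)

lemma derivatives_component_uniform_limit:
  assumes "compact K" "\<And>n. \<Phi> n \<in> smooth_supp K" "(\<lambda>n. derivatives (\<Phi> n)) \<longlonglongrightarrow> F"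
  shows "uniform_limit UNIV (\<lambda>n. foldr pderiv_at is (\<Phi> n)) (apply_bcontfun (F is)) sequentially"
proof -
  have "continuous_on UNIV (\<lambda>F :: 'a list \<Rightarrow> ((real^'a) \<Rightarrow>\<^sub>C complex). F is)"
    by (rule continuous_on_product_coordinates)
  then have "isCont (\<lambda>F :: 'a list \<Rightarrow> ((real^'a) \<Rightarrow>\<^sub>C complex). F is) F"
    unfolding continuous_on_eq_continuous_at[OF open_UNIV] by (rule bspec) simp
  from isCont_tendsto_compose[OF this assms(3)]
  have "(\<lambda>n. derivatives (\<Phi> n) is) \<longlonglongrightarrow> F is" .
  from tendsto_bcontfun_uniform_limit[OF this]
  show ?thesis unfolding apply_derivatives[OF assms(1,2)] .
qed

text \<open>Completeness: if all derivatives converge uniformly, their limits are the derivatives of the limit.\<close>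

lemma derivatives_limit:
  fixes K :: "(real^'n::finite) set"
  assumes "compact K" "\<And>n. \<Phi> n \<in> smooth_supp K" "(\<lambda>n. derivatives (\<Phi> n)) \<longlonglongrightarrow> F"
  shows "apply_bcontfun (F []) \<in> smooth_supp K" "derivatives (apply_bcontfun (F [])) = F"
proof -
  let ?g = "\<lambda>is. apply_bcontfun (F is)"
  note u = derivatives_component_uniform_limit[OF assms]
  have lim: "(\<lambda>n. foldr pderiv_at is (\<Phi> n) x) \<longlonglongrightarrow> ?g is x" for "is" x
    by (rule tendsto_uniform_limitI[OF u]) simp
  have D: "(?g is has_derivative (\<lambda>h. \<Sum>j\<in>UNIV. h $ j *\<^sub>R ?g (j # is) x)) (at x)" for "is" x
  proof (rule pderivs_uniform_limit[OF _ lim])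
    show "foldr pderiv_at is (\<Phi> n) differentiable at x" for n x
      using smooth_onD[OF smooth_on_foldr[OF smooth_suppD(1)[OF assms(2)]]] by simp
    show "uniform_limit UNIV (\<lambda>n. pderiv_at j (foldr pderiv_at is (\<Phi> n))) (?g (j # is)) sequentially" for j
      using u[of "j # is"] by simp
  qed
  have p: "pderiv_at j (?g is) = ?g (j # is)" for j "is"
  proof
    fix x
    have "pderiv_at j (?g is) x = (\<Sum>i\<in>UNIV. (axis j 1 :: real^'n) $ i *\<^sub>R ?g (i # is) x)"
      by (rule pderiv_at_eqI[OF D])
    also have "\<dots> = (\<Sum>i\<in>UNIV. if i = j then ?g (i # is) x else 0)"
      by (intro sum.cong) (auto simp: axis_def)
    finally show "pderiv_at j (?g is) x = ?g (j # is) x" by simp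
  qed
  have f: "foldr pderiv_at is (?g []) = ?g is" for "is"
    by (induction "is") (simp_all add: p)
  have "foldr pderiv_at is (?g []) differentiable_on UNIV" for "is"
    unfolding f
  proof (rule differentiable_at_imp_differentiable_on)
    show "?g is differentiable at x" for x using D[of "is" x] unfolding differentiable_def by blast
  qed
  then have "smooth_on UNIV (?g [])" unfolding smooth_on_def by (rule allI)
  moreover have "?g [] x = 0" if "x \<notin> K" for x
  proof -
    have "(\<lambda>n. 0) \<longlonglongrightarrow> ?g [] x"
      using lim[of "[]" x] smooth_suppD(2)[OF assms(2) that] by simp
    then show ?thesis by (simp add: LIMSEQ_const_iff)
  qed
  ultimately show m: "apply_bcontfun (F []) \<in> smooth_supp K" unfolding smooth_supp_def by simp
  show "derivatives (apply_bcontfun (F [])) = F"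
    by (intro ext bcontfun_eqI) (simp add: apply_derivatives[OF assms(1) m] f)
qed

lemma closed_derivatives_image:
  assumes "compact K" "A \<subseteq> smooth_supp K"
    and cl: "\<And>\<Phi> \<phi>. (\<And>i. \<Phi> i \<in> A) \<Longrightarrow> \<phi> \<in> smooth_supp K \<Longrightarrow> uniform_limit UNIV \<Phi> \<phi> sequentially \<Longrightarrow> \<phi> \<in> A"
  shows "closed (derivatives ` A)"
  unfolding closed_sequential_limits
proof (intro allI impI)
  fix X F assume "(\<forall>n. X n \<in> derivatives ` A) \<and> X \<longlonglongrightarrow> F"
  then have X: "\<And>n. X n \<in> derivatives ` A" "X \<longlonglongrightarrow> F" by auto
  then have "\<forall>n. \<exists>\<phi>. \<phi> \<in> A \<and> X n = derivatives \<phi>" by blast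
  then obtain \<Phi> where \<Phi>: "\<And>n. \<Phi> n \<in> A" "\<And>n. X n = derivatives (\<Phi> n)" by metis
  have s: "\<Phi> n \<in> smooth_supp K" for n using \<Phi>(1) assms(2) by blast
  have l: "(\<lambda>n. derivatives (\<Phi> n)) \<longlonglongrightarrow> F" using X(2) ext[of X, OF \<Phi>(2)] by simp
  have "uniform_limit UNIV \<Phi> (apply_bcontfun (F [])) sequentially"
    using derivatives_component_uniform_limit[OF assms(1) s l, of "[]"] by simp
  then have "apply_bcontfun (F []) \<in> A"
    by (rule cl[OF \<Phi>(1) derivatives_limit(1)[OF assms(1) s l]])
  then show "F \<in> derivatives ` A"
    using derivatives_limit(2)[OF assms(1) s l] by (metis image_eqI)
qed

text \<open>A basic open set of the product restricts only finitely many derivatives, and these are bounded by a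
  jet of sufficiently high order.\<close>

lemma derivatives_neighbourhood:
  fixes K :: "(real^'n::finite) set"
  assumes "compact K" "\<phi> \<in> smooth_supp K" "open W" "derivatives \<phi> \<in> W"
  obtains k \<delta> where "\<delta> > 0"
    "\<And>\<psi>. \<psi> \<in> smooth_supp K \<Longrightarrow> (\<And>x. x \<in> K \<Longrightarrow> jet k \<psi> x < \<delta>) \<Longrightarrow> derivatives (\<lambda>x. \<phi> x + \<psi> x) \<in> W"
proof -
  have "openin (product_topology (\<lambda>_. euclidean) UNIV) W" using assms(3) by (simp add: open_fun_def)
  from product_topology_open_contains_basis[OF this assms(4)]
  obtain X where "derivatives \<phi> \<in> Pi\<^sub>E UNIV X" "\<forall>i. openin euclidean (X i)"
    "finite {i. X i \<noteq> topspace euclidean}" "Pi\<^sub>E UNIV X \<subseteq> W" by (elim exE conjE) (rule that)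
  then have X: "derivatives \<phi> \<in> Pi\<^sub>E UNIV X" "\<And>i. open (X i)" "finite {i. X i \<noteq> UNIV}" "Pi\<^sub>E UNIV X \<subseteq> W"
    by simp_all
  have "\<exists>d>0. ball (derivatives \<phi> is) d \<subseteq> X is" for "is"
    using X(2)[of "is"] PiE_mem[OF X(1) UNIV_I, of "is"] by (meson open_contains_ball)
  then obtain d where d: "\<And>is. d is > 0" "\<And>is. ball (derivatives \<phi> is) (d is) \<subseteq> X is" by metis
  let ?I = "{i. X i \<noteq> UNIV}"
  define \<delta> where "\<delta> = Min (insert 1 (d ` ?I)) / 2"
  define k where "k = Max (insert 0 (length ` ?I))"
  have \<delta>: "\<delta> > 0" unfolding \<delta>_def using X(3) d(1) by (subst half_gt_zero_iff, subst Min_gr_iff) auto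
  have "derivatives (\<lambda>x. \<phi> x + \<psi> x) \<in> W"
    if \<psi>: "\<psi> \<in> smooth_supp K" "\<And>x. x \<in> K \<Longrightarrow> jet k \<psi> x < \<delta>" for \<psi>
  proof -
    have sum: "(\<lambda>x. \<phi> x + \<psi> x) \<in> smooth_supp K" by (intro smooth_supp_add assms \<psi>)
    have "derivatives (\<lambda>x. \<phi> x + \<psi> x) is \<in> X is" for "is"
    proof (cases "is \<in> ?I")
      case True
      have "cmod (foldr pderiv_at is \<psi> x) \<le> \<delta>" for x
      proof (cases "x \<in> K")
        case True
        have "length is \<le> k" unfolding k_def using \<open>is \<in> ?I\<close> X(3) by (intro Max_ge) auto
        then have "cmod (foldr pderiv_at is \<psi> x) \<le> jet k \<psi> x"
          by (rule order_trans[OF iterated_pderiv_le_jet jet_mono])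
        then show ?thesis using \<psi>(2)[OF True] by simp
      next
        case False
        then show ?thesis
          using smooth_suppD(2)[OF smooth_supp_foldr[OF compact_imp_closed[OF assms(1)] \<psi>(1)]] \<delta> by simp
      qed
      then have "dist (derivatives \<phi> is) (derivatives (\<lambda>x. \<phi> x + \<psi> x) is) \<le> \<delta>"
        by (intro dist_bound) (simp add: apply_derivatives[OF assms(1)] assms(2) sum dist_norm
          iterated_pderiv_add smooth_suppD(1)[OF assms(2)] smooth_suppD(1)[OF \<psi>(1)])
      moreover have "Min (insert 1 (d ` ?I)) \<le> d is" using True X(3) by (intro Min_le) auto
      ultimately have "derivatives (\<lambda>x. \<phi> x + \<psi> x) is \<in> ball (derivatives \<phi> is) (d is)"
        using \<delta> unfolding \<delta>_def by simp
      then show ?thesis using d(2) by (rule subsetD[rotated])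
    qed simp
    then have "derivatives (\<lambda>x. \<phi> x + \<psi> x) \<in> Pi\<^sub>E UNIV X" by (simp add: PiE_UNIV_domain)
    then show ?thesis using X(4) by (rule subsetD[rotated])
  qed
  then show thesis by (rule that[OF \<delta>])
qed

text \<open>A uniform boundedness principle. If for every \<open>\<phi>\<close> some \<open>N\<close> works for all \<open>l\<close>, then
  one \<open>N\<close> works for all \<open>\<phi>\<close>: otherwise, choosing for each \<open>N\<close> a bad \<open>l\<close>, the closed sets
  \<open>A N l m\<close> would be nowhere dense for these countably many indices and yet cover the space. A
  symmetric convex set with an interior point contains a neighbourhood of zero, and a
  neighbourhood of zero is described by finitely many derivatives.\<close>

lemma smooth_supp_uniform_boundedness:
  fixes K :: "(real^'n::finite) set" and A :: "nat \<Rightarrow> nat \<Rightarrow> nat \<Rightarrow> (real^'n \<Rightarrow> complex) set"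
  assumes K: "compact K"
    and closed: "\<And>N l m \<Phi> \<phi>. (\<And>i. \<Phi> i \<in> smooth_supp K \<inter> A N l m) \<Longrightarrow> \<phi> \<in> smooth_supp K \<Longrightarrow>
      uniform_limit UNIV \<Phi> \<phi> sequentially \<Longrightarrow> \<phi> \<in> A N l m"
    and convex: "\<And>N l m \<phi> \<psi>. \<phi> \<in> smooth_supp K \<inter> A N l m \<Longrightarrow> \<psi> \<in> smooth_supp K \<inter> A N l m \<Longrightarrow>
      (\<lambda>x. (\<phi> x - \<psi> x) / 2) \<in> A N l m"
    and cover: "\<And>\<phi>. \<phi> \<in> smooth_supp K \<Longrightarrow> \<exists>N. \<forall>l. \<exists>m. \<phi> \<in> A N l m"
  shows "\<exists>N. \<forall>l. \<exists>m k \<delta>. \<delta> > 0 \<and>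
    (\<forall>\<phi>\<in>smooth_supp K. (\<forall>x\<in>K. jet k \<phi> x < \<delta>) \<longrightarrow> \<phi> \<in> A N l m)"
proof (rule ccontr)
  assume "\<not> ?thesis"
  then obtain L where L: "\<And>N m k \<delta>. \<delta> > 0 \<Longrightarrow>
      \<exists>\<phi>\<in>smooth_supp K. (\<forall>x\<in>K. jet k \<phi> x < \<delta>) \<and> \<phi> \<notin> A N (L N) m" by metis
  define T where "T N m = derivatives ` (smooth_supp K \<inter> A N (L N) m)" for N m
  define S where "S = derivatives ` smooth_supp K"
  let ?X = "top_of_set S"
  have "closed S" unfolding S_def by (rule closed_derivatives_image[OF K]) auto
  then have cm: "completely_metrizable_space ?X"
    using completely_metrizable_space_closedin completely_metrizable_space_euclidean closed_closedin by blast
  have T: "closedin ?X (T N m)" "?X interior_of T N m = {}" for N m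
  proof -
    have "closed (T N m)"
      unfolding T_def
    proof (rule closed_derivatives_image[OF K])
      fix \<Phi> \<phi>
      assume "\<And>i. \<Phi> i \<in> smooth_supp K \<inter> A N (L N) m" and \<phi>: "\<phi> \<in> smooth_supp K"
        and "uniform_limit UNIV \<Phi> \<phi> sequentially"
      then have "\<phi> \<in> A N (L N) m" by (rule closed)
      then show "\<phi> \<in> smooth_supp K \<inter> A N (L N) m" using \<phi> by simp
    qed simp
    then show "closedin ?X (T N m)" by (rule closed_subset[rotated]) (auto simp: T_def S_def)
    show "?X interior_of T N m = {}"
    proof (rule ccontr)
      assume "?X interior_of T N m \<noteq> {}"
      then obtain F Z where Z: "openin ?X Z" "F \<in> Z" "Z \<subseteq> T N m"
        unfolding interior_of_def by auto
      then obtain W where W: "open W" "Z = S \<inter> W" by (auto simp: openin_open)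
      obtain \<phi> where \<phi>: "\<phi> \<in> smooth_supp K" "F = derivatives \<phi>" using Z(2) W(2) by (auto simp: S_def)
      obtain k \<delta> where k: "\<delta> > 0" "\<And>\<psi>. \<psi> \<in> smooth_supp K \<Longrightarrow> (\<And>x. x \<in> K \<Longrightarrow> jet k \<psi> x < \<delta>) \<Longrightarrow>
          derivatives (\<lambda>x. \<phi> x + \<psi> x) \<in> W"
        using derivatives_neighbourhood[OF K \<phi>(1) W(1)] Z(2) W(2) \<phi>(2) by blast
      \<comment> \<open>Both \<open>\<phi> + \<psi>\<close> and \<open>\<phi> - \<psi>\<close> lie in the set if \<open>\<psi>\<close> is small; half their difference is \<open>\<psi>\<close>.\<close>
      have inA: "(\<lambda>x. \<phi> x + \<psi> x) \<in> smooth_supp K \<inter> A N (L N) m"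
        if "\<psi> \<in> smooth_supp K" "\<And>x. x \<in> K \<Longrightarrow> jet k \<psi> x < \<delta>" for \<psi>
      proof -
        have s: "(\<lambda>x. \<phi> x + \<psi> x) \<in> smooth_supp K" by (intro smooth_supp_add \<phi> that)
        then have "derivatives (\<lambda>x. \<phi> x + \<psi> x) \<in> T N m" using k(2)[OF that] Z(3) W(2) by (auto simp: S_def)
        then obtain \<theta> where \<theta>: "\<theta> \<in> smooth_supp K \<inter> A N (L N) m" "derivatives (\<lambda>x. \<phi> x + \<psi> x) = derivatives \<theta>"
          unfolding T_def by blast
        have "(\<lambda>x. \<phi> x + \<psi> x) = \<theta>"
          using apply_derivatives[OF K s, of "[]"] apply_derivatives[OF K, of \<theta> "[]"] \<theta> by simp
        then show ?thesis using \<theta>(1) by simp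
      qed
      obtain \<psi> where \<psi>: "\<psi> \<in> smooth_supp K" "\<And>x. x \<in> K \<Longrightarrow> jet k \<psi> x < \<delta>" "\<psi> \<notin> A N (L N) m"
        using L[OF k(1)] by blast
      have "jet k (\<lambda>x. - 1 * \<psi> x) x < \<delta>" if "x \<in> K" for x
        using jet_cmult_le[OF open_UNIV smooth_suppD(1)[OF \<psi>(1)], of x k "- 1"] \<psi>(2)[OF that] by simp
      then have "(\<lambda>x. \<phi> x + - 1 * \<psi> x) \<in> smooth_supp K \<inter> A N (L N) m"
        by (intro inA smooth_supp_cmult \<psi>(1))
      from convex[OF inA[OF \<psi>(1,2)] this] have "\<psi> \<in> A N (L N) m" by simp
      then show False using \<psi>(3) by simp
    qed
  qed
  have "?X interior_of \<Union>(range (\<lambda>(N, m). T N m)) = {}"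
    by (rule Baire_category_alt) (use cm T in auto)
  moreover have "\<Union>(range (\<lambda>(N, m). T N m)) = S"
  proof
    show "\<Union>(range (\<lambda>(N, m). T N m)) \<subseteq> S" by (auto simp: T_def S_def)
    show "S \<subseteq> \<Union>(range (\<lambda>(N, m). T N m))"
    proof
      fix F assume "F \<in> S"
      then obtain \<phi> where \<phi>: "\<phi> \<in> smooth_supp K" "F = derivatives \<phi>" by (auto simp: S_def)
      then obtain N m where "\<phi> \<in> A N (L N) m" using cover by metis
      then have "F \<in> T N m" using \<phi> by (auto simp: T_def)
      then show "F \<in> \<Union>(range (\<lambda>(N, m). T N m))" by auto
    qed
  qed
  moreover have "?X interior_of S = S" using interior_of_topspace[of ?X] by simp
  moreover have "(\<lambda>_. 0) \<in> smooth_supp K" using smooth_on_const[OF open_UNIV] by (auto simp: smooth_supp_def)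
  ultimately show False unfolding S_def by auto
qed

section \<open>Independence of representatives\<close>

lemma colombeau_imp_moderate: "u \<in> colombeau \<Omega> \<Longrightarrow> v \<in> u \<Longrightarrow> v \<in> moderate \<Omega>"
  unfolding colombeau_def colombeau_rel_def by (auto elim!: quotientE)

lemma moderate_imp_smooth_on: "u \<in> moderate \<Omega> \<Longrightarrow> \<epsilon> \<in> {0<..1} \<Longrightarrow> smooth_on \<Omega> (u \<epsilon>)"
  unfolding moderate_def by blast

lemma jet_diff_le:
  assumes "open V" "smooth_on V f" "smooth_on V g" "x \<in> V"
  shows "jet k (\<lambda>x. f x - g x) x \<le> jet k f x + jet k g x"
proof -
  have s: "smooth_on V (\<lambda>x. - 1 * g x)" by (intro smooth_on_mult smooth_on_const assms)
  have "jet k (\<lambda>x. f x + - 1 * g x) x \<le> jet k f x + jet k (\<lambda>x. - 1 * g x) x"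
    by (rule jet_add_le[OF assms(1,2) s assms(4)])
  also have "jet k (\<lambda>x. - 1 * g x) x \<le> jet k g x"
    using jet_cmult_le[OF assms(1,3,4), of k "- 1"] by simp
  finally show ?thesis by simp
qed

lemma negligible_diff_colombeau:
  fixes A :: "'n::finite family set"
  assumes "open \<Omega>" "A \<in> colombeau \<Omega>" "a \<in> A" "b \<in> A" "compact K" "K \<subseteq> \<Omega>"
  shows "negligible_net K (\<lambda>\<epsilon>. jet k (\<lambda>x. a \<epsilon> x - b \<epsilon> x))"
proof -
  obtain c where c: "(c, a) \<in> colombeau_rel \<Omega>" "(c, b) \<in> colombeau_rel \<Omega>"
    using assms(2-4) unfolding colombeau_def by (auto elim!: quotientE)
  define d e where "d = (\<lambda>\<epsilon> x. c \<epsilon> x - a \<epsilon> x)" and "e = (\<lambda>\<epsilon> x. c \<epsilon> x - b \<epsilon> x)"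
  have de: "d \<in> negligible_families \<Omega>" "e \<in> negligible_families \<Omega>"
    using c unfolding colombeau_rel_def d_def e_def by auto
  then have s: "smooth_on \<Omega> (d \<epsilon>)" "smooth_on \<Omega> (e \<epsilon>)" if "\<epsilon> \<in> {0<..1}" for \<epsilon>
    using that unfolding negligible_families_def by auto
  have eq: "(\<lambda>x. a \<epsilon> x - b \<epsilon> x) = (\<lambda>x. e \<epsilon> x - d \<epsilon> x)" for \<epsilon> by (simp add: d_def e_def)
  have n: "negligible_net K (\<lambda>\<epsilon> x. jet k (e \<epsilon>) x + jet k (d \<epsilon>) x)"
    by (intro negligible_net_add negligible_imp_negligible_net_jet[OF assms(1) _ assms(5,6)] de)
  show ?thesis unfolding eq
  proof (rule negligible_net_mono[OF n])
    show "\<forall>\<^sub>F \<epsilon> in at_right 0. \<forall>x\<in>K. \<bar>jet k (\<lambda>x. e \<epsilon> x - d \<epsilon> x) x\<bar> \<le> jet k (e \<epsilon>) x + jet k (d \<epsilon>) x"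
      using eventually_small[OF zero_less_one]
    proof eventually_elim
      case (elim \<epsilon>)
      show ?case
      proof
        fix x assume "x \<in> K"
        then have "x \<in> \<Omega>" using assms(6) by blast
        then show "\<bar>jet k (\<lambda>x. e \<epsilon> x - d \<epsilon> x) x\<bar> \<le> jet k (e \<epsilon>) x + jet k (d \<epsilon>) x"
          using jet_diff_le[OF assms(1) s(2)[of \<epsilon>] s(1)[of \<epsilon>], of x k] elim
            jet_nonneg[of k "\<lambda>x. e \<epsilon> x - d \<epsilon> x" x] by simp
      qed
    qed
  qed
qed

lemma smooth_on_first_order_family:
  assumes "open \<Omega>" "smooth_on \<Omega> (a\<^sub>0 \<epsilon>)" "\<And>j. smooth_on \<Omega> (a j \<epsilon>)" "smooth_on \<Omega> (v \<epsilon>)"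
  shows "smooth_on \<Omega> (first_order_family a\<^sub>0 a v \<epsilon>)"
  unfolding first_order_family_def
  by (intro smooth_on_add[OF assms(1)] smooth_on_sum[OF assms(1)] smooth_on_mult[OF assms(1)]
    smooth_on_const[OF assms(1)] smooth_on_pderiv assms finite)

lemma negligible_diff_first_order_family:
  fixes a\<^sub>0 b\<^sub>0 v :: "'n::finite family" and a b :: "'n \<Rightarrow> 'n family"
  assumes "open \<Omega>" "compact K" "K \<subseteq> \<Omega>"
    and v: "v \<in> moderate \<Omega>"
    and a\<^sub>0: "a\<^sub>0 \<in> moderate \<Omega>" "b\<^sub>0 \<in> moderate \<Omega>" "\<And>k. negligible_net K (\<lambda>\<epsilon>. jet k (\<lambda>x. a\<^sub>0 \<epsilon> x - b\<^sub>0 \<epsilon> x))"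
    and a: "\<And>j. a j \<in> moderate \<Omega>" "\<And>j. b j \<in> moderate \<Omega>"
      "\<And>k j. negligible_net K (\<lambda>\<epsilon>. jet k (\<lambda>x. a j \<epsilon> x - b j \<epsilon> x))"
  shows "negligible_net K (\<lambda>\<epsilon>. jet k (\<lambda>x. first_order_family a\<^sub>0 a v \<epsilon> x - first_order_family b\<^sub>0 b v \<epsilon> x))"
proof (rule negligible_net_mono)
  let ?B = "\<lambda>\<epsilon> x. (\<Sum>j\<in>UNIV. jet k (\<lambda>x. a j \<epsilon> x - b j \<epsilon> x) x * jet (Suc k) (v \<epsilon>) x * 2 ^ k)
      + jet k (\<lambda>x. a\<^sub>0 \<epsilon> x - b\<^sub>0 \<epsilon> x) x * jet k (v \<epsilon>) x * 2 ^ k"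
  show "negligible_net K ?B"
    by (intro negligible_net_add negligible_net_sum finite
      negligible_net_mult_moderate[OF _ moderate_net_const] negligible_net_mult_moderate a\<^sub>0(3) a(3)
      moderate_imp_moderate_net_jet[OF assms(1) v assms(2,3)])
  show "\<forall>\<^sub>F \<epsilon> in at_right 0. \<forall>x\<in>K.
      \<bar>jet k (\<lambda>x. first_order_family a\<^sub>0 a v \<epsilon> x - first_order_family b\<^sub>0 b v \<epsilon> x) x\<bar> \<le> ?B \<epsilon> x"
    using eventually_small[OF zero_less_one]
  proof eventually_elim
    case (elim \<epsilon>)
    then have \<epsilon>: "\<epsilon> \<in> {0<..1}" by simp
    note s = moderate_imp_smooth_on[OF _ \<epsilon>]
    let ?c = "\<lambda>j x. a j \<epsilon> x - b j \<epsilon> x" and ?z = "\<lambda>x. a\<^sub>0 \<epsilon> x - b\<^sub>0 \<epsilon> x" and ?w = "\<lambda>j x. - \<i> * pderiv_at j (v \<epsilon>) x"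
    have sc: "smooth_on \<Omega> (?c j)" "smooth_on \<Omega> ?z" "smooth_on \<Omega> (?w j)" "smooth_on \<Omega> (v \<epsilon>)" for j
      by (intro smooth_on_diff[OF assms(1)] smooth_on_mult[OF assms(1)] smooth_on_const[OF assms(1)]
        smooth_on_pderiv s a a\<^sub>0 v)+
    have eq: "(\<lambda>x. first_order_family a\<^sub>0 a v \<epsilon> x - first_order_family b\<^sub>0 b v \<epsilon> x)
        = (\<lambda>x. (\<Sum>j\<in>UNIV. ?c j x * ?w j x) + ?z x * v \<epsilon> x)"
      unfolding first_order_family_def by (simp only: left_diff_distrib sum_subtractf add_diff_add)
    show ?case
    proof
      fix x assume "x \<in> K"
      then have x: "x \<in> \<Omega>" using assms(3) by blast
      have w: "jet k (?w j) x \<le> jet (Suc k) (v \<epsilon>) x" for j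
        using jet_cmult_le[OF assms(1) smooth_on_pderiv[OF sc(4)] x, of k "- \<i>" j] jet_pderiv_le[of k j "v \<epsilon>" x]
        by (simp del: jet.simps)
      have "jet k (\<lambda>x. (\<Sum>j\<in>UNIV. ?c j x * ?w j x) + ?z x * v \<epsilon> x) x
          \<le> jet k (\<lambda>x. \<Sum>j\<in>UNIV. ?c j x * ?w j x) x + jet k (\<lambda>x. ?z x * v \<epsilon> x) x"
        by (intro jet_add_le[OF assms(1) _ _ x] smooth_on_sum[OF assms(1)] smooth_on_mult[OF assms(1)] sc finite)
      also have "\<dots> \<le> (\<Sum>j\<in>UNIV. jet k (\<lambda>x. ?c j x * ?w j x) x) + jet k (\<lambda>x. ?z x * v \<epsilon> x) x"
        by (intro add_right_mono jet_sum_le[OF assms(1) finite _ x] smooth_on_mult[OF assms(1)] sc)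
      also have "\<dots> \<le> ?B \<epsilon> x"
      proof (intro add_mono sum_mono)
        fix j
        have "jet k (\<lambda>x. ?c j x * ?w j x) x \<le> 2 ^ k * (jet k (?c j) x * jet k (?w j) x)"
          by (rule jet_mult_le[OF assms(1) sc(1,3) x])
        also have "\<dots> \<le> 2 ^ k * (jet k (?c j) x * jet (Suc k) (v \<epsilon>) x)"
          by (intro mult_left_mono w jet_nonneg) simp
        finally show "jet k (\<lambda>x. ?c j x * ?w j x) x \<le> jet k (?c j) x * jet (Suc k) (v \<epsilon>) x * 2 ^ k"
          by (simp add: mult_ac del: jet.simps)
        show "jet k (\<lambda>x. ?z x * v \<epsilon> x) x \<le> jet k ?z x * jet k (v \<epsilon>) x * 2 ^ k"
          using jet_mult_le[OF assms(1) sc(2,4) x, of k] by (simp add: mult_ac)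
      qed
      finally show "\<bar>jet k (\<lambda>x. first_order_family a\<^sub>0 a v \<epsilon> x - first_order_family b\<^sub>0 b v \<epsilon> x) x\<bar> \<le> ?B \<epsilon> x"
        unfolding eq using jet_nonneg[of k "\<lambda>x. (\<Sum>j\<in>UNIV. ?c j x * ?w j x) + ?z x * v \<epsilon> x" x]
        by (simp only: abs_of_nonneg)
    qed
  qed
qed

text \<open>The estimate required of a single test function in the definition of microlocal regularity.\<close>

abbreviation rapid_decay :: "(real^'n::finite) set \<Rightarrow> (real^'n \<Rightarrow> complex) \<Rightarrow> 'n family \<Rightarrow> bool" where
  "rapid_decay \<Gamma> \<phi> u \<equiv> \<exists>N::real. \<forall>l::nat. \<exists>C>0. \<exists>\<epsilon>\<^sub>0>0. \<forall>\<xi>\<in>\<Gamma>. \<forall>\<epsilon>\<in>{0<..<\<epsilon>\<^sub>0}.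
    cmod (fourier (\<lambda>x. \<phi> x * u \<epsilon> x) \<xi>) \<le> C * \<epsilon> powr (- N) * (1 + norm \<xi>) powr (- real l)"

lemma le_decay_iff:
  fixes n :: real
  assumes "0 \<le> n"
  shows "X \<le> Y * (1 + n) powr (- real l) \<longleftrightarrow> (1 + n) ^ l * X \<le> Y"
proof -
  have "(1 + n) powr (- real l) = inverse ((1 + n) ^ l)"
    using assms by (simp add: powr_minus powr_realpow)
  moreover have "0 < (1 + n) ^ l" using assms by (intro zero_less_power) auto
  ultimately show ?thesis by (simp add: divide_inverse[symmetric] pos_le_divide_eq mult.commute)
qed

lemma jet_bounded_smooth_supp:
  assumes "compact K" "\<phi> \<in> smooth_supp K"
  shows "\<exists>B\<ge>0. \<forall>x\<in>K. jet k \<phi> x \<le> B"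
proof -
  let ?B = "\<Sum>is\<in>{is. length is \<le> k}. sup_on K (mderiv (count (mset is)) \<phi>)"
  have "\<forall>x\<in>K. jet k \<phi> x \<le> ?B"
    using jet_le_sup_on[OF open_UNIV smooth_suppD(1)[OF assms(2)] assms(1)] by blast
  then show ?thesis by (intro exI[of _ "max ?B 0"]) auto
qed

text \<open>All derivatives of a localized negligible family are bounded for small \<open>\<epsilon>\<close>, so \<open>fourier_decay\<close>
  bounds its transform with the exponent \<open>0\<close>. Taking \<open>max N 0\<close> makes room for this term.\<close>

lemma microlocally_regular_family_negligible_diff:
  fixes f w :: "'n::finite family"
  assumes "open \<Omega>" "microlocally_regular_family \<Omega> w x\<^sub>0 \<xi>\<^sub>0"
    and sm: "\<And>\<epsilon>. \<epsilon> \<in> {0<..1} \<Longrightarrow> smooth_on \<Omega> (w \<epsilon>)" "\<And>\<epsilon>. \<epsilon> \<in> {0<..1} \<Longrightarrow> smooth_on \<Omega> (f \<epsilon>)"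
    and neg: "\<And>K k. compact K \<Longrightarrow> K \<subseteq> \<Omega> \<Longrightarrow> negligible_net K (\<lambda>\<epsilon>. jet k (\<lambda>x. f \<epsilon> x - w \<epsilon> x))"
  shows "microlocally_regular_family \<Omega> f x\<^sub>0 \<xi>\<^sub>0"
proof -
  let ?F = "\<lambda>\<phi> u \<xi>. cmod (fourier (\<lambda>x. \<phi> x * u x) \<xi>)"
  obtain U \<Gamma> where U: "open U" "U \<subseteq> \<Omega>" "x\<^sub>0 \<in> U" "open_cone \<Gamma>" "\<xi>\<^sub>0 \<in> \<Gamma>"
    and reg: "\<And>\<phi>. \<phi> \<in> test_functions U \<Longrightarrow> rapid_decay \<Gamma> \<phi> w"
    using assms(2) unfolding microlocally_regular_family_def by blast
  have "rapid_decay \<Gamma> \<phi> f"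
    if \<phi>: "\<phi> \<in> test_functions U" for \<phi>
  proof -
    obtain K where K: "compact K" "K \<subseteq> U" "\<phi> \<in> smooth_supp K"
      using test_functions_imp_smooth_supp[OF \<phi>] by blast
    have K\<Omega>: "K \<subseteq> \<Omega>" and clK: "closed K" using K U(2) compact_imp_closed by auto
    obtain N where N: "\<And>l. \<exists>C>0. \<exists>\<epsilon>\<^sub>0>0. \<forall>\<xi>\<in>\<Gamma>. \<forall>\<epsilon>\<in>{0<..<\<epsilon>\<^sub>0}.
        ?F \<phi> (w \<epsilon>) \<xi> \<le> C * \<epsilon> powr (- N) * (1 + norm \<xi>) powr (- real l)" using reg[OF \<phi>] by blast
    have "\<exists>C>0. \<exists>\<epsilon>\<^sub>0>0. \<forall>\<xi>\<in>\<Gamma>. \<forall>\<epsilon>\<in>{0<..<\<epsilon>\<^sub>0}.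
        ?F \<phi> (f \<epsilon>) \<xi> \<le> C * \<epsilon> powr (- max N 0) * (1 + norm \<xi>) powr (- real l)" for l
    proof -
      obtain C \<epsilon>1 where C: "C > 0" "\<epsilon>1 > 0" "\<And>\<xi> \<epsilon>. \<xi> \<in> \<Gamma> \<Longrightarrow> \<epsilon> \<in> {0<..<\<epsilon>1} \<Longrightarrow>
          ?F \<phi> (w \<epsilon>) \<xi> \<le> C * \<epsilon> powr (- N) * (1 + norm \<xi>) powr (- real l)" using N[of l] by blast
      obtain B where B: "B \<ge> 0" "\<And>x. x \<in> K \<Longrightarrow> jet l \<phi> x \<le> B"
        using jet_bounded_smooth_supp[OF K(1,3)] by blast
      have "\<forall>\<^sub>F \<epsilon> in at_right 0. \<forall>x\<in>K. \<bar>jet l (\<lambda>x. f \<epsilon> x - w \<epsilon> x) x\<bar> \<le> \<epsilon> powr 0"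
        using neg[OF K(1) K\<Omega>, of l] unfolding negligible_net_def by blast
      then obtain \<epsilon>2 where e2: "\<epsilon>2 > 0" "\<And>\<epsilon> x. \<epsilon> \<in> {0<..<\<epsilon>2} \<Longrightarrow> x \<in> K \<Longrightarrow>
          \<bar>jet l (\<lambda>x. f \<epsilon> x - w \<epsilon> x) x\<bar> \<le> \<epsilon> powr 0" by (rule eventually_right0E) blast
      define D where "D = real (1 + CARD('n)) ^ l * (measure lborel K * (2 ^ l * B))"
      have D: "D \<ge> 0" unfolding D_def using B(1) by simp
      have "?F \<phi> (f \<epsilon>) \<xi> \<le> (C + D) * \<epsilon> powr (- max N 0) * (1 + norm \<xi>) powr (- real l)"
        if \<xi>: "\<xi> \<in> \<Gamma>" and \<epsilon>: "\<epsilon> \<in> {0<..<min 1 (min \<epsilon>1 \<epsilon>2)}" for \<xi> \<epsilon>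
      proof -
        have e: "\<epsilon> \<in> {0<..1}" "\<epsilon> \<in> {0<..<\<epsilon>1}" "\<epsilon> \<in> {0<..<\<epsilon>2}" using \<epsilon> by auto
        let ?d = "\<lambda>x. f \<epsilon> x - w \<epsilon> x"
        have sd: "smooth_on \<Omega> ?d" by (intro smooth_on_diff[OF assms(1)] sm e)
        have m: "(\<lambda>x. \<phi> x * w \<epsilon> x) \<in> smooth_supp K" "(\<lambda>x. \<phi> x * ?d x) \<in> smooth_supp K"
          by (rule smooth_supp_mult[OF assms(1) clK K\<Omega> K(3)], rule sm sd, rule e)
            (rule smooth_supp_mult[OF assms(1) clK K\<Omega> K(3) sd])
        have "fourier (\<lambda>x. \<phi> x * w \<epsilon> x + \<phi> x * ?d x) \<xi>
            = fourier (\<lambda>x. \<phi> x * w \<epsilon> x) \<xi> + fourier (\<lambda>x. \<phi> x * ?d x) \<xi>"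
          by (rule fourier_add[OF K(1)]) (use smooth_suppD[OF m(1)] smooth_suppD[OF m(2)] in auto)
        moreover have "(\<lambda>x. \<phi> x * w \<epsilon> x + \<phi> x * ?d x) = (\<lambda>x. \<phi> x * f \<epsilon> x)" by (simp add: algebra_simps)
        ultimately have 1: "?F \<phi> (f \<epsilon>) \<xi> \<le> ?F \<phi> (w \<epsilon>) \<xi> + ?F \<phi> ?d \<xi>"
          using norm_triangle_ineq[of "fourier (\<lambda>x. \<phi> x * w \<epsilon> x) \<xi>" "fourier (\<lambda>x. \<phi> x * ?d x) \<xi>"] by simp
        have "jet l (\<lambda>x. \<phi> x * ?d x) x \<le> 2 ^ l * B" if x: "x \<in> K" for x
        proof -
          have x\<Omega>: "x \<in> \<Omega>" using x K\<Omega> by blast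
          have "jet l (\<lambda>x. \<phi> x * ?d x) x \<le> 2 ^ l * (jet l \<phi> x * jet l ?d x)"
            by (rule jet_mult_le[OF assms(1) smooth_on_subset[OF smooth_suppD(1)[OF K(3)]] sd x\<Omega>]) simp
          also have "\<dots> \<le> 2 ^ l * (B * 1)"
            using e2(2)[OF e(3) x] e B(1) jet_nonneg[of l ?d x] B(2)[OF x]
            by (intro mult_left_mono mult_mono jet_nonneg) auto
          finally show ?thesis by simp
        qed
        from fourier_decay[OF K(1) m(2) this, of \<xi>]
        have "?F \<phi> ?d \<xi> \<le> D * (1 + norm \<xi>) powr (- real l)"
          unfolding D_def by (subst le_decay_iff) auto
        also have "\<dots> \<le> D * \<epsilon> powr (- max N 0) * (1 + norm \<xi>) powr (- real l)"
        proof -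
          have "1 \<le> \<epsilon> powr (- max N 0)" using powr_mono'[of "- max N 0" 0 \<epsilon>] e by simp
          then show ?thesis using D by (intro mult_right_mono) (auto simp: mult_le_cancel_left1)
        qed
        finally have 2: "?F \<phi> ?d \<xi> \<le> D * \<epsilon> powr (- max N 0) * (1 + norm \<xi>) powr (- real l)" .
        have "\<epsilon> powr (- N) \<le> \<epsilon> powr (- max N 0)" using e by (intro powr_mono') auto
        then have "C * \<epsilon> powr (- N) * (1 + norm \<xi>) powr (- real l)
            \<le> C * \<epsilon> powr (- max N 0) * (1 + norm \<xi>) powr (- real l)"
          using C(1) by (intro mult_right_mono mult_left_mono) auto
        with C(3)[OF \<xi> e(2)] 1 2 show ?thesis by (simp add: distrib_right)
      qed
      then show ?thesis
        using C D e2(1) by (intro exI[of _ "C + D"] conjI exI[of _ "min 1 (min \<epsilon>1 \<epsilon>2)"] ballI) auto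
    qed
    then show ?thesis by blast
  qed
  then show ?thesis unfolding microlocally_regular_family_def using U by blast
qed


text \<open>The class of \<open>P u\<close> may be regular through a representative computed with other representatives
  of the coefficients than those whose growth is controlled. The difference is negligible, because
  the negligible families form an ideal of the moderate ones.\<close>

lemma regular_first_order_op_representative:
  fixes a\<^sub>0 :: "'n::finite family" and a :: "'n \<Rightarrow> 'n family"
  assumes \<Omega>: "open \<Omega>" and A: "A\<^sub>0 \<in> colombeau \<Omega>" "\<And>j. A j \<in> colombeau \<Omega>"
    and a: "a\<^sub>0 \<in> A\<^sub>0" "\<And>j. a j \<in> A j" and u: "u \<in> colombeau \<Omega>"
    and reg: "microlocally_regular \<Omega> (first_order_op \<Omega> A\<^sub>0 A u) x\<^sub>0 \<xi>\<^sub>0"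
  obtains v where "v \<in> u" "microlocally_regular_family \<Omega> (first_order_family a\<^sub>0 a v) x\<^sub>0 \<xi>\<^sub>0"
proof -
  have mod: "a\<^sub>0 \<in> moderate \<Omega>" "\<And>j. a j \<in> moderate \<Omega>"
    using colombeau_imp_moderate[OF A(1) a(1)] colombeau_imp_moderate[OF A(2) a(2)] by auto
  note sa = moderate_imp_smooth_on[OF mod(1)] moderate_imp_smooth_on[OF mod(2)]
  obtain w where w: "w \<in> first_order_op \<Omega> A\<^sub>0 A u" "microlocally_regular_family \<Omega> w x\<^sub>0 \<xi>\<^sub>0"
    using reg unfolding microlocally_regular_def by blast
  then obtain b\<^sub>0 b v where bv: "b\<^sub>0 \<in> A\<^sub>0" "\<And>j. b j \<in> A j" "v \<in> u"
    and rel: "(first_order_family b\<^sub>0 b v, w) \<in> colombeau_rel \<Omega>"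
    unfolding first_order_op_def by blast
  have v: "v \<in> moderate \<Omega>" by (rule colombeau_imp_moderate[OF u bv(3)])
  have modb: "b\<^sub>0 \<in> moderate \<Omega>" "\<And>j. b j \<in> moderate \<Omega>"
    using colombeau_imp_moderate[OF A(1) bv(1)] colombeau_imp_moderate[OF A(2) bv(2)] by auto
  define f where "f = first_order_family a\<^sub>0 a v"
  define g where "g = first_order_family b\<^sub>0 b v"
  have sf: "smooth_on \<Omega> (f \<epsilon>)" if "\<epsilon> \<in> {0<..1}" for \<epsilon>
    unfolding f_def by (intro smooth_on_first_order_family \<Omega> sa that moderate_imp_smooth_on[OF v])
  have sw: "smooth_on \<Omega> (w \<epsilon>)" "smooth_on \<Omega> (g \<epsilon>)" if "\<epsilon> \<in> {0<..1}" for \<epsilon>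
    using rel that moderate_imp_smooth_on unfolding colombeau_rel_def g_def by auto
  have "microlocally_regular_family \<Omega> f x\<^sub>0 \<xi>\<^sub>0"
  proof (rule microlocally_regular_family_negligible_diff[OF \<Omega> w(2) sw(1) sf])
    fix K k assume K: "compact K" "K \<subseteq> \<Omega>"
    have 1: "negligible_net K (\<lambda>\<epsilon>. jet k (\<lambda>x. f \<epsilon> x - g \<epsilon> x))"
      unfolding f_def g_def
      by (rule negligible_diff_first_order_family[OF \<Omega> K v])
        (intro mod modb negligible_diff_colombeau[OF \<Omega> A(1) a(1) bv(1) K]
          negligible_diff_colombeau[OF \<Omega> A(2) a(2) bv(2) K])+
    have "(\<lambda>\<epsilon> x. g \<epsilon> x - w \<epsilon> x) \<in> negligible_families \<Omega>"
      using rel unfolding colombeau_rel_def g_def by simp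
    from negligible_imp_negligible_net_jet[OF \<Omega> this K, of k]
    have 2: "negligible_net K (\<lambda>\<epsilon>. jet k (\<lambda>x. g \<epsilon> x - w \<epsilon> x))" .
    show "negligible_net K (\<lambda>\<epsilon>. jet k (\<lambda>x. f \<epsilon> x - w \<epsilon> x))"
    proof (rule negligible_net_mono[OF negligible_net_add[OF 1 2]])
      show "\<forall>\<^sub>F \<epsilon> in at_right 0. \<forall>x\<in>K. \<bar>jet k (\<lambda>x. f \<epsilon> x - w \<epsilon> x) x\<bar>
          \<le> jet k (\<lambda>x. f \<epsilon> x - g \<epsilon> x) x + jet k (\<lambda>x. g \<epsilon> x - w \<epsilon> x) x"
        using eventually_small[OF zero_less_one]
      proof eventually_elim
        case (elim \<epsilon>)
        then have \<epsilon>: "\<epsilon> \<in> {0<..1}" by simp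
        show ?case
        proof
          fix x assume "x \<in> K"
          then have "x \<in> \<Omega>" using K(2) by blast
          from jet_add_le[OF \<Omega> smooth_on_diff[OF \<Omega> sf[OF \<epsilon>] sw(2)[OF \<epsilon>]]
            smooth_on_diff[OF \<Omega> sw(2)[OF \<epsilon>] sw(1)[OF \<epsilon>]] this, of k]
          show "\<bar>jet k (\<lambda>x. f \<epsilon> x - w \<epsilon> x) x\<bar>
              \<le> jet k (\<lambda>x. f \<epsilon> x - g \<epsilon> x) x + jet k (\<lambda>x. g \<epsilon> x - w \<epsilon> x) x"
            by (simp add: abs_of_nonneg[OF jet_nonneg])
        qed
      qed
    qed
  qed
  then show thesis by (rule that[OF bv(3), folded f_def])
qed

section \<open>Regularity is uniform over amplitudes of slow scale\<close>

lemma continuous_on_bounded_by: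
  fixes f :: "'a::topological_space \<Rightarrow> complex"
  assumes "compact K" "continuous_on K f"
  obtains B where "B > 0" "\<And>x. x \<in> K \<Longrightarrow> cmod (f x) \<le> B"
proof -
  have "bounded (f ` K)" by (intro compact_imp_bounded compact_continuous_image assms)
  then show thesis using that unfolding bounded_pos by auto
qed

lemma fourier_uniform_limit:
  assumes K: "compact K" and \<Phi>: "\<And>i. \<Phi> i \<in> smooth_supp K" "\<phi> \<in> smooth_supp K"
    and lim: "uniform_limit UNIV \<Phi> \<phi> sequentially" and v: "continuous_on K v"
  shows "(\<lambda>i. fourier (\<lambda>x. \<Phi> i x * v x) \<xi>) \<longlonglongrightarrow> fourier (\<lambda>x. \<phi> x * v x) \<xi>"
proof -
  obtain B where B: "B > 0" "\<And>x. x \<in> K \<Longrightarrow> cmod (v x) \<le> B" using continuous_on_bounded_by[OF K v] by blast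
  let ?M = "measure lborel K * B"
  have d: "(\<lambda>x. \<phi> x + - 1 * \<Phi> i x) \<in> smooth_supp K" for i by (intro smooth_supp_add smooth_supp_cmult \<Phi>)
  have diff: "cmod (fourier (\<lambda>x. \<Phi> i x * v x) \<xi> - fourier (\<lambda>x. \<phi> x * v x) \<xi>) \<le> measure lborel K * (e * B)"
    if "\<And>x. dist (\<Phi> i x) (\<phi> x) \<le> e" for i e
  proof -
    have "fourier (\<lambda>x. \<Phi> i x * v x + (\<phi> x + - 1 * \<Phi> i x) * v x) \<xi>
        = fourier (\<lambda>x. \<Phi> i x * v x) \<xi> + fourier (\<lambda>x. (\<phi> x + - 1 * \<Phi> i x) * v x) \<xi>"
      by (rule fourier_add[OF K])
        (use smooth_suppD[OF \<Phi>(1)] smooth_suppD[OF d] v in \<open>auto intro!: continuous_on_mult\<close>)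
    then have eq: "fourier (\<lambda>x. \<Phi> i x * v x) \<xi> - fourier (\<lambda>x. \<phi> x * v x) \<xi>
        = - fourier (\<lambda>x. (\<phi> x + - 1 * \<Phi> i x) * v x) \<xi>" by (simp add: algebra_simps)
    have "cmod (fourier (\<lambda>x. (\<phi> x + - 1 * \<Phi> i x) * v x) \<xi>) \<le> measure lborel K * (e * B)"
    proof (rule norm_fourier_le[OF K])
      show "continuous_on K (\<lambda>x. (\<phi> x + - 1 * \<Phi> i x) * v x)"
        by (intro continuous_on_mult smooth_suppD(3)[OF d] v)
      show "(\<phi> x + - 1 * \<Phi> i x) * v x = 0" if "x \<notin> K" for x
        using smooth_suppD(2)[OF d that] by simp
      show "cmod ((\<phi> x + - 1 * \<Phi> i x) * v x) \<le> e * B" if x: "x \<in> K" for x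
        unfolding norm_mult using that(1) \<open>\<And>x. dist (\<Phi> i x) (\<phi> x) \<le> e\<close>[of x] B(2)[OF x]
        by (intro mult_mono) (auto simp: dist_norm norm_minus_commute intro: order_trans[OF norm_ge_zero])
    qed
    then show ?thesis unfolding eq by simp
  qed
  show ?thesis
  proof (rule LIMSEQ_I)
    fix r :: real assume r: "r > 0"
    define e where "e = r / (?M + 1)"
    have M: "0 \<le> ?M" using B(1) by simp
    then have e: "e > 0" unfolding e_def using r by simp
    have "measure lborel K * (e * B) = e * ?M" by simp
    also have "\<dots> < e * (?M + 1)" using e by simp
    also have "\<dots> = r" unfolding e_def using M by simp
    finally have small: "measure lborel K * (e * B) < r" .
    have "\<forall>\<^sub>F i in sequentially. \<forall>x\<in>UNIV. dist (\<Phi> i x) (\<phi> x) < e"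
      using lim e unfolding uniform_limit_iff by blast
    then have "\<forall>\<^sub>F i in sequentially. norm (fourier (\<lambda>x. \<Phi> i x * v x) \<xi> - fourier (\<lambda>x. \<phi> x * v x) \<xi>) < r"
    proof eventually_elim
      case (elim i)
      then have "\<And>x. dist (\<Phi> i x) (\<phi> x) \<le> e" by (simp add: less_imp_le)
      from diff[OF this] small show ?case by simp
    qed
    then show "\<exists>no. \<forall>i\<ge>no. norm (fourier (\<lambda>x. \<Phi> i x * v x) \<xi> - fourier (\<lambda>x. \<phi> x * v x) \<xi>) < r"
      unfolding eventually_sequentially .
  qed
qed

text \<open>The uniform boundedness principle applies with \<open>A N l m\<close> the functions that satisfy the estimate of
  order \<open>l\<close> with exponent \<open>N\<close>, constant \<open>m + 1\<close> and for \<open>\<epsilon> < 1 / (m + 1)\<close>. This set is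
  closed because the Fourier transform at a single frequency is continuous under uniform
  convergence on \<open>K\<close>.\<close>

lemma regular_on_smooth_supp_uniform:
  fixes K \<Gamma> :: "(real^'n::finite) set" and f :: "'n family"
  assumes K: "compact K" and f: "\<And>\<epsilon>. \<epsilon> \<in> {0<..1} \<Longrightarrow> continuous_on K (f \<epsilon>)"
    and reg: "\<And>\<phi>. \<phi> \<in> smooth_supp K \<Longrightarrow> rapid_decay \<Gamma> \<phi> f"
  shows "\<exists>N::nat. \<forall>l. \<exists>m k \<delta>. \<delta> > 0 \<and> (\<forall>\<phi>\<in>smooth_supp K. (\<forall>x\<in>K. jet k \<phi> x < \<delta>) \<longrightarrow>
    (\<forall>\<xi>\<in>\<Gamma>. \<forall>\<epsilon>\<in>{0<..<1 / real (Suc m)}.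
      (1 + norm \<xi>) ^ l * cmod (fourier (\<lambda>x. \<phi> x * f \<epsilon> x) \<xi>) \<le> real (Suc m) * \<epsilon> powr (- real N)))"
proof -
  define A where "A N l m = {\<phi>. \<forall>\<xi>\<in>\<Gamma>. \<forall>\<epsilon>\<in>{0<..<1 / real (Suc m)}.
      (1 + norm \<xi>) ^ l * cmod (fourier (\<lambda>x. \<phi> x * f \<epsilon> x) \<xi>) \<le> real (Suc m) * \<epsilon> powr (- real N)}"
    for N l m :: nat
  have small: "\<epsilon> \<in> {0<..1}" if "\<epsilon> \<in> {0<..<1 / real (Suc m)}" for \<epsilon> m
  proof -
    have "1 / real (Suc m) \<le> 1" by simp
    then show ?thesis using that unfolding greaterThanLessThan_iff greaterThanAtMost_iff by linarith
  qed
  have "\<exists>N. \<forall>l. \<exists>m k \<delta>. \<delta> > 0 \<and> (\<forall>\<phi>\<in>smooth_supp K. (\<forall>x\<in>K. jet k \<phi> x < \<delta>) \<longrightarrow> \<phi> \<in> A N l m)"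
  proof (rule smooth_supp_uniform_boundedness[OF K])
    fix N l m \<Phi> \<phi>
    assume \<Phi>: "\<And>i. \<Phi> i \<in> smooth_supp K \<inter> A N l m" and \<phi>: "\<phi> \<in> smooth_supp K"
      and lim: "uniform_limit UNIV \<Phi> \<phi> sequentially"
    show "\<phi> \<in> A N l m" unfolding A_def
    proof (intro CollectI ballI)
      fix \<xi> \<epsilon> assume \<xi>: "\<xi> \<in> \<Gamma>" and \<epsilon>: "\<epsilon> \<in> {0<..<1 / real (Suc m)}"
      have "(\<lambda>i. fourier (\<lambda>x. \<Phi> i x * f \<epsilon> x) \<xi>) \<longlonglongrightarrow> fourier (\<lambda>x. \<phi> x * f \<epsilon> x) \<xi>"
        by (rule fourier_uniform_limit[OF K IntD1[OF \<Phi>] \<phi> lim f[OF small[OF \<epsilon>]]])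
      then have "(\<lambda>i. (1 + norm \<xi>) ^ l * cmod (fourier (\<lambda>x. \<Phi> i x * f \<epsilon> x) \<xi>))
          \<longlonglongrightarrow> (1 + norm \<xi>) ^ l * cmod (fourier (\<lambda>x. \<phi> x * f \<epsilon> x) \<xi>)"
        by (intro tendsto_intros)
      moreover have "(1 + norm \<xi>) ^ l * cmod (fourier (\<lambda>x. \<Phi> i x * f \<epsilon> x) \<xi>) \<le> real (Suc m) * \<epsilon> powr (- real N)" for i
        using IntD2[OF \<Phi>[of i]] \<xi> \<epsilon> unfolding A_def by simp
      ultimately show "(1 + norm \<xi>) ^ l * cmod (fourier (\<lambda>x. \<phi> x * f \<epsilon> x) \<xi>) \<le> real (Suc m) * \<epsilon> powr (- real N)"
        by (intro LIMSEQ_le_const2) auto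
    qed
  next
    fix N l m \<phi> \<psi>
    assume \<phi>: "\<phi> \<in> smooth_supp K \<inter> A N l m" and \<psi>: "\<psi> \<in> smooth_supp K \<inter> A N l m"
    show "(\<lambda>x. (\<phi> x - \<psi> x) / 2) \<in> A N l m" unfolding A_def
    proof (intro CollectI ballI)
      fix \<xi> \<epsilon> assume \<xi>: "\<xi> \<in> \<Gamma>" and \<epsilon>: "\<epsilon> \<in> {0<..<1 / real (Suc m)}"
      note fc = f[OF small[OF \<epsilon>]]
      let ?a = "fourier (\<lambda>x. \<phi> x * f \<epsilon> x) \<xi>" and ?b = "fourier (\<lambda>x. \<psi> x * f \<epsilon> x) \<xi>"
      have c: "continuous_on K (\<lambda>x. \<phi> x * f \<epsilon> x)" "continuous_on K (\<lambda>x. - 1 * (\<psi> x * f \<epsilon> x))"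
        by (intro continuous_on_mult continuous_on_const fc smooth_suppD(3)[OF IntD1[OF \<phi>]]
          smooth_suppD(3)[OF IntD1[OF \<psi>]])+
      have "fourier (\<lambda>x. (1/2) * (\<phi> x * f \<epsilon> x + - 1 * (\<psi> x * f \<epsilon> x))) \<xi> = (1/2) * (?a + - 1 * ?b)"
        unfolding fourier_cmult
        by (subst fourier_add[OF K c(1) _ c(2)])
          (simp_all add: smooth_suppD(2)[OF IntD1[OF \<phi>]] smooth_suppD(2)[OF IntD1[OF \<psi>]]
            fourier_cmult[of "- 1" "\<lambda>x. \<psi> x * f \<epsilon> x", simplified])
      moreover have "(\<lambda>x. (1/2) * (\<phi> x * f \<epsilon> x + - 1 * (\<psi> x * f \<epsilon> x))) = (\<lambda>x. (\<phi> x - \<psi> x) / 2 * f \<epsilon> x)"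
        by (simp add: left_diff_distrib)
      ultimately have eq: "fourier (\<lambda>x. (\<phi> x - \<psi> x) / 2 * f \<epsilon> x) \<xi> = (?a - ?b) / 2" by simp
      have "cmod (?a - ?b) \<le> cmod ?a + cmod ?b" by (rule norm_triangle_ineq4)
      then have "(1 + norm \<xi>) ^ l * cmod (?a - ?b) \<le> (1 + norm \<xi>) ^ l * cmod ?a + (1 + norm \<xi>) ^ l * cmod ?b"
        unfolding distrib_left[symmetric] by (intro mult_left_mono) auto
      also have "\<dots> \<le> real (Suc m) * \<epsilon> powr (- real N) + real (Suc m) * \<epsilon> powr (- real N)"
        using IntD2[OF \<phi>] IntD2[OF \<psi>] \<xi> \<epsilon> unfolding A_def by (intro add_mono) simp_all
      finally show "(1 + norm \<xi>) ^ l * cmod (fourier (\<lambda>x. (\<phi> x - \<psi> x) / 2 * f \<epsilon> x) \<xi>)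
          \<le> real (Suc m) * \<epsilon> powr (- real N)"
        unfolding eq norm_divide by simp
    qed
  next
    fix \<phi> assume \<phi>: "\<phi> \<in> smooth_supp K"
    obtain N :: real where N: "\<And>l. \<exists>C>0. \<exists>\<epsilon>\<^sub>0>0. \<forall>\<xi>\<in>\<Gamma>. \<forall>\<epsilon>\<in>{0<..<\<epsilon>\<^sub>0}.
        cmod (fourier (\<lambda>x. \<phi> x * f \<epsilon> x) \<xi>) \<le> C * \<epsilon> powr (- N) * (1 + norm \<xi>) powr (- real l)"
      using reg[OF \<phi>] by blast
    obtain N' :: nat where N': "N \<le> real N'" using real_arch_simple by blast
    have "\<exists>m. \<phi> \<in> A N' l m" for l
    proof -
      obtain C \<epsilon>\<^sub>0 where C: "C > 0" "\<epsilon>\<^sub>0 > 0" "\<And>\<xi> \<epsilon>. \<xi> \<in> \<Gamma> \<Longrightarrow> \<epsilon> \<in> {0<..<\<epsilon>\<^sub>0} \<Longrightarrow>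
          cmod (fourier (\<lambda>x. \<phi> x * f \<epsilon> x) \<xi>) \<le> C * \<epsilon> powr (- N) * (1 + norm \<xi>) powr (- real l)"
        using N[of l] by blast
      obtain m :: nat where m: "max C (1 / \<epsilon>\<^sub>0) \<le> real m" using real_arch_simple by blast
      have "1 / \<epsilon>\<^sub>0 \<le> real (Suc m)" using m by simp
      then have m2: "C \<le> real (Suc m)" "1 / real (Suc m) \<le> \<epsilon>\<^sub>0"
        using m C(2) by (simp_all add: divide_le_eq mult.commute)
      have "\<phi> \<in> A N' l m" unfolding A_def
      proof (intro CollectI ballI)
        fix \<xi> \<epsilon> assume \<xi>: "\<xi> \<in> \<Gamma>" and \<epsilon>: "\<epsilon> \<in> {0<..<1 / real (Suc m)}"
        have "\<epsilon> \<in> {0<..<\<epsilon>\<^sub>0}" using \<epsilon> m2(2) by auto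
        from C(3)[OF \<xi> this] have "(1 + norm \<xi>) ^ l * cmod (fourier (\<lambda>x. \<phi> x * f \<epsilon> x) \<xi>) \<le> C * \<epsilon> powr (- N)"
          by (subst (asm) le_decay_iff) auto
        also have "\<dots> \<le> real (Suc m) * \<epsilon> powr (- real N')"
          using small[OF \<epsilon>] m2(1) N' by (intro mult_mono powr_mono') auto
        finally show "(1 + norm \<xi>) ^ l * cmod (fourier (\<lambda>x. \<phi> x * f \<epsilon> x) \<xi>) \<le> real (Suc m) * \<epsilon> powr (- real N')" .
      qed
      then show ?thesis by blast
    qed
    then show "\<exists>N. \<forall>l. \<exists>m. \<phi> \<in> A N l m" by blast
  qed
  then show ?thesis unfolding A_def by simp
qed

text \<open>Test functions that depend on \<open>\<epsilon>\<close> and on the frequency. The slow scale bounds are uniform in the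
  frequency, and the support stays in \<open>K\<close>.\<close>

definition slow_amplitude ::
    "(real^'n::finite) set \<Rightarrow> (real^'n) set \<Rightarrow> (real \<Rightarrow> real^'n \<Rightarrow> real^'n \<Rightarrow> complex) \<Rightarrow> bool" where
  "slow_amplitude K \<Gamma> \<Psi> \<longleftrightarrow> (\<forall>\<^sub>F \<epsilon> in at_right 0. \<forall>\<xi>\<in>\<Gamma>. \<Psi> \<epsilon> \<xi> \<in> smooth_supp K) \<and>
    (\<forall>k. slow_net (\<Gamma> \<times> K) (\<lambda>\<epsilon> p. jet k (\<Psi> \<epsilon> (fst p)) (snd p)))"

text \<open>The same estimate for an amplitude, with the exponent \<open>N\<close> as a parameter, so that one can say
  that it is the same for all amplitudes and all orders \<open>l\<close>.\<close>

abbreviation amplitude_decay ::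
    "(real^'n::finite) set \<Rightarrow> real \<Rightarrow> 'n family \<Rightarrow> (real \<Rightarrow> real^'n \<Rightarrow> real^'n \<Rightarrow> complex) \<Rightarrow> nat \<Rightarrow> bool" where
  "amplitude_decay \<Gamma> N u \<Psi> l \<equiv> \<exists>C>0. \<forall>\<^sub>F \<epsilon> in at_right 0. \<forall>\<xi>\<in>\<Gamma>.
    (1 + norm \<xi>) ^ l * cmod (fourier (\<lambda>x. \<Psi> \<epsilon> \<xi> x * u \<epsilon> x) \<xi>) \<le> C * \<epsilon> powr (- N)"

lemma slow_amplitudeD:
  assumes "slow_amplitude K \<Gamma> \<Psi>"
  shows "\<forall>\<^sub>F \<epsilon> in at_right 0. \<forall>\<xi>\<in>\<Gamma>. \<Psi> \<epsilon> \<xi> \<in> smooth_supp K"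
    "slow_net (\<Gamma> \<times> K) (\<lambda>\<epsilon> p. jet k (\<Psi> \<epsilon> (fst p)) (snd p))"
    "\<forall>\<^sub>F \<epsilon> in at_right 0. \<forall>\<xi>\<in>\<Gamma>. \<forall>x\<in>K. jet k (\<Psi> \<epsilon> \<xi>) x \<le> 1 / \<epsilon>"
proof -
  show "\<forall>\<^sub>F \<epsilon> in at_right 0. \<forall>\<xi>\<in>\<Gamma>. \<Psi> \<epsilon> \<xi> \<in> smooth_supp K"
    and s: "slow_net (\<Gamma> \<times> K) (\<lambda>\<epsilon> p. jet k (\<Psi> \<epsilon> (fst p)) (snd p))"
    using assms unfolding slow_amplitude_def by auto
  show "\<forall>\<^sub>F \<epsilon> in at_right 0. \<forall>\<xi>\<in>\<Gamma>. \<forall>x\<in>K. jet k (\<Psi> \<epsilon> \<xi>) x \<le> 1 / \<epsilon>"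
    using slow_net_le_inverse[OF s] by eventually_elim (force simp: abs_le_iff)
qed

text \<open>The amplitudes need not be bounded, but \<open>\<epsilon>\<close> times an amplitude of slow scale is, so it can be
  scaled into the neighbourhood of zero on which the estimate is uniform. The exponent grows by one,
  regardless of \<open>l\<close>.\<close>

lemma regular_imp_slow_amplitude_decay:
  fixes K \<Gamma> :: "(real^'n::finite) set" and f :: "'n family"
  assumes K: "compact K" and f: "\<And>\<epsilon>. \<epsilon> \<in> {0<..1} \<Longrightarrow> continuous_on K (f \<epsilon>)"
    and reg: "\<And>\<phi>. \<phi> \<in> smooth_supp K \<Longrightarrow> rapid_decay \<Gamma> \<phi> f"
  shows "\<exists>N::real. \<forall>\<Psi> l. slow_amplitude K \<Gamma> \<Psi> \<longrightarrow> amplitude_decay \<Gamma> N f \<Psi> l"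
proof -
  obtain N :: nat where N: "\<And>l. \<exists>m k \<delta>. \<delta> > 0 \<and> (\<forall>\<phi>\<in>smooth_supp K. (\<forall>x\<in>K. jet k \<phi> x < \<delta>) \<longrightarrow>
    (\<forall>\<xi>\<in>\<Gamma>. \<forall>\<epsilon>\<in>{0<..<1 / real (Suc m)}.
      (1 + norm \<xi>) ^ l * cmod (fourier (\<lambda>x. \<phi> x * f \<epsilon> x) \<xi>) \<le> real (Suc m) * \<epsilon> powr (- real N)))"
    using regular_on_smooth_supp_uniform[OF K f reg] by blast
  have "amplitude_decay \<Gamma> (real N + 1) f \<Psi> l"
    if \<Psi>: "slow_amplitude K \<Gamma> \<Psi>" for \<Psi> l
  proof -
    obtain m k \<delta> where \<delta>: "\<delta> > 0" and bd: "\<And>\<phi> \<xi> \<epsilon>. \<phi> \<in> smooth_supp K \<Longrightarrow> (\<And>x. x \<in> K \<Longrightarrow> jet k \<phi> x < \<delta>) \<Longrightarrow>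
        \<xi> \<in> \<Gamma> \<Longrightarrow> \<epsilon> \<in> {0<..<1 / real (Suc m)} \<Longrightarrow>
        (1 + norm \<xi>) ^ l * cmod (fourier (\<lambda>x. \<phi> x * f \<epsilon> x) \<xi>) \<le> real (Suc m) * \<epsilon> powr (- real N)"
      using N[of l] by blast
    have "\<forall>\<^sub>F \<epsilon> in at_right (0::real). 0 < \<epsilon> \<and> \<epsilon> < 1 / real (Suc m)" by (rule eventually_small) simp
    with slow_amplitudeD(1)[OF \<Psi>] slow_amplitudeD(3)[OF \<Psi>, of k]
    have "\<forall>\<^sub>F \<epsilon> in at_right 0. \<forall>\<xi>\<in>\<Gamma>. (1 + norm \<xi>) ^ l * cmod (fourier (\<lambda>x. \<Psi> \<epsilon> \<xi> x * f \<epsilon> x) \<xi>)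
        \<le> (2 / \<delta> * real (Suc m)) * \<epsilon> powr (- (real N + 1))"
    proof eventually_elim
      case (elim \<epsilon>)
      show ?case
      proof
        fix \<xi> assume \<xi>: "\<xi> \<in> \<Gamma>"
        \<comment> \<open>\<open>c\<close> scales the amplitude into the neighbourhood of zero on which the estimate is uniform;
            undoing the scaling costs the factor \<open>1 / \<epsilon>\<close>.\<close>
        define c where "c = \<delta> / 2 * \<epsilon>"
        have c: "c > 0" unfolding c_def using \<delta> elim by simp
        let ?\<psi> = "\<lambda>x. complex_of_real c * \<Psi> \<epsilon> \<xi> x"
        have s: "\<Psi> \<epsilon> \<xi> \<in> smooth_supp K" using elim \<xi> by blast
        have "jet k ?\<psi> x < \<delta>" if x: "x \<in> K" for x
        proof -
          have "jet k ?\<psi> x \<le> c * jet k (\<Psi> \<epsilon> \<xi>) x"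
            using jet_cmult_le[OF open_UNIV smooth_suppD(1)[OF s], of x k "complex_of_real c"] c by simp
          also have "\<dots> \<le> c * (1 / \<epsilon>)" using elim \<xi> x c by (intro mult_left_mono) auto
          also have "\<dots> = \<delta> / 2" unfolding c_def using elim by simp
          finally show ?thesis using \<delta> by simp
        qed
        from bd[OF smooth_supp_cmult[OF s] this \<xi>, of \<epsilon>] elim
        have "(1 + norm \<xi>) ^ l * cmod (fourier (\<lambda>x. ?\<psi> x * f \<epsilon> x) \<xi>) \<le> real (Suc m) * \<epsilon> powr (- real N)" by simp
        moreover have "fourier (\<lambda>x. ?\<psi> x * f \<epsilon> x) \<xi> = complex_of_real c * fourier (\<lambda>x. \<Psi> \<epsilon> \<xi> x * f \<epsilon> x) \<xi>"
          by (simp add: fourier_cmult[symmetric] mult.assoc)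
        ultimately have "c * ((1 + norm \<xi>) ^ l * cmod (fourier (\<lambda>x. \<Psi> \<epsilon> \<xi> x * f \<epsilon> x) \<xi>)) \<le> real (Suc m) * \<epsilon> powr (- real N)"
          using c by (simp add: norm_mult mult_ac)
        then have "(1 + norm \<xi>) ^ l * cmod (fourier (\<lambda>x. \<Psi> \<epsilon> \<xi> x * f \<epsilon> x) \<xi>) \<le> real (Suc m) * \<epsilon> powr (- real N) / c"
          using c by (simp add: pos_le_divide_eq mult.commute)
        also have "\<dots> = (2 / \<delta> * real (Suc m)) * \<epsilon> powr (- (real N + 1))"
          unfolding c_def using elim \<delta> by (simp add: powr_diff powr_minus field_simps)
        finally show "(1 + norm \<xi>) ^ l * cmod (fourier (\<lambda>x. \<Psi> \<epsilon> \<xi> x * f \<epsilon> x) \<xi>)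
            \<le> (2 / \<delta> * real (Suc m)) * \<epsilon> powr (- (real N + 1))" .
      qed
    qed
    moreover have "2 / \<delta> * real (Suc m) > 0" using \<delta> by simp
    ultimately show ?thesis by blast
  qed
  then show ?thesis by (intro exI[of _ "real N + 1"]) blast
qed

section \<open>The parametrix\<close>

text \<open>Factors by which amplitudes can be multiplied. Smoothness is asked near \<open>K\<close>, on a neighbourhood that
  may depend on \<open>\<epsilon>\<close> and \<open>\<xi>\<close>: the principal symbol can vanish close to \<open>K\<close>.\<close>

definition slow_symbol ::
    "(real^'n::finite) set \<Rightarrow> (real^'n) set \<Rightarrow> (real \<Rightarrow> real^'n \<Rightarrow> real^'n \<Rightarrow> complex) \<Rightarrow> bool" where
  "slow_symbol K \<Gamma> G \<longleftrightarrow>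
    (\<forall>\<^sub>F \<epsilon> in at_right 0. \<forall>\<xi>\<in>\<Gamma>. \<exists>V. open V \<and> K \<subseteq> V \<and> smooth_on V (G \<epsilon> \<xi>)) \<and>
    (\<forall>k. slow_net (\<Gamma> \<times> K) (\<lambda>\<epsilon> p. jet k (G \<epsilon> (fst p)) (snd p)))"

lemma slow_amplitude_add:
  assumes "slow_amplitude K \<Gamma> \<Phi>" "slow_amplitude K \<Gamma> \<Psi>"
  shows "slow_amplitude K \<Gamma> (\<lambda>\<epsilon> \<xi> x. \<Phi> \<epsilon> \<xi> x + \<Psi> \<epsilon> \<xi> x)"
  unfolding slow_amplitude_def
proof (intro conjI allI)
  show "\<forall>\<^sub>F \<epsilon> in at_right 0. \<forall>\<xi>\<in>\<Gamma>. (\<lambda>x. \<Phi> \<epsilon> \<xi> x + \<Psi> \<epsilon> \<xi> x) \<in> smooth_supp K"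
    using slow_amplitudeD(1)[OF assms(1)] slow_amplitudeD(1)[OF assms(2)]
    by eventually_elim (simp add: smooth_supp_add)
  fix k
  show "slow_net (\<Gamma> \<times> K) (\<lambda>\<epsilon> p. jet k (\<lambda>x. \<Phi> \<epsilon> (fst p) x + \<Psi> \<epsilon> (fst p) x) (snd p))"
  proof (rule slow_net_mono[OF slow_net_add[OF slow_amplitudeD(2)[OF assms(1)] slow_amplitudeD(2)[OF assms(2)]]])
    show "\<forall>\<^sub>F \<epsilon> in at_right 0. \<forall>p\<in>\<Gamma> \<times> K. \<bar>jet k (\<lambda>x. \<Phi> \<epsilon> (fst p) x + \<Psi> \<epsilon> (fst p) x) (snd p)\<bar>
        \<le> jet k (\<Phi> \<epsilon> (fst p)) (snd p) + jet k (\<Psi> \<epsilon> (fst p)) (snd p)"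
      using slow_amplitudeD(1)[OF assms(1)] slow_amplitudeD(1)[OF assms(2)]
    proof eventually_elim
      case (elim \<epsilon>)
      show ?case
      proof
        fix p assume "p \<in> \<Gamma> \<times> K"
        then have "smooth_on UNIV (\<Phi> \<epsilon> (fst p))" "smooth_on UNIV (\<Psi> \<epsilon> (fst p))"
          using elim smooth_suppD(1) by (metis mem_Times_iff)+
        from jet_add_le[OF open_UNIV this, of "snd p" k]
        show "\<bar>jet k (\<lambda>x. \<Phi> \<epsilon> (fst p) x + \<Psi> \<epsilon> (fst p) x) (snd p)\<bar>
            \<le> jet k (\<Phi> \<epsilon> (fst p)) (snd p) + jet k (\<Psi> \<epsilon> (fst p)) (snd p)"
          by (simp add: abs_of_nonneg[OF jet_nonneg])
      qed
    qed
  qed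
qed

lemma slow_amplitude_mult_symbol:
  assumes K: "closed K" and \<Psi>: "slow_amplitude K \<Gamma> \<Psi>" and G: "slow_symbol K \<Gamma> G"
  shows "slow_amplitude K \<Gamma> (\<lambda>\<epsilon> \<xi> x. \<Psi> \<epsilon> \<xi> x * G \<epsilon> \<xi> x)"
  unfolding slow_amplitude_def
proof (intro conjI allI)
  have sG: "\<forall>\<^sub>F \<epsilon> in at_right 0. \<forall>\<xi>\<in>\<Gamma>. \<exists>V. open V \<and> K \<subseteq> V \<and> smooth_on V (G \<epsilon> \<xi>)"
    and nG: "\<And>k. slow_net (\<Gamma> \<times> K) (\<lambda>\<epsilon> p. jet k (G \<epsilon> (fst p)) (snd p))"
    using G unfolding slow_symbol_def by auto
  show "\<forall>\<^sub>F \<epsilon> in at_right 0. \<forall>\<xi>\<in>\<Gamma>. (\<lambda>x. \<Psi> \<epsilon> \<xi> x * G \<epsilon> \<xi> x) \<in> smooth_supp K"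
    using slow_amplitudeD(1)[OF \<Psi>] sG
  proof eventually_elim
    case (elim \<epsilon>)
    show ?case
    proof
      fix \<xi> assume \<xi>: "\<xi> \<in> \<Gamma>"
      then obtain V where "open V" "K \<subseteq> V" "smooth_on V (G \<epsilon> \<xi>)" using elim(2) by blast
      then show "(\<lambda>x. \<Psi> \<epsilon> \<xi> x * G \<epsilon> \<xi> x) \<in> smooth_supp K"
        using elim(1) \<xi> by (intro smooth_supp_mult[OF _ K]) auto
    qed
  qed
  fix k
  show "slow_net (\<Gamma> \<times> K) (\<lambda>\<epsilon> p. jet k (\<lambda>x. \<Psi> \<epsilon> (fst p) x * G \<epsilon> (fst p) x) (snd p))"
  proof (rule slow_net_mono[OF slow_net_mult[OF slow_net_const slow_net_mult[OF slow_amplitudeD(2)[OF \<Psi>] nG]]])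
    show "\<forall>\<^sub>F \<epsilon> in at_right 0. \<forall>p\<in>\<Gamma> \<times> K. \<bar>jet k (\<lambda>x. \<Psi> \<epsilon> (fst p) x * G \<epsilon> (fst p) x) (snd p)\<bar>
        \<le> 2 ^ k * (jet k (\<Psi> \<epsilon> (fst p)) (snd p) * jet k (G \<epsilon> (fst p)) (snd p))"
      using slow_amplitudeD(1)[OF \<Psi>] sG
    proof eventually_elim
      case (elim \<epsilon>)
      show ?case
      proof
        fix p assume "p \<in> \<Gamma> \<times> K"
        then have p: "fst p \<in> \<Gamma>" "snd p \<in> K" by auto
        then obtain V where V: "open V" "K \<subseteq> V" "smooth_on V (G \<epsilon> (fst p))" using elim(2) by blast
        have "smooth_on V (\<Psi> \<epsilon> (fst p))"
          using elim(1) p by (intro smooth_on_subset[OF smooth_suppD(1)]) auto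
        from jet_mult_le[OF V(1) this V(3), of "snd p" k]
        show "\<bar>jet k (\<lambda>x. \<Psi> \<epsilon> (fst p) x * G \<epsilon> (fst p) x) (snd p)\<bar>
            \<le> 2 ^ k * (jet k (\<Psi> \<epsilon> (fst p)) (snd p) * jet k (G \<epsilon> (fst p)) (snd p))"
          using V(2) p by (simp add: abs_of_nonneg[OF jet_nonneg] subsetD)
      qed
    qed
  qed
qed

lemma slow_symbol_const: "slow_symbol K \<Gamma> (\<lambda>_ _ _. c)"
  unfolding slow_symbol_def
proof (intro conjI allI)
  have "\<exists>V. open V \<and> K \<subseteq> V \<and> smooth_on V (\<lambda>_. c)"
    using smooth_on_const[OF open_UNIV] by (intro exI[of _ UNIV]) simp
  then show "\<forall>\<^sub>F \<epsilon> in at_right (0::real). \<forall>\<xi>\<in>\<Gamma>. \<exists>V. open V \<and> K \<subseteq> V \<and> smooth_on V (\<lambda>_. c)" by simp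
qed (simp add: jet_const slow_net_const)

lemma slow_amplitude_cmult:
  assumes "closed K" "slow_amplitude K \<Gamma> \<Psi>"
  shows "slow_amplitude K \<Gamma> (\<lambda>\<epsilon> \<xi> x. c * \<Psi> \<epsilon> \<xi> x)"
  using slow_amplitude_mult_symbol[OF assms slow_symbol_const] by (simp add: mult.commute)

lemma slow_amplitude_sum:
  assumes "closed K" "finite I" "\<And>i. i \<in> I \<Longrightarrow> slow_amplitude K \<Gamma> (\<Psi> i)"
  shows "slow_amplitude K \<Gamma> (\<lambda>\<epsilon> \<xi> x. \<Sum>i\<in>I. \<Psi> i \<epsilon> \<xi> x)"
  using assms(2,3)
proof (induction I rule: finite_induct)
  case empty
  have "(\<lambda>_. 0) \<in> smooth_supp K" using smooth_on_const[OF open_UNIV] by (simp add: smooth_supp_def)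
  then show ?case by (simp add: slow_amplitude_def jet_const slow_net_const)
next
  case (insert i I)
  then have "slow_amplitude K \<Gamma> (\<lambda>\<epsilon> \<xi> x. \<Psi> i \<epsilon> \<xi> x + (\<Sum>i\<in>I. \<Psi> i \<epsilon> \<xi> x))"
    by (intro slow_amplitude_add) auto
  then show ?case using insert(1,2) by simp
qed

lemma slow_amplitude_pderiv:
  assumes "closed K" "slow_amplitude K \<Gamma> \<Psi>"
  shows "slow_amplitude K \<Gamma> (\<lambda>\<epsilon> \<xi>. pderiv_at j (\<Psi> \<epsilon> \<xi>))"
  unfolding slow_amplitude_def
proof (intro conjI allI)
  show "\<forall>\<^sub>F \<epsilon> in at_right 0. \<forall>\<xi>\<in>\<Gamma>. pderiv_at j (\<Psi> \<epsilon> \<xi>) \<in> smooth_supp K"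
    using slow_amplitudeD(1)[OF assms(2)] by eventually_elim (simp add: smooth_supp_pderiv assms(1))
  fix k
  show "slow_net (\<Gamma> \<times> K) (\<lambda>\<epsilon> p. jet k (pderiv_at j (\<Psi> \<epsilon> (fst p))) (snd p))"
    by (rule slow_net_mono[OF slow_amplitudeD(2)[OF assms(2), of "Suc k"]])
      (simp only: abs_of_nonneg[OF jet_nonneg] jet_pderiv_le, simp)
qed

lemma slow_symbol_coefficient:
  fixes a :: "'n::finite family"
  assumes "open \<Omega>" "K \<subseteq> \<Omega>" "\<And>\<epsilon>. \<epsilon> \<in> {0<..1} \<Longrightarrow> smooth_on \<Omega> (a \<epsilon>)"
    "\<And>k. slow_net K (\<lambda>\<epsilon>. jet k (a \<epsilon>))"
  shows "slow_symbol K \<Gamma> (\<lambda>\<epsilon> _. a \<epsilon>)"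
  unfolding slow_symbol_def
proof (intro conjI allI)
  show "\<forall>\<^sub>F \<epsilon> in at_right 0. \<forall>\<xi>\<in>\<Gamma>. \<exists>V. open V \<and> K \<subseteq> V \<and> smooth_on V (a \<epsilon>)"
    using eventually_small[OF zero_less_one] by eventually_elim (use assms in force)
  show "slow_net (\<Gamma> \<times> K) (\<lambda>\<epsilon> p. jet k (a \<epsilon>) (snd p))" for k
    by (rule slow_net_pullback[OF assms(4)]) auto
qed

lemma principal_symbol_scaleR:
  "principal_symbol a \<epsilon> x (t *\<^sub>R \<xi>) = complex_of_real t * principal_symbol a \<epsilon> x \<xi>"
  unfolding principal_symbol_def by (simp add: sum_distrib_left mult_ac)

lemma principal_symbol_sgn:
  "complex_of_real (norm \<xi>) * principal_symbol a \<epsilon> x (sgn \<xi>) = principal_symbol a \<epsilon> x \<xi>"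
  unfolding principal_symbol_scaleR[symmetric] by (cases "\<xi> = 0") (simp_all add: sgn_div_norm)

text \<open>The principal symbol is homogeneous, so a lower bound at large frequencies scales down to the unit
  sphere of the cone.\<close>

lemma principal_symbol_sgn_lower_bound:
  assumes "open_cone \<Gamma>" "\<xi> \<in> \<Gamma>" "s > 0"
    and bound: "\<And>\<eta>. \<eta> \<in> \<Gamma> \<Longrightarrow> norm \<eta> \<ge> r \<Longrightarrow> cmod (principal_symbol a \<epsilon> x \<eta>) \<ge> 1 / s * (1 + norm \<eta>)"
  shows "cmod (principal_symbol a \<epsilon> x (sgn \<xi>)) \<ge> 1 / s"
proof -
  have "\<xi> \<noteq> 0" using assms(1,2) unfolding open_cone_def by blast
  define t where "t = max 1 r"
  have t: "t \<ge> 1" "t \<ge> r" by (auto simp: t_def)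
  have "(t / norm \<xi>) *\<^sub>R \<xi> \<in> \<Gamma>"
    using assms(1,2) \<open>\<xi> \<noteq> 0\<close> t unfolding open_cone_def by simp
  moreover have "(t / norm \<xi>) *\<^sub>R \<xi> = t *\<^sub>R sgn \<xi>" by (simp add: sgn_div_norm divide_inverse)
  ultimately have "t *\<^sub>R sgn \<xi> \<in> \<Gamma>" by simp
  moreover have "norm (t *\<^sub>R sgn \<xi>) = t" using \<open>\<xi> \<noteq> 0\<close> t by (simp add: norm_sgn)
  ultimately have "1 / s * (1 + t) \<le> t * cmod (principal_symbol a \<epsilon> x (sgn \<xi>))"
    using bound[of "t *\<^sub>R sgn \<xi>"] t by (simp add: principal_symbol_scaleR norm_mult)
  moreover have "t * (1 / s) \<le> 1 / s * (1 + t)" using assms(3) by (simp add: distrib_left)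
  ultimately have "t * (1 / s) \<le> t * cmod (principal_symbol a \<epsilon> x (sgn \<xi>))" by linarith
  then show ?thesis by (rule mult_left_le_imp_le) (use t in simp)
qed

text \<open>Slow scale is inherited from order to order by \<open>jet_inverse_le\<close>; the lower bound on \<open>G\<close> enters
  only through the value of the inverse itself.\<close>

lemma slow_symbol_inverse:
  assumes G: "slow_symbol K \<Gamma> G"
    and bound: "slow_net (\<Gamma> \<times> K) (\<lambda>\<epsilon> p. inverse (cmod (G \<epsilon> (fst p) (snd p))))"
    and nz: "\<forall>\<^sub>F \<epsilon> in at_right 0. \<forall>\<xi>\<in>\<Gamma>. \<forall>x\<in>K. G \<epsilon> \<xi> x \<noteq> 0"
  shows "slow_symbol K \<Gamma> (\<lambda>\<epsilon> \<xi> x. inverse (G \<epsilon> \<xi> x))"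
proof -
  have sG: "\<forall>\<^sub>F \<epsilon> in at_right 0. \<forall>\<xi>\<in>\<Gamma>. \<exists>V. open V \<and> K \<subseteq> V \<and> smooth_on V (G \<epsilon> \<xi>)"
    and nG: "\<And>k. slow_net (\<Gamma> \<times> K) (\<lambda>\<epsilon> p. jet k (G \<epsilon> (fst p)) (snd p))"
    using G unfolding slow_symbol_def by auto
  have V: "\<forall>\<^sub>F \<epsilon> in at_right 0. \<forall>\<xi>\<in>\<Gamma>. \<exists>V. open V \<and> K \<subseteq> V \<and> smooth_on V (G \<epsilon> \<xi>) \<and> (\<forall>x\<in>V. G \<epsilon> \<xi> x \<noteq> 0)"
    using sG nz
  proof eventually_elim
    case (elim \<epsilon>)
    show ?case
    proof
      fix \<xi> assume \<xi>: "\<xi> \<in> \<Gamma>"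
      then obtain V where V: "open V" "K \<subseteq> V" "smooth_on V (G \<epsilon> \<xi>)" using elim(1) by blast
      let ?W = "V \<inter> G \<epsilon> \<xi> -` (- {0})"
      show "\<exists>V. open V \<and> K \<subseteq> V \<and> smooth_on V (G \<epsilon> \<xi>) \<and> (\<forall>x\<in>V. G \<epsilon> \<xi> x \<noteq> 0)"
      proof (intro exI conjI)
        show "open ?W"
          by (rule continuous_open_preimage[OF smooth_on_imp_continuous_on[OF V(3)] V(1)]) (rule open_Compl[OF closed_singleton])
        show "K \<subseteq> ?W"
        proof
          fix x assume "x \<in> K"
          then show "x \<in> ?W" using V(2) bspec[OF bspec[OF elim(2) \<xi>]] by auto
        qed
        show "smooth_on ?W (G \<epsilon> \<xi>)" by (rule smooth_on_subset[OF V(3) Int_lower1])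
        show "\<forall>x\<in>?W. G \<epsilon> \<xi> x \<noteq> 0" by simp
      qed
    qed
  qed
  have "slow_net (\<Gamma> \<times> K) (\<lambda>\<epsilon> p. jet k (\<lambda>x. inverse (G \<epsilon> (fst p) x)) (snd p))" for k
  proof (induction k)
    case 0
    then show ?case using bound by (simp add: norm_inverse)
  next
    case (Suc k)
    show ?case
    proof (rule slow_net_mono[OF slow_net_add[OF bound slow_net_mult[OF slow_net_const
        slow_net_mult[OF nG slow_net_mult[OF Suc Suc]]]]])
      show "\<forall>\<^sub>F \<epsilon> in at_right 0. \<forall>p\<in>\<Gamma> \<times> K. \<bar>jet (Suc k) (\<lambda>x. inverse (G \<epsilon> (fst p) x)) (snd p)\<bar>
          \<le> inverse (cmod (G \<epsilon> (fst p) (snd p))) + 4 ^ k * (jet (Suc k) (G \<epsilon> (fst p)) (snd p) *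
            (jet k (\<lambda>x. inverse (G \<epsilon> (fst p) x)) (snd p) * jet k (\<lambda>x. inverse (G \<epsilon> (fst p) x)) (snd p)))"
        using V
      proof eventually_elim
        case (elim \<epsilon>)
        show ?case
        proof
          fix p assume "p \<in> \<Gamma> \<times> K"
          then have p: "fst p \<in> \<Gamma>" "snd p \<in> K" by auto
          obtain V where V: "open V" "K \<subseteq> V" "smooth_on V (G \<epsilon> (fst p))" "\<And>x. x \<in> V \<Longrightarrow> G \<epsilon> (fst p) x \<noteq> 0"
            using bspec[OF elim p(1)] by metis
          have "snd p \<in> V" using p V(2) by blast
          from jet_inverse_le[OF V(1,3) this V(4), of k]
          show "\<bar>jet (Suc k) (\<lambda>x. inverse (G \<epsilon> (fst p) x)) (snd p)\<bar>
              \<le> inverse (cmod (G \<epsilon> (fst p) (snd p))) + 4 ^ k * (jet (Suc k) (G \<epsilon> (fst p)) (snd p) *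
                (jet k (\<lambda>x. inverse (G \<epsilon> (fst p) x)) (snd p) * jet k (\<lambda>x. inverse (G \<epsilon> (fst p) x)) (snd p)))"
            unfolding abs_of_nonneg[OF jet_nonneg] power2_eq_square .
        qed
      qed
    qed
  qed
  moreover have "\<forall>\<^sub>F \<epsilon> in at_right 0. \<forall>\<xi>\<in>\<Gamma>. \<exists>V. open V \<and> K \<subseteq> V \<and> smooth_on V (\<lambda>x. inverse (G \<epsilon> \<xi> x))"
    using V
  proof eventually_elim
    case (elim \<epsilon>)
    show ?case
    proof
      fix \<xi> assume \<xi>: "\<xi> \<in> \<Gamma>"
      obtain V where "open V" "K \<subseteq> V" "smooth_on V (G \<epsilon> \<xi>)" "\<And>x. x \<in> V \<Longrightarrow> G \<epsilon> \<xi> x \<noteq> 0"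
        using bspec[OF elim \<xi>] by metis
      then show "\<exists>V. open V \<and> K \<subseteq> V \<and> smooth_on V (\<lambda>x. inverse (G \<epsilon> \<xi> x))"
        by (intro exI[of _ V] conjI smooth_on_inverse)
    qed
  qed
  ultimately show ?thesis unfolding slow_symbol_def by simp
qed

lemma slow_symbol_principal_symbol_sgn:
  fixes a :: "'n::finite \<Rightarrow> 'n family"
  assumes "open \<Omega>" "K \<subseteq> \<Omega>" "\<And>j \<epsilon>. \<epsilon> \<in> {0<..1} \<Longrightarrow> smooth_on \<Omega> (a j \<epsilon>)"
    "\<And>j k. slow_net K (\<lambda>\<epsilon>. jet k (a j \<epsilon>))"
  shows "slow_symbol K \<Gamma> (\<lambda>\<epsilon> \<xi> x. principal_symbol a \<epsilon> x (sgn \<xi>))"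
  unfolding slow_symbol_def
proof (intro conjI allI)
  have s: "smooth_on \<Omega> (\<lambda>x. principal_symbol a \<epsilon> x \<eta>)" if "\<epsilon> \<in> {0<..1}" for \<epsilon> \<eta>
    unfolding principal_symbol_def
    by (intro smooth_on_sum[OF assms(1)] smooth_on_mult[OF assms(1)] smooth_on_const[OF assms(1)]
      assms(3)[OF that] finite)
  show "\<forall>\<^sub>F \<epsilon> in at_right 0. \<forall>\<xi>\<in>\<Gamma>. \<exists>V. open V \<and> K \<subseteq> V \<and> smooth_on V (\<lambda>x. principal_symbol a \<epsilon> x (sgn \<xi>))"
    using eventually_small[OF zero_less_one]
  proof eventually_elim
    case (elim \<epsilon>)
    then have "smooth_on \<Omega> (\<lambda>x. principal_symbol a \<epsilon> x (sgn \<xi>))" for \<xi> by (intro s) simp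
    then show ?case using assms(1,2) by blast
  qed
  fix k
  have n: "slow_net (\<Gamma> \<times> K) (\<lambda>\<epsilon> p. \<Sum>j\<in>UNIV. jet k (a j \<epsilon>) (snd p))"
    by (intro slow_net_sum finite slow_net_pullback[OF assms(4)]) auto
  show "slow_net (\<Gamma> \<times> K) (\<lambda>\<epsilon> p. jet k (\<lambda>x. principal_symbol a \<epsilon> x (sgn (fst p))) (snd p))"
  proof (rule slow_net_mono[OF n])
    show "\<forall>\<^sub>F \<epsilon> in at_right 0. \<forall>p\<in>\<Gamma> \<times> K. \<bar>jet k (\<lambda>x. principal_symbol a \<epsilon> x (sgn (fst p))) (snd p)\<bar>
        \<le> (\<Sum>j\<in>UNIV. jet k (a j \<epsilon>) (snd p))"
      using eventually_small[OF zero_less_one]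
    proof eventually_elim
      case (elim \<epsilon>)
      then have sa: "smooth_on \<Omega> (a j \<epsilon>)" for j by (intro assms(3)) simp
      show ?case
      proof
        fix p assume "p \<in> \<Gamma> \<times> K"
        then have x: "snd p \<in> \<Omega>" using assms(2) by auto
        let ?\<eta> = "sgn (fst p)"
        have "jet k (\<lambda>x. principal_symbol a \<epsilon> x ?\<eta>) (snd p)
            = jet k (\<lambda>x. \<Sum>j\<in>UNIV. complex_of_real (?\<eta> $ j) * a j \<epsilon> x) (snd p)"
          unfolding principal_symbol_def by (simp add: mult.commute)
        also have "\<dots> \<le> (\<Sum>j\<in>UNIV. jet k (\<lambda>x. complex_of_real (?\<eta> $ j) * a j \<epsilon> x) (snd p))"
          by (intro jet_sum_le[OF assms(1) finite _ x] smooth_on_mult[OF assms(1)] smooth_on_const[OF assms(1)] sa)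
        also have "\<dots> \<le> (\<Sum>j\<in>UNIV. jet k (a j \<epsilon>) (snd p))"
        proof (rule sum_mono)
          fix j
          have "\<bar>?\<eta> $ j\<bar> \<le> norm ?\<eta>" by (rule component_le_norm_cart)
          also have "\<dots> \<le> 1" by (simp add: norm_sgn)
          finally have "cmod (complex_of_real (?\<eta> $ j)) * jet k (a j \<epsilon>) (snd p) \<le> 1 * jet k (a j \<epsilon>) (snd p)"
            by (intro mult_right_mono jet_nonneg) simp
          then show "jet k (\<lambda>x. complex_of_real (?\<eta> $ j) * a j \<epsilon> x) (snd p) \<le> jet k (a j \<epsilon>) (snd p)"
            using jet_cmult_le[OF assms(1) sa x, of k "complex_of_real (?\<eta> $ j)" j] by linarith
        qed
        finally show "\<bar>jet k (\<lambda>x. principal_symbol a \<epsilon> x ?\<eta>) (snd p)\<bar> \<le> (\<Sum>j\<in>UNIV. jet k (a j \<epsilon>) (snd p))"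
          by (simp only: abs_of_nonneg[OF jet_nonneg])
      qed
    qed
  qed
qed

text \<open>The transpose of \<open>P\<close>, applied to \<open>\<psi> b\<close> times \<open>exp(-i\<xi>x)\<close>, consists of the principal symbol times
  \<open>\<psi> b exp(-i\<xi>x)\<close> and of terms in which the exponential is not differentiated. The latter, with
  the opposite sign and without the exponential, are the following function.\<close>

definition transport_step ::
    "'n::finite family \<Rightarrow> ('n \<Rightarrow> 'n family) \<Rightarrow> real \<Rightarrow> (real^'n \<Rightarrow> complex) \<Rightarrow> (real^'n \<Rightarrow> complex) \<Rightarrow> real^'n \<Rightarrow> complex" where
  "transport_step a\<^sub>0 a \<epsilon> b \<psi> x =
    (\<Sum>j\<in>UNIV. - \<i> * pderiv_at j (\<lambda>x. \<psi> x * b x * a j \<epsilon> x) x) + - 1 * (\<psi> x * b x * a\<^sub>0 \<epsilon> x)"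

lemma slow_amplitude_transport_step:
  assumes "closed K" "slow_amplitude K \<Gamma> \<Psi>" "slow_symbol K \<Gamma> b"
    "slow_symbol K \<Gamma> (\<lambda>\<epsilon> _. a\<^sub>0 \<epsilon>)" "\<And>j. slow_symbol K \<Gamma> (\<lambda>\<epsilon> _. a j \<epsilon>)"
  shows "slow_amplitude K \<Gamma> (\<lambda>\<epsilon> \<xi>. transport_step a\<^sub>0 a \<epsilon> (b \<epsilon> \<xi>) (\<Psi> \<epsilon> \<xi>))"
  unfolding transport_step_def
  by (intro slow_amplitude_add slow_amplitude_sum slow_amplitude_cmult slow_amplitude_pderiv
    slow_amplitude_mult_symbol assms finite)

text \<open>Integration by parts against \<open>exp (- \<i> \<xi> x)\<close>: differentiating the exponential in \<open>P\<close> produces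
  the principal symbol, which the factor \<open>b\<close> turns into \<open>|\<xi>|\<close>, and everything else is collected in
  \<open>transport_step\<close>.\<close>

lemma fourier_parametrix_identity:
  fixes a\<^sub>0 v :: "'n::finite family" and a :: "'n \<Rightarrow> 'n family"
  assumes K: "compact K" and V: "open V" "K \<subseteq> V" and \<psi>: "\<psi> \<in> smooth_supp K"
    and b: "smooth_on V b" "\<And>x. x \<in> K \<Longrightarrow> b x * principal_symbol a \<epsilon> x \<xi> = complex_of_real (norm \<xi>)"
    and s: "smooth_on V (a\<^sub>0 \<epsilon>)" "\<And>j. smooth_on V (a j \<epsilon>)" "smooth_on V (v \<epsilon>)"
  shows "complex_of_real (norm \<xi>) * fourier (\<lambda>x. \<psi> x * v \<epsilon> x) \<xi> =
    fourier (\<lambda>x. (\<psi> x * b x) * first_order_family a\<^sub>0 a v \<epsilon> x) \<xi> +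
    fourier (\<lambda>x. transport_step a\<^sub>0 a \<epsilon> b \<psi> x * v \<epsilon> x) \<xi>"
proof -
  have clK: "closed K" using K by (rule compact_imp_closed)
  let ?f = "first_order_family a\<^sub>0 a v \<epsilon>" and ?T = "transport_step a\<^sub>0 a \<epsilon> b \<psi>"
  define B where "B j x = \<psi> x * b x * a j \<epsilon> x" for j x
  define G where "G j x = B j x * v \<epsilon> x" for j x
  note sm = smooth_supp_mult[OF V(1) clK V(2)]
  have \<psi>b: "(\<lambda>x. \<psi> x * b x) \<in> smooth_supp K" by (rule sm[OF \<psi> b(1)])
  have B: "B j \<in> smooth_supp K" for j
    using sm[OF \<psi>b s(2)[of j]] by (simp add: B_def[abs_def])
  have G: "G j \<in> smooth_supp K" for j
    using sm[OF B s(3)] by (simp add: G_def[abs_def])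
  have dG: "pderiv_at j (G j) \<in> smooth_supp K" and dB: "pderiv_at j (B j) \<in> smooth_supp K" for j
    by (intro smooth_supp_pderiv clK B G)+
  have T: "?T \<in> smooth_supp K"
  proof -
    have "(\<lambda>x. (\<Sum>j\<in>UNIV. - \<i> * pderiv_at j (B j) x) + - 1 * (\<psi> x * b x * a\<^sub>0 \<epsilon> x)) \<in> smooth_supp K"
      by (intro smooth_supp_add smooth_supp_sum smooth_supp_cmult dB sm[OF \<psi>b s(1)] finite)
    then show ?thesis unfolding transport_step_def[abs_def] B_def[abs_def] .
  qed
  have sf: "smooth_on V ?f" by (intro smooth_on_first_order_family V s)
  have bf: "(\<lambda>x. (\<psi> x * b x) * ?f x) \<in> smooth_supp K" by (rule sm[OF \<psi>b sf])
  have Tv: "(\<lambda>x. ?T x * v \<epsilon> x) \<in> smooth_supp K" by (rule sm[OF T s(3)])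
  have "complex_of_real (norm \<xi>) * fourier (\<lambda>x. \<psi> x * v \<epsilon> x) \<xi>
      = fourier (\<lambda>x. \<Sum>j\<in>UNIV. complex_of_real (\<xi> $ j) * G j x) \<xi>"
  proof -
    have "complex_of_real (norm \<xi>) * (\<psi> x * v \<epsilon> x) = (\<Sum>j\<in>UNIV. complex_of_real (\<xi> $ j) * G j x)" for x
    proof (cases "x \<in> K")
      case True
      have "(\<Sum>j\<in>UNIV. complex_of_real (\<xi> $ j) * G j x) = \<psi> x * v \<epsilon> x * (b x * principal_symbol a \<epsilon> x \<xi>)"
        unfolding G_def B_def principal_symbol_def by (simp add: sum_distrib_left mult_ac)
      then show ?thesis using b(2)[OF True] by (simp add: mult_ac)
    next
      case False
      then show ?thesis using smooth_suppD(2)[OF \<psi> False] by (simp add: G_def B_def)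
    qed
    then show ?thesis unfolding fourier_cmult[symmetric] by simp
  qed
  also have "\<dots> = (\<Sum>j\<in>UNIV. complex_of_real (\<xi> $ j) * fourier (G j) \<xi>)"
    by (subst fourier_sum[OF K finite])
      (simp_all add: fourier_cmult smooth_suppD(2)[OF G] continuous_on_mult_left smooth_suppD(3)[OF G])
  also have "\<dots> = (\<Sum>j\<in>UNIV. - \<i> * fourier (pderiv_at j (G j)) \<xi>)"
    unfolding fourier_pderiv[OF K G] by (simp add: mult.assoc[symmetric])
  also have "\<dots> = fourier (\<lambda>x. \<Sum>j\<in>UNIV. - \<i> * pderiv_at j (G j) x) \<xi>"
    using smooth_suppD(2)[OF smooth_supp_cmult[OF dG]] smooth_suppD(3)[OF smooth_supp_cmult[OF dG]]
    by (subst fourier_sum[OF K finite]) (simp_all only: fourier_cmult)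
  also have "(\<lambda>x. \<Sum>j\<in>UNIV. - \<i> * pderiv_at j (G j) x) = (\<lambda>x. (\<psi> x * b x) * ?f x + ?T x * v \<epsilon> x)"
  proof
    fix x
    show "(\<Sum>j\<in>UNIV. - \<i> * pderiv_at j (G j) x) = (\<psi> x * b x) * ?f x + ?T x * v \<epsilon> x"
    proof (cases "x \<in> K")
      case True
      then have x: "x \<in> V" using V(2) by blast
      have "pderiv_at j (G j) x = pderiv_at j (B j) x * v \<epsilon> x + B j x * pderiv_at j (v \<epsilon>) x" for j
        unfolding G_def[abs_def]
        by (rule pderiv_at_mult[OF smooth_onD[OF smooth_suppD(1)[OF B] open_UNIV UNIV_I] smooth_onD[OF s(3) V(1) x]])
      then have "(\<Sum>j\<in>UNIV. - \<i> * pderiv_at j (G j) x)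
          = (\<Sum>j\<in>UNIV. - \<i> * pderiv_at j (B j) x) * v \<epsilon> x + (\<Sum>j\<in>UNIV. B j x * (- \<i> * pderiv_at j (v \<epsilon>) x))"
        by (simp only: sum_distrib_right sum.distrib[symmetric]) (simp add: algebra_simps)
      moreover have "(\<Sum>j\<in>UNIV. B j x * (- \<i> * pderiv_at j (v \<epsilon>) x))
          = \<psi> x * b x * (\<Sum>j\<in>UNIV. a j \<epsilon> x * (- \<i> * pderiv_at j (v \<epsilon>) x))"
        unfolding B_def sum_distrib_left by (simp add: mult.assoc)
      ultimately show ?thesis
        unfolding first_order_family_def transport_step_def B_def[symmetric, abs_def]
        by (simp add: algebra_simps)
    next
      case False
      then show ?thesis
        using smooth_suppD(2)[OF dG False] smooth_suppD(2)[OF T False] smooth_suppD(2)[OF \<psi> False] by simp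
    qed
  qed
  also have "fourier (\<lambda>x. (\<psi> x * b x) * ?f x + ?T x * v \<epsilon> x) \<xi>
      = fourier (\<lambda>x. (\<psi> x * b x) * ?f x) \<xi> + fourier (\<lambda>x. ?T x * v \<epsilon> x) \<xi>"
    by (rule fourier_add[OF K smooth_suppD(3)[OF bf] smooth_suppD(2)[OF bf] smooth_suppD(3)[OF Tv] smooth_suppD(2)[OF Tv]])
  finally show ?thesis .
qed

section \<open>Decay by repeated integration by parts\<close>

text \<open>Induction on the order \<open>l\<close> of decay, for all amplitudes at once. The base case is that \<open>v\<close> is
  moderate and amplitudes are at most \<open>1 / \<epsilon>\<close>; in the step \<open>(1 + |\<xi>|) F(\<Psi> v)\<close> is replaced by \<open>F(\<Psi> v)\<close> and the two terms of
  \<open>fourier_parametrix_identity\<close>, all of which have decay of order \<open>l\<close>. No step changes the exponent.\<close>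

lemma slow_amplitude_decay:
  fixes a\<^sub>0 v :: "'n::finite family" and a :: "'n \<Rightarrow> 'n family" and K \<Gamma> :: "(real^'n) set"
  assumes K: "compact K" "K \<subseteq> \<Omega>" and \<Omega>: "open \<Omega>"
    and v: "v \<in> moderate \<Omega>"
    and sa: "\<And>\<epsilon>. \<epsilon> \<in> {0<..1} \<Longrightarrow> smooth_on \<Omega> (a\<^sub>0 \<epsilon>)" "\<And>j \<epsilon>. \<epsilon> \<in> {0<..1} \<Longrightarrow> smooth_on \<Omega> (a j \<epsilon>)"
    and coeff: "slow_symbol K \<Gamma> (\<lambda>\<epsilon> _. a\<^sub>0 \<epsilon>)" "\<And>j. slow_symbol K \<Gamma> (\<lambda>\<epsilon> _. a j \<epsilon>)"
    and b: "slow_symbol K \<Gamma> b"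
      "\<forall>\<^sub>F \<epsilon> in at_right 0. \<forall>\<xi>\<in>\<Gamma>. \<forall>x\<in>K. b \<epsilon> \<xi> x * principal_symbol a \<epsilon> x \<xi> = complex_of_real (norm \<xi>)"
    and f: "\<And>\<Psi> l. slow_amplitude K \<Gamma> \<Psi> \<Longrightarrow> amplitude_decay \<Gamma> N\<^sub>f (first_order_family a\<^sub>0 a v) \<Psi> l"
  shows "\<exists>N. \<forall>\<Psi> l. slow_amplitude K \<Gamma> \<Psi> \<longrightarrow> amplitude_decay \<Gamma> N v \<Psi> l"
proof -
  have clK: "closed K" using K(1) by (rule compact_imp_closed)
  obtain p where p: "\<forall>\<^sub>F \<epsilon> in at_right 0. \<forall>x\<in>K. \<bar>jet 0 (v \<epsilon>) x\<bar> \<le> \<epsilon> powr (- p)"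
    using moderate_imp_moderate_net_jet[OF \<Omega> v K, of 0] unfolding moderate_net_def by (elim exE) (rule that)
  \<comment> \<open>\<open>p\<close> powers are lost to \<open>v\<close> and one to the amplitude, whose values are at most \<open>1 / \<epsilon>\<close>.\<close>
  define N where "N = max N\<^sub>f (p + 1)"
  have main: "amplitude_decay \<Gamma> N v \<Psi> l"
    if "slow_amplitude K \<Gamma> \<Psi>" for \<Psi> l
    using that
  proof (induction l arbitrary: \<Psi>)
    case 0
    have "\<forall>\<^sub>F \<epsilon> in at_right 0. \<forall>\<xi>\<in>\<Gamma>. cmod (fourier (\<lambda>x. \<Psi> \<epsilon> \<xi> x * v \<epsilon> x) \<xi>)
        \<le> (measure lborel K + 1) * \<epsilon> powr (- N)"
      using p slow_amplitudeD(1)[OF 0] slow_amplitudeD(3)[OF 0, of 0] eventually_small[OF zero_less_one]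
    proof eventually_elim
      case (elim \<epsilon>)
      have vc: "continuous_on K (v \<epsilon>)"
        using smooth_on_imp_continuous_on[OF moderate_imp_smooth_on[OF v, of \<epsilon>]] K(2) elim(4)
        by (auto intro: continuous_on_subset)
      show ?case
      proof
        fix \<xi> assume \<xi>: "\<xi> \<in> \<Gamma>"
        have s: "\<Psi> \<epsilon> \<xi> \<in> smooth_supp K" using elim(2) \<xi> by blast
        have "cmod (fourier (\<lambda>x. \<Psi> \<epsilon> \<xi> x * v \<epsilon> x) \<xi>) \<le> measure lborel K * \<epsilon> powr (- N)"
        proof (rule norm_fourier_le[OF K(1)])
          show "continuous_on K (\<lambda>x. \<Psi> \<epsilon> \<xi> x * v \<epsilon> x)"
            by (intro continuous_on_mult smooth_suppD(3)[OF s] vc)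
          show "\<Psi> \<epsilon> \<xi> x * v \<epsilon> x = 0" if "x \<notin> K" for x using smooth_suppD(2)[OF s that] by simp
          show "cmod (\<Psi> \<epsilon> \<xi> x * v \<epsilon> x) \<le> \<epsilon> powr (- N)" if x: "x \<in> K" for x
          proof -
            have "cmod (\<Psi> \<epsilon> \<xi> x) \<le> 1 / \<epsilon>" "cmod (v \<epsilon> x) \<le> \<epsilon> powr (- p)"
              using bspec[OF bspec[OF elim(3) \<xi>] x] bspec[OF elim(1) x] by simp_all
            then have "cmod (\<Psi> \<epsilon> \<xi> x * v \<epsilon> x) \<le> (1 / \<epsilon>) * \<epsilon> powr (- p)"
              unfolding norm_mult by (rule mult_mono) (use elim(4) in simp_all)
            also have "\<dots> = \<epsilon> powr (- (p + 1))" using elim(4) by (simp add: powr_diff powr_minus field_simps)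
            also have "\<dots> \<le> \<epsilon> powr (- N)" using elim(4) by (intro powr_mono') (auto simp: N_def)
            finally show ?thesis .
          qed
        qed
        also have "\<dots> \<le> (measure lborel K + 1) * \<epsilon> powr (- N)" by (intro mult_right_mono) auto
        finally show "cmod (fourier (\<lambda>x. \<Psi> \<epsilon> \<xi> x * v \<epsilon> x) \<xi>) \<le> (measure lborel K + 1) * \<epsilon> powr (- N)" .
      qed
    qed
    moreover have "measure lborel K + 1 > 0" by (simp add: add_nonneg_pos)
    ultimately show ?case by (intro exI[of _ "measure lborel K + 1"]) simp
  next
    case (Suc l)
    let ?T = "\<lambda>\<epsilon> \<xi>. transport_step a\<^sub>0 a \<epsilon> (b \<epsilon> \<xi>) (\<Psi> \<epsilon> \<xi>)" and ?Q = "\<lambda>\<epsilon> \<xi> x. \<Psi> \<epsilon> \<xi> x * b \<epsilon> \<xi> x"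
    have T: "slow_amplitude K \<Gamma> ?T" by (rule slow_amplitude_transport_step[OF clK Suc.prems b(1) coeff])
    have Q: "slow_amplitude K \<Gamma> ?Q" by (rule slow_amplitude_mult_symbol[OF clK Suc.prems b(1)])
    let ?e = "\<lambda>\<Psi> u \<epsilon> \<xi>. cmod (fourier (\<lambda>x. \<Psi> \<epsilon> \<xi> x * u \<epsilon> x) \<xi>)"
    obtain C1 where C1: "C1 > 0" "\<forall>\<^sub>F \<epsilon> in at_right 0. \<forall>\<xi>\<in>\<Gamma>. (1 + norm \<xi>) ^ l * ?e \<Psi> v \<epsilon> \<xi> \<le> C1 * \<epsilon> powr (- N)"
      using Suc.IH[OF Suc.prems] by (elim exE conjE) (rule that)
    obtain C2 where C2: "C2 > 0" "\<forall>\<^sub>F \<epsilon> in at_right 0. \<forall>\<xi>\<in>\<Gamma>. (1 + norm \<xi>) ^ l * ?e ?T v \<epsilon> \<xi> \<le> C2 * \<epsilon> powr (- N)"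
      using Suc.IH[OF T] by (elim exE conjE) (rule that)
    obtain C3 where C3: "C3 > 0" "\<forall>\<^sub>F \<epsilon> in at_right 0. \<forall>\<xi>\<in>\<Gamma>.
        (1 + norm \<xi>) ^ l * ?e ?Q (first_order_family a\<^sub>0 a v) \<epsilon> \<xi> \<le> C3 * \<epsilon> powr (- N\<^sub>f)"
      using f[OF Q, of l] by (elim exE conjE) (rule that)
    have sb: "\<forall>\<^sub>F \<epsilon> in at_right 0. \<forall>\<xi>\<in>\<Gamma>. \<exists>V. open V \<and> K \<subseteq> V \<and> smooth_on V (b \<epsilon> \<xi>)"
      using b(1) unfolding slow_symbol_def by (rule conjunct1)
    have "\<forall>\<^sub>F \<epsilon> in at_right 0. \<forall>\<xi>\<in>\<Gamma>. (1 + norm \<xi>) ^ Suc l * ?e \<Psi> v \<epsilon> \<xi> \<le> (C1 + C2 + C3) * \<epsilon> powr (- N)"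
      using C1(2) C2(2) C3(2) sb b(2) slow_amplitudeD(1)[OF Suc.prems] eventually_small[OF zero_less_one]
    proof eventually_elim
      case (elim \<epsilon>)
      then have \<epsilon>: "\<epsilon> \<in> {0<..1}" by simp
      show ?case
      proof
        fix \<xi> assume \<xi>: "\<xi> \<in> \<Gamma>"
        obtain V where V: "open V" "K \<subseteq> V" "smooth_on V (b \<epsilon> \<xi>)" using bspec[OF elim(4) \<xi>] by blast
        let ?W = "V \<inter> \<Omega>" and ?n = "(1 + norm \<xi>) ^ l"
        have W: "open ?W" "K \<subseteq> ?W" using V K(2) \<Omega> by auto
        have eq: "complex_of_real (norm \<xi>) * fourier (\<lambda>x. \<Psi> \<epsilon> \<xi> x * v \<epsilon> x) \<xi> =
            fourier (\<lambda>x. ?Q \<epsilon> \<xi> x * first_order_family a\<^sub>0 a v \<epsilon> x) \<xi> + fourier (\<lambda>x. ?T \<epsilon> \<xi> x * v \<epsilon> x) \<xi>"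
          by (rule fourier_parametrix_identity[OF K(1) W bspec[OF elim(6) \<xi>]])
            (use smooth_on_subset[OF V(3)] bspec[OF elim(5) \<xi>] smooth_on_subset[OF sa(1)[OF \<epsilon>]]
              smooth_on_subset[OF sa(2)[OF \<epsilon>]] smooth_on_subset[OF moderate_imp_smooth_on[OF v \<epsilon>]] in simp_all)
        have "norm \<xi> * ?e \<Psi> v \<epsilon> \<xi> = cmod (complex_of_real (norm \<xi>) * fourier (\<lambda>x. \<Psi> \<epsilon> \<xi> x * v \<epsilon> x) \<xi>)"
          by (simp add: norm_mult)
        also have "\<dots> \<le> ?e ?Q (first_order_family a\<^sub>0 a v) \<epsilon> \<xi> + ?e ?T v \<epsilon> \<xi>"
          unfolding eq by (rule norm_triangle_ineq)
        finally have "norm \<xi> * ?e \<Psi> v \<epsilon> \<xi> \<le> ?e ?Q (first_order_family a\<^sub>0 a v) \<epsilon> \<xi> + ?e ?T v \<epsilon> \<xi>" .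
        then have "(1 + norm \<xi>) * ?e \<Psi> v \<epsilon> \<xi>
            \<le> ?e \<Psi> v \<epsilon> \<xi> + (?e ?Q (first_order_family a\<^sub>0 a v) \<epsilon> \<xi> + ?e ?T v \<epsilon> \<xi>)"
          by (simp only: distrib_right mult_1_left add_left_mono)
        then have "?n * ((1 + norm \<xi>) * ?e \<Psi> v \<epsilon> \<xi>)
            \<le> ?n * (?e \<Psi> v \<epsilon> \<xi> + (?e ?Q (first_order_family a\<^sub>0 a v) \<epsilon> \<xi> + ?e ?T v \<epsilon> \<xi>))"
          by (rule mult_left_mono) simp
        also have "\<dots> = ?n * ?e \<Psi> v \<epsilon> \<xi> + (?n * ?e ?Q (first_order_family a\<^sub>0 a v) \<epsilon> \<xi> + ?n * ?e ?T v \<epsilon> \<xi>)"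
          by (simp only: distrib_left)
        also have "\<dots> \<le> C1 * \<epsilon> powr (- N) + (C3 * \<epsilon> powr (- N) + C2 * \<epsilon> powr (- N))"
        proof (intro add_mono)
          show "?n * ?e \<Psi> v \<epsilon> \<xi> \<le> C1 * \<epsilon> powr (- N)" by (rule bspec[OF elim(1) \<xi>])
          show "?n * ?e ?T v \<epsilon> \<xi> \<le> C2 * \<epsilon> powr (- N)" by (rule bspec[OF elim(2) \<xi>])
          have "C3 * \<epsilon> powr (- N\<^sub>f) \<le> C3 * \<epsilon> powr (- N)"
            using C3(1) elim(7) by (intro mult_left_mono powr_mono') (auto simp: N_def)
          with bspec[OF elim(3) \<xi>]
          show "?n * ?e ?Q (first_order_family a\<^sub>0 a v) \<epsilon> \<xi> \<le> C3 * \<epsilon> powr (- N)" by linarith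
        qed
        finally show "(1 + norm \<xi>) ^ Suc l * ?e \<Psi> v \<epsilon> \<xi> \<le> (C1 + C2 + C3) * \<epsilon> powr (- N)"
          by (simp only: power_Suc2 mult.assoc distrib_right add_ac)
      qed
    qed
    moreover have "C1 + C2 + C3 > 0" using C1 C2 C3 by simp
    ultimately show ?case by (intro exI[of _ "C1 + C2 + C3"] conjI)
  qed
  show ?thesis by (rule exI[of _ N], intro allI impI) (rule main)
qed

theorem proposition4p2:
  fixes \<Omega> U \<Gamma> :: "(real^'n::finite) set"
    and A\<^sub>0 :: "'n family set" and A :: "'n \<Rightarrow> 'n family set"
    and a\<^sub>0 :: "'n family" and a :: "'n \<Rightarrow> 'n family"
    and x\<^sub>0 \<xi>\<^sub>0 :: "real^'n" and u :: "'n family set"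
  assumes "open \<Omega>"
    and "A\<^sub>0 \<in> colombeau \<Omega>" and "\<And>j. A j \<in> colombeau \<Omega>"
    and "a\<^sub>0 \<in> A\<^sub>0" and "\<And>j. a j \<in> A j"
    and "\<And>K \<alpha>. compact K \<Longrightarrow> K \<subseteq> \<Omega> \<Longrightarrow> slow_scale (\<lambda>\<epsilon>. sup_on K (mderiv \<alpha> (a\<^sub>0 \<epsilon>)))"
    and "\<And>K \<alpha> j. compact K \<Longrightarrow> K \<subseteq> \<Omega> \<Longrightarrow> slow_scale (\<lambda>\<epsilon>. sup_on K (mderiv \<alpha> (a j \<epsilon>)))"
    and "x\<^sub>0 \<in> \<Omega>" and "\<xi>\<^sub>0 \<noteq> 0"
    and "open U" and "U \<subseteq> \<Omega>" and "x\<^sub>0 \<in> U"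
    and "open_cone \<Gamma>" and "\<xi>\<^sub>0 \<in> \<Gamma>"
    and "\<And>K. compact K \<Longrightarrow> K \<subseteq> U \<Longrightarrow>
      \<exists>(s :: real \<Rightarrow> real) (r :: real \<Rightarrow> real) \<epsilon>\<^sub>0.
        slow_scale s \<and> slow_scale r \<and> (\<forall>\<epsilon>\<in>{0<..1}. s \<epsilon> > 0 \<and> r \<epsilon> > 0) \<and> \<epsilon>\<^sub>0 > 0 \<and>
        (\<forall>x\<in>K. \<forall>\<xi>\<in>\<Gamma>. \<forall>\<epsilon>\<in>{0<..<\<epsilon>\<^sub>0}. norm \<xi> \<ge> r \<epsilon> \<longrightarrow>
           cmod (principal_symbol a \<epsilon> x \<xi>) \<ge> 1 / s \<epsilon> * (1 + norm \<xi>))"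
    and "u \<in> colombeau \<Omega>"
    and "(x\<^sub>0, \<xi>\<^sub>0) \<notin> WF_g \<Omega> (first_order_op \<Omega> A\<^sub>0 A u)"
  shows "(x\<^sub>0, \<xi>\<^sub>0) \<notin> WF_g \<Omega> u"
proof -
  note \<Omega> = assms(1)
  have mod: "a\<^sub>0 \<in> moderate \<Omega>" "\<And>j. a j \<in> moderate \<Omega>"
    using colombeau_imp_moderate[OF assms(2,4)] colombeau_imp_moderate[OF assms(3,5)] by auto
  note sa = moderate_imp_smooth_on[OF mod(1)] moderate_imp_smooth_on[OF mod(2)]
  have "microlocally_regular \<Omega> (first_order_op \<Omega> A\<^sub>0 A u) x\<^sub>0 \<xi>\<^sub>0"
    using assms(17) assms(8,9) unfolding WF_g_def by simp
  from regular_first_order_op_representative[OF assms(1-5,16) this]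
  obtain v where bv: "v \<in> u" "microlocally_regular_family \<Omega> (first_order_family a\<^sub>0 a v) x\<^sub>0 \<xi>\<^sub>0" .
  have v: "v \<in> moderate \<Omega>" by (rule colombeau_imp_moderate[OF assms(16) bv(1)])
  define f where "f = first_order_family a\<^sub>0 a v"
  have sf: "smooth_on \<Omega> (f \<epsilon>)" if "\<epsilon> \<in> {0<..1}" for \<epsilon>
    unfolding f_def by (intro smooth_on_first_order_family \<Omega> sa that moderate_imp_smooth_on[OF v])
  have "microlocally_regular_family \<Omega> f x\<^sub>0 \<xi>\<^sub>0" unfolding f_def by (rule bv(2))
  then obtain U' \<Gamma>' where U': "open U'" "U' \<subseteq> \<Omega>" "x\<^sub>0 \<in> U'" "open_cone \<Gamma>'" "\<xi>\<^sub>0 \<in> \<Gamma>'"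
    and reg: "\<And>\<phi>. \<phi> \<in> test_functions U' \<Longrightarrow> rapid_decay \<Gamma>' \<phi> f"
    unfolding microlocally_regular_family_def by blast
  let ?U = "U \<inter> U'" and ?\<Gamma> = "\<Gamma> \<inter> \<Gamma>'"
  have "rapid_decay ?\<Gamma> \<phi> v"
    if \<phi>: "\<phi> \<in> test_functions ?U" for \<phi>
  proof -
    obtain K where K: "compact K" "K \<subseteq> ?U" "\<phi> \<in> smooth_supp K"
      using test_functions_imp_smooth_supp[OF \<phi>] by blast
    have KU: "K \<subseteq> U" "K \<subseteq> U'" "K \<subseteq> \<Omega>" using K(2) assms(11) by auto
    have fc: "continuous_on K (f \<epsilon>)" if "\<epsilon> \<in> {0<..1}" for \<epsilon>
      by (rule continuous_on_subset[OF smooth_on_imp_continuous_on[OF sf[OF that]] KU(3)])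
    have regK: "rapid_decay ?\<Gamma> \<psi> f"
      if "\<psi> \<in> smooth_supp K" for \<psi>
      using reg[OF smooth_supp_imp_test_functions[OF K(1) KU(2) that]] by (meson IntD2)
    obtain N\<^sub>f where f: "\<And>\<Psi> l. slow_amplitude K ?\<Gamma> \<Psi> \<Longrightarrow> amplitude_decay ?\<Gamma> N\<^sub>f f \<Psi> l"
      using regular_imp_slow_amplitude_decay[OF K(1) fc regK] by blast
    have na: "slow_net K (\<lambda>\<epsilon>. jet k (a\<^sub>0 \<epsilon>))" "slow_net K (\<lambda>\<epsilon>. jet k (a j \<epsilon>))" for k j
      using slow_net_jet[OF \<Omega> sa(1) K(1) KU(3) assms(6)[OF K(1) KU(3)]]
        slow_net_jet[OF \<Omega> sa(2) K(1) KU(3) assms(7)[OF K(1) KU(3)]] by blast+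
    have coeff: "slow_symbol K ?\<Gamma> (\<lambda>\<epsilon> _. a\<^sub>0 \<epsilon>)" "slow_symbol K ?\<Gamma> (\<lambda>\<epsilon> _. a j \<epsilon>)" for j
      by (rule slow_symbol_coefficient[OF \<Omega> KU(3) sa(1) na(1)], assumption)
        (rule slow_symbol_coefficient[OF \<Omega> KU(3) sa(2) na(2)], assumption)
    obtain s r :: "real \<Rightarrow> real" and \<epsilon>\<^sub>0 where s: "slow_scale s" "\<And>\<epsilon>. \<epsilon> \<in> {0<..1} \<Longrightarrow> s \<epsilon> > 0" "\<epsilon>\<^sub>0 > 0"
      and low: "\<And>x \<xi> \<epsilon>. x \<in> K \<Longrightarrow> \<xi> \<in> \<Gamma> \<Longrightarrow> \<epsilon> \<in> {0<..<\<epsilon>\<^sub>0} \<Longrightarrow> norm \<xi> \<ge> r \<epsilon> \<Longrightarrow>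
        cmod (principal_symbol a \<epsilon> x \<xi>) \<ge> 1 / s \<epsilon> * (1 + norm \<xi>)"
      using assms(15)[OF K(1) KU(1)] by metis
    \<comment> \<open>The parametrix is the inverse of \<open>?h\<close>: by homogeneity it equals \<open>|\<xi>|\<close> over the principal symbol at \<open>\<xi>\<close>.\<close>
    let ?h = "\<lambda>\<epsilon> \<xi> x. principal_symbol a \<epsilon> x (sgn \<xi>)"
    have "\<forall>\<^sub>F \<epsilon> in at_right (0::real). 0 < \<epsilon> \<and> \<epsilon> < min 1 \<epsilon>\<^sub>0" by (rule eventually_small) (use s(3) in simp)
    then have low': "\<forall>\<^sub>F \<epsilon> in at_right 0. s \<epsilon> > 0 \<and> (\<forall>\<xi>\<in>?\<Gamma>. \<forall>x\<in>K. cmod (?h \<epsilon> \<xi> x) \<ge> 1 / s \<epsilon>)"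
    proof eventually_elim
      case (elim \<epsilon>)
      have se: "s \<epsilon> > 0" using elim by (intro s(2)) simp
      have "cmod (?h \<epsilon> \<xi> x) \<ge> 1 / s \<epsilon>" if "\<xi> \<in> ?\<Gamma>" "x \<in> K" for \<xi> x
        by (rule principal_symbol_sgn_lower_bound[OF assms(13) IntD1[OF that(1)] se low[OF that(2)]])
          (use elim in auto)
      then show ?case using se by blast
    qed
    have b: "slow_symbol K ?\<Gamma> (\<lambda>\<epsilon> \<xi> x. inverse (?h \<epsilon> \<xi> x))"
    proof (rule slow_symbol_inverse)
      show "slow_symbol K ?\<Gamma> ?h"
        by (rule slow_symbol_principal_symbol_sgn[OF \<Omega> KU(3) sa(2) na(2)])
      show "slow_net (?\<Gamma> \<times> K) (\<lambda>\<epsilon> p. inverse (cmod (?h \<epsilon> (fst p) (snd p))))"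
      proof (rule slow_net_mono[OF slow_scale_imp_slow_net[OF s(1)]])
        show "\<forall>\<^sub>F \<epsilon> in at_right 0. \<forall>p\<in>?\<Gamma> \<times> K. \<bar>inverse (cmod (?h \<epsilon> (fst p) (snd p)))\<bar> \<le> norm (s \<epsilon>)"
          using low'
        proof eventually_elim
          case (elim \<epsilon>)
          show ?case
          proof
            fix p assume "p \<in> ?\<Gamma> \<times> K"
            then have "1 / s \<epsilon> \<le> cmod (?h \<epsilon> (fst p) (snd p))" using elim by auto
            then have "inverse (cmod (?h \<epsilon> (fst p) (snd p))) \<le> inverse (1 / s \<epsilon>)"
              using elim by (intro le_imp_inverse_le) auto
            then show "\<bar>inverse (cmod (?h \<epsilon> (fst p) (snd p)))\<bar> \<le> norm (s \<epsilon>)" using elim by simp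
          qed
        qed
      qed
      show "\<forall>\<^sub>F \<epsilon> in at_right 0. \<forall>\<xi>\<in>?\<Gamma>. \<forall>x\<in>K. ?h \<epsilon> \<xi> x \<noteq> 0"
        using low' by eventually_elim force
    qed
    have bh: "\<forall>\<^sub>F \<epsilon> in at_right 0. \<forall>\<xi>\<in>?\<Gamma>. \<forall>x\<in>K.
        inverse (?h \<epsilon> \<xi> x) * principal_symbol a \<epsilon> x \<xi> = complex_of_real (norm \<xi>)"
      using low'
    proof eventually_elim
      case (elim \<epsilon>)
      show ?case
      proof (intro ballI)
        fix \<xi> x assume "\<xi> \<in> ?\<Gamma>" "x \<in> K"
        then have "?h \<epsilon> \<xi> x \<noteq> 0" using elim by force
        then show "inverse (?h \<epsilon> \<xi> x) * principal_symbol a \<epsilon> x \<xi> = complex_of_real (norm \<xi>)"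
          by (subst principal_symbol_sgn[symmetric]) simp
      qed
    qed
    obtain N where N: "\<And>\<Psi> l. slow_amplitude K ?\<Gamma> \<Psi> \<Longrightarrow> amplitude_decay ?\<Gamma> N v \<Psi> l"
      using slow_amplitude_decay[OF K(1) KU(3) \<Omega> v sa coeff b bh f[unfolded f_def]] by blast
    \<comment> \<open>The given test function is the constant amplitude.\<close>
    have "slow_amplitude K ?\<Gamma> (\<lambda>_ _. \<phi>)"
      unfolding slow_amplitude_def
    proof (intro conjI allI)
      fix k
      obtain B where "B \<ge> 0" "\<And>x. x \<in> K \<Longrightarrow> jet k \<phi> x \<le> B" using jet_bounded_smooth_supp[OF K(1,3)] by blast
      then show "slow_net (?\<Gamma> \<times> K) (\<lambda>_ p. jet k \<phi> (snd p))"
        by (intro slow_net_mono[OF slow_net_const[of _ B]] always_eventually) (auto simp: abs_of_nonneg[OF jet_nonneg])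
    qed (use K(3) in simp)
    note decay = N[OF this]
    have "\<exists>C>0. \<exists>\<epsilon>\<^sub>0>0. \<forall>\<xi>\<in>?\<Gamma>. \<forall>\<epsilon>\<in>{0<..<\<epsilon>\<^sub>0}.
        cmod (fourier (\<lambda>x. \<phi> x * v \<epsilon> x) \<xi>) \<le> C * \<epsilon> powr (- N) * (1 + norm \<xi>) powr (- real l)" for l
    proof -
      obtain C where C: "C > 0" "\<forall>\<^sub>F \<epsilon> in at_right 0. \<forall>\<xi>\<in>?\<Gamma>.
          (1 + norm \<xi>) ^ l * cmod (fourier (\<lambda>x. \<phi> x * v \<epsilon> x) \<xi>) \<le> C * \<epsilon> powr (- N)" using decay[of l] by blast
      obtain \<epsilon>1 where e1: "\<epsilon>1 > 0" "\<And>\<epsilon>. \<epsilon> \<in> {0<..<\<epsilon>1} \<Longrightarrow> \<forall>\<xi>\<in>?\<Gamma>.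
          (1 + norm \<xi>) ^ l * cmod (fourier (\<lambda>x. \<phi> x * v \<epsilon> x) \<xi>) \<le> C * \<epsilon> powr (- N)"
        using C(2) by (rule eventually_right0E) (rule that)
      have "cmod (fourier (\<lambda>x. \<phi> x * v \<epsilon> x) \<xi>) \<le> C * \<epsilon> powr (- N) * (1 + norm \<xi>) powr (- real l)"
        if "\<xi> \<in> ?\<Gamma>" "\<epsilon> \<in> {0<..<\<epsilon>1}" for \<xi> \<epsilon>
        using bspec[OF e1(2)[OF that(2)] that(1)] by (subst le_decay_iff) simp_all
      then show ?thesis using C(1) e1(1) by blast
    qed
    then show ?thesis by blast
  qed
  moreover have "open ?U" "?U \<subseteq> \<Omega>" "x\<^sub>0 \<in> ?U" "open_cone ?\<Gamma>" "\<xi>\<^sub>0 \<in> ?\<Gamma>"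
    using assms U' by (auto simp: open_cone_def)
  ultimately have "microlocally_regular_family \<Omega> v x\<^sub>0 \<xi>\<^sub>0"
    unfolding microlocally_regular_family_def by blast
  then have "microlocally_regular \<Omega> u x\<^sub>0 \<xi>\<^sub>0" using bv(1) unfolding microlocally_regular_def by blast
  then show ?thesis unfolding WF_g_def by simp
qed

end
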